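(* The free unital JB-algebra generated by two projections exists and is isomorphic to the JC-algebra $$J:=\{f\in C([0,1],M_2(\mathbb{R})_{sa}) : f(0), f(1)\text{ are diagonal}\}$$ via an isomorphism carrying the generating projections into the functions $$p_1(t):=\begin{pmatrix}1&0\\0&0\end{pmatrix},\qquad p_2(t):=\begin{pmatrix}t&\sqrt{t(1-t)}\\ \sqrt{t(1-t)}&1-t\end{pmatrix}\qquad (t\in[0,1]).$$ That is, $(J,(p_1,p_2))$ is a free unital JB-algebra generated by two projections.
   Context: A real Jordan algebra is a real vector space with a commutative bilinear product $\circ$ satisfying $x\circ(y\circ x^2)=(x\circ y)\circ x^2$. A JB-algebra is a real Jordan algebra complete in a norm satisfying $\|x\circ y\|\le\|x\|\|y\|$, $\|x\|^2=\|x^2\|$ and $\|x^2\|\le\|x^2+y^2\|$. A Jordan homomorphism is a linear map preserving $\circ$; it is unital if it maps the unit element to the unit element. A projection is an element $p$ with $p\circ p=p$. A JC-algebra is a JB-algebra isometrically isomorphic to a norm-closed Jordan subalgebra of $B(H)_{sa}$ (bounded self-adjoint operators on a complex Hilbert space $H$, with product $\frac12(xy+yx)$). $M_2(\mathbb{R})_{sa}$ denotes the real symmetric $2\times2$ matrices with the Jordan product $x\circ y=\frac12(xy+yx)$ and the operator norm; $C([0,1],M_2(\mathbb{R})_{sa})$ carries the pointwise Jordan product and the supremum norm. For a positive integer $n$, a free unital JB-algebra generated by $n$ projections is a unital JB-algebra $J$ together with an $n$-tuple $(p_i)_{i=1}^n$ of projections in $J$ such that for every unital JB-algebra $T$ and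 every $n$-tuple $(q_i)_{i=1}^n$ of projections in $T$ there exists a unique unital Jordan homomorphism $\phi\colon J\to T$ with $\phi(p_i)=q_i$ for all $i\in\{1,\dots,n\}$. It is unique up to unique isomorphism. *)

theory Defs
  imports "HOL-Analysis.Analysis" "HOL-Algebra.Module"
begin

section \<open>Vector spaces, norms and linear maps on explicit carriers\<close>

definition scalar_ring :: "'k::field ring" where
  "scalar_ring = \<lparr>carrier = UNIV, mult = (*), one = 1, zero = 0, add = (+)\<rparr>"

text \<open>The value outside the carrier is irrelevant; it is fixed to 0 because the locale
  \<open>Metric_space\<close> asks for symmetry and nonnegativity on the whole type.\<close>

definition norm_dist :: "('k, 'a, 'm) module_scheme \<Rightarrow> ('a \<Rightarrow> real) \<Rightarrow> 'a \<Rightarrow> 'a \<Rightarrow> real" where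
  "norm_dist M N x y =
     (if x \<in> carrier M \<and> y \<in> carrier M then N (x \<ominus>\<^bsub>M\<^esub> y) else 0)"

definition linear_maps ::
  "('k, 'a, 'm) module_scheme \<Rightarrow> ('k, 'b, 'n) module_scheme \<Rightarrow> ('a \<Rightarrow> 'b) set" where
  "linear_maps A B =
     {f \<in> carrier A \<rightarrow> carrier B.
        (\<forall>x\<in>carrier A. \<forall>y\<in>carrier A. f (x \<oplus>\<^bsub>A\<^esub> y) = f x \<oplus>\<^bsub>B\<^esub> f y) \<and>
        (\<forall>a. \<forall>x\<in>carrier A. f (a \<odot>\<^bsub>A\<^esub> x) = a \<odot>\<^bsub>B\<^esub> f x)}"


section \<open>JB-algebras\<close>

text \<open>The record field \<open>mult\<close> (written \<open>\<otimes>\<close>) holds the Jordan product, which in general is not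
  associative. The field \<open>one\<close> is meaningful only for unital algebras.\<close>

record 'a normed_alg = "(real, 'a) module" +
  nrm :: "'a \<Rightarrow> real"

locale real_jordan_algebra = Module.module scalar_ring A
  for A :: "(real, 'a, 'm) module_scheme" (structure) +
  assumes jprod_closed: "\<lbrakk>x \<in> carrier A; y \<in> carrier A\<rbrakk> \<Longrightarrow> x \<otimes> y \<in> carrier A"
    and jprod_comm: "\<lbrakk>x \<in> carrier A; y \<in> carrier A\<rbrakk> \<Longrightarrow> x \<otimes> y = y \<otimes> x"
    and jprod_add: "\<lbrakk>x \<in> carrier A; y \<in> carrier A; z \<in> carrier A\<rbrakk> \<Longrightarrow>
      (x \<oplus> y) \<otimes> z = (x \<otimes> z) \<oplus> (y \<otimes> z)"
    and jprod_smult: "\<lbrakk>x \<in> carrier A; y \<in> carrier A\<rbrakk> \<Longrightarrow> (a \<odot> x) \<otimes> y = a \<odot> (x \<otimes> y)"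
    and jordan_identity: "\<lbrakk>x \<in> carrier A; y \<in> carrier A\<rbrakk> \<Longrightarrow>
      x \<otimes> (y \<otimes> (x \<otimes> x)) = (x \<otimes> y) \<otimes> (x \<otimes> x)"

locale jb_algebra = real_jordan_algebra A
  for A :: "'a normed_alg" (structure) +
  assumes nrm_nonneg: "x \<in> carrier A \<Longrightarrow> 0 \<le> nrm A x"
    and nrm_eq_zero: "x \<in> carrier A \<Longrightarrow> nrm A x = 0 \<longleftrightarrow> x = \<zero>"
    and nrm_triangle: "\<lbrakk>x \<in> carrier A; y \<in> carrier A\<rbrakk> \<Longrightarrow> nrm A (x \<oplus> y) \<le> nrm A x + nrm A y"
    and nrm_smult: "x \<in> carrier A \<Longrightarrow> nrm A (a \<odot> x) = \<bar>a\<bar> * nrm A x"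
    and complete: "Metric_space.mcomplete (carrier A) (norm_dist A (nrm A))"
    and nrm_jprod: "\<lbrakk>x \<in> carrier A; y \<in> carrier A\<rbrakk> \<Longrightarrow> nrm A (x \<otimes> y) \<le> nrm A x * nrm A y"
    and nrm_square: "x \<in> carrier A \<Longrightarrow> (nrm A x)\<^sup>2 = nrm A (x \<otimes> x)"
    and nrm_square_add: "\<lbrakk>x \<in> carrier A; y \<in> carrier A\<rbrakk> \<Longrightarrow>
      nrm A (x \<otimes> x) \<le> nrm A ((x \<otimes> x) \<oplus> (y \<otimes> y))"

locale unital_jb_algebra = jb_algebra A
  for A :: "'a normed_alg" (structure) +
  assumes unit_closed: "\<one> \<in> carrier A"
    and unit: "x \<in> carrier A \<Longrightarrow> \<one> \<otimes> x = x"

definition jordan_hom :: "'a normed_alg \<Rightarrow> 'b normed_alg \<Rightarrow> ('a \<Rightarrow> 'b) set" where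
  "jordan_hom A B =
     {f \<in> linear_maps A B.
        \<forall>x\<in>carrier A. \<forall>y\<in>carrier A. f (x \<otimes>\<^bsub>A\<^esub> y) = f x \<otimes>\<^bsub>B\<^esub> f y}"

definition unital_jordan_hom :: "'a normed_alg \<Rightarrow> 'b normed_alg \<Rightarrow> ('a \<Rightarrow> 'b) set" where
  "unital_jordan_hom A B = {f \<in> jordan_hom A B. f \<one>\<^bsub>A\<^esub> = \<one>\<^bsub>B\<^esub>}"

definition jordan_iso :: "'a normed_alg \<Rightarrow> 'b normed_alg \<Rightarrow> ('a \<Rightarrow> 'b) set" where
  "jordan_iso A B = {f \<in> jordan_hom A B. bij_betw f (carrier A) (carrier B)}"

definition projections :: "'a normed_alg \<Rightarrow> 'a set" where
  "projections A = {p \<in> carrier A. p \<otimes>\<^bsub>A\<^esub> p = p}"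

text \<open>HOL cannot quantify over types inside a formula. The test algebras \<open>T\<close> therefore range over
  all unital JB-algebras whose elements have type \<open>'b\<close>; freeness among all unital JB-algebras is
  this predicate for every \<open>'b\<close>, i.e. with a type variable for \<open>'b\<close> at the theorem level.
  Homomorphisms are taken extensional, so that uniqueness means uniqueness on the carrier.\<close>

definition free_unital_jb_algebra ::
  "'b itself \<Rightarrow> nat \<Rightarrow> 'a normed_alg \<Rightarrow> (nat \<Rightarrow> 'a) \<Rightarrow> bool" where
  "free_unital_jb_algebra (_ :: 'b itself) n J p \<longleftrightarrow>
     unital_jb_algebra J \<and> (\<forall>i\<in>{1..n}. p i \<in> projections J) \<and>
     (\<forall>(T :: 'b normed_alg) q.
        unital_jb_algebra T \<and> (\<forall>i\<in>{1..n}. q i \<in> projections T) \<longrightarrow>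
        (\<exists>!\<phi>. \<phi> \<in> extensional (carrier J) \<and> \<phi> \<in> unital_jordan_hom J T \<and>
              (\<forall>i\<in>{1..n}. \<phi> (p i) = q i)))"


section \<open>JC-algebras\<close>

text \<open>Fields \<open>mult\<close> and \<open>one\<close> of the underlying module record are not used.\<close>

record 'h inner_space = "(complex, 'h) module" +
  cinner :: "'h \<Rightarrow> 'h \<Rightarrow> complex"

definition hnorm :: "'h inner_space \<Rightarrow> 'h \<Rightarrow> real" where
  "hnorm H x = sqrt (Re (cinner H x x))"

locale complex_hilbert_space = Module.module scalar_ring H
  for H :: "'h inner_space" (structure) +
  assumes cinner_add: "\<lbrakk>x \<in> carrier H; y \<in> carrier H; z \<in> carrier H\<rbrakk> \<Longrightarrow>
      cinner H (x \<oplus> y) z = cinner H x z + cinner H y z"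
    and cinner_smult: "\<lbrakk>x \<in> carrier H; y \<in> carrier H\<rbrakk> \<Longrightarrow> cinner H (a \<odot> x) y = a * cinner H x y"
    and cinner_cnj: "\<lbrakk>x \<in> carrier H; y \<in> carrier H\<rbrakk> \<Longrightarrow> cinner H y x = cnj (cinner H x y)"
    and cinner_nonneg: "x \<in> carrier H \<Longrightarrow> 0 \<le> Re (cinner H x x)"
    and cinner_eq_zero: "\<lbrakk>x \<in> carrier H; cinner H x x = 0\<rbrakk> \<Longrightarrow> x = \<zero>"
    and complete: "Metric_space.mcomplete (carrier H) (norm_dist H (hnorm H))"

definition bounded_sa_operators :: "'h inner_space \<Rightarrow> ('h \<Rightarrow> 'h) set" where
  "bounded_sa_operators H =
     {S \<in> linear_maps H H. S \<in> extensional (carrier H) \<and>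
        (\<exists>K. \<forall>x\<in>carrier H. hnorm H (S x) \<le> K * hnorm H x) \<and>
        (\<forall>x\<in>carrier H. \<forall>y\<in>carrier H. cinner H (S x) y = cinner H x (S y))}"

definition BH_sa :: "'h inner_space \<Rightarrow> ('h \<Rightarrow> 'h) normed_alg" where
  "BH_sa H = \<lparr>
     carrier = bounded_sa_operators H,
     mult = (\<lambda>S T. \<lambda>x\<in>carrier H. complex_of_real (1/2) \<odot>\<^bsub>H\<^esub> (S (T x) \<oplus>\<^bsub>H\<^esub> T (S x))),
     one = (\<lambda>x\<in>carrier H. x),
     zero = (\<lambda>x\<in>carrier H. \<zero>\<^bsub>H\<^esub>),
     add = (\<lambda>S T. \<lambda>x\<in>carrier H. S x \<oplus>\<^bsub>H\<^esub> T x),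
     smult = (\<lambda>a S. \<lambda>x\<in>carrier H. complex_of_real a \<odot>\<^bsub>H\<^esub> S x),
     nrm = (\<lambda>S. Sup {hnorm H (S x) | x. x \<in> carrier H \<and> hnorm H x \<le> 1})\<rparr>"

definition norm_closed_jordan_subalgebra :: "'a set \<Rightarrow> 'a normed_alg \<Rightarrow> bool" where
  "norm_closed_jordan_subalgebra B A \<longleftrightarrow>
     submodule B scalar_ring A \<and> (\<forall>x\<in>B. \<forall>y\<in>B. x \<otimes>\<^bsub>A\<^esub> y \<in> B) \<and>
     closedin (Metric_space.mtopology (carrier A) (norm_dist A (nrm A))) B"

text \<open>The type \<open>'h\<close> only provides room for the elements of the Hilbert space.\<close>

definition jc_algebra :: "'h itself \<Rightarrow> 'a normed_alg \<Rightarrow> bool" where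
  "jc_algebra (_ :: 'h itself) A \<longleftrightarrow>
     jb_algebra A \<and>
     (\<exists>(H :: 'h inner_space) B \<psi>.
        complex_hilbert_space H \<and> norm_closed_jordan_subalgebra B (BH_sa H) \<and>
        \<psi> \<in> jordan_iso A ((BH_sa H)\<lparr>carrier := B\<rparr>) \<and>
        (\<forall>x\<in>carrier A. nrm (BH_sa H) (\<psi> x) = nrm A x))"


section \<open>The algebra of functions on the unit interval\<close>

definition C01_M2_sa :: "(real \<Rightarrow> real^2^2) normed_alg" where
  "C01_M2_sa = \<lparr>
     carrier = {f \<in> {0..1} \<rightarrow>\<^sub>E {M. transpose M = M}. continuous_on {0..1} f},
     mult = (\<lambda>f g. \<lambda>t\<in>{0..1}. (1/2) *\<^sub>R (f t ** g t + g t ** f t)),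
     one = (\<lambda>t\<in>{0..1}. mat 1),
     zero = (\<lambda>t\<in>{0..1}. 0),
     add = (\<lambda>f g. \<lambda>t\<in>{0..1}. f t + g t),
     smult = (\<lambda>a f. \<lambda>t\<in>{0..1}. a *\<^sub>R f t),
     nrm = (\<lambda>f. SUP t\<in>{0..1}. onorm (\<lambda>x. f t *v x))\<rparr>"

definition is_diagonal :: "real^2^2 \<Rightarrow> bool" where
  "is_diagonal M \<longleftrightarrow> (\<forall>i j. i \<noteq> j \<longrightarrow> M $ i $ j = 0)"

definition J_alg :: "(real \<Rightarrow> real^2^2) normed_alg" where
  "J_alg = C01_M2_sa
     \<lparr>carrier := {f \<in> carrier C01_M2_sa. is_diagonal (f 0) \<and> is_diagonal (f 1)}\<rparr>"

definition J_p1 :: "real \<Rightarrow> real^2^2" where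
  "J_p1 = (\<lambda>t\<in>{0..1}. vector [vector [1, 0], vector [0, 0]])"

definition J_p2 :: "real \<Rightarrow> real^2^2" where
  "J_p2 = (\<lambda>t\<in>{0..1}.
     vector [vector [t, sqrt (t * (1 - t))], vector [sqrt (t * (1 - t)), 1 - t]])"

definition J_gens :: "nat \<Rightarrow> real \<Rightarrow> real^2^2" where
  "J_gens i = (if i = 1 then J_p1 else J_p2)"

end

theory Submission
  imports Defs "HOL-Computational_Algebra.Fundamental_Theorem_Algebra"
    "HOL-Analysis.Finite_Function_Topology"
begin

text \<open>Let \<open>p\<close>, \<open>q\<close> be projections in a unital JB-algebra \<open>T\<close>. By the polarized Jordan identity,
  multiplication by \<open>c = 1 - (p - q)\<^sup>2 = (1 - p - q)\<^sup>2\<close> commutes with multiplication by \<open>p\<close> and by \<open>q\<close>, so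
  the Jordan algebra generated by \<open>1, p, q\<close> is spanned over the polynomials in \<open>c\<close> by \<open>p\<close>, \<open>1 - p\<close> and the
  off-diagonal Peirce part \<open>y\<close> of \<open>q\<close>, and \<open>y\<^sup>2 = c (1 - c)\<close>. In the matrix algebra \<open>c\<close> is the function
  \<open>t\<close> and \<open>y\<close> has off-diagonal entry \<open>sqrt (t (1 - t))\<close>; there these elements are dense by Weierstrass
  approximation. The resulting homomorphism into \<open>T\<close> is bounded: a polynomial positive on \<open>[0,1]\<close> is a
  sum of terms \<open>t\<^sup>i (1 - t)\<^sup>j r\<^sup>2\<close>, each of which becomes a sum of squares at \<open>c\<close>, and sums of squares in
  \<open>T\<close> are squares because \<open>1 - u\<close> has a square root for \<open>\<parallel>u\<parallel> \<le> 1\<close>. Hence it extends by continuity.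
  Uniqueness holds because every unital homomorphism maps squares to squares and is therefore bounded.
  Pointwise multiplication on \<open>\<ell>\<^sup>2([0,1], \<complex>\<^sup>2)\<close> represents the matrix algebra isometrically.\<close>

section \<open>Jordan algebras as total structures on a vector space\<close>

text \<open>Write L_x for multiplication by x. The choice of \<open>c\<close> is forced: the
  linearized Jordan identity at p, q, p reads [L_p, L_q] = 2 [L_p, L_{pq}], so L_p commutes with
  multiplication by 2pq - q and, by symmetry, L_q with multiplication by 2pq - p; e - p - q + 2pq
  serves both. The obstacle is that homomorphisms carry no continuity, and that the only order
  information in the axioms is the inequality for sums of squares. Only squares can be transported
  between the algebras, so every norm bound passes through explicit square roots, and positivity on
  [0,1] has to come with an algebraic certificate. Off-diagonal elements are bounded through their
  squares, which are diagonal. The constants 3, 8 and 9 that arise are crude; extension and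
  uniqueness use boundedness alone. The Hilbert space carries counting measure on the interval so
  that a vector concentrated at one point tests the matrix at that point; this makes the
  representation exactly isometric.\<close>

text \<open>The product is total on a vector space type. The algebra proper is the subspace of all \<open>x\<close> with
  \<open>e \<star> x = x\<close>, and \<open>x \<mapsto> e \<star> x\<close> is a projection onto it through which the product factors.\<close>

locale jordan_space =
  fixes jp :: "'v::real_vector \<Rightarrow> 'v \<Rightarrow> 'v" (infixl \<open>\<star>\<close> 70) and e :: 'v
  assumes add_left: "(x + y) \<star> z = x \<star> z + y \<star> z"
    and scale_left: "(a *\<^sub>R x) \<star> y = a *\<^sub>R (x \<star> y)"
    and comm: "x \<star> y = y \<star> x"
    and jordan: "x \<star> (y \<star> (x \<star> x)) = (x \<star> y) \<star> (x \<star> x)"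
    and unit_prod: "e \<star> (x \<star> y) = x \<star> y"
    and unit_absorb: "(e \<star> x) \<star> y = x \<star> y"
    and unit_idem: "e \<star> e = e"
begin

lemma add_right: "z \<star> (x + y) = z \<star> x + z \<star> y"
  by (metis add_left comm)

lemma scale_right: "x \<star> (a *\<^sub>R y) = a *\<^sub>R (x \<star> y)"
  by (metis scale_left comm)

lemma zero_left [simp]: "0 \<star> x = 0"
  by (metis scale_left scale_zero_left)

lemma zero_right [simp]: "x \<star> 0 = 0"
  by (metis comm zero_left)

lemma minus_left: "(- x) \<star> y = - (x \<star> y)"
  by (metis scale_left scaleR_minus1_left)

lemma minus_right: "x \<star> (- y) = - (x \<star> y)"
  by (metis comm minus_left)

lemma diff_left: "(x - y) \<star> z = x \<star> z - y \<star> z"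
  by (metis add_left minus_left uminus_add_conv_diff add.commute)

lemma diff_right: "z \<star> (x - y) = z \<star> x - z \<star> y"
  by (metis comm diff_left)

lemmas bilin = add_left add_right scale_left scale_right minus_left minus_right diff_left diff_right

lemma unit_absorb_right: "x \<star> (e \<star> y) = x \<star> y"
  by (metis comm unit_absorb)

lemma jordan_polarized:
  "((x \<star> y) \<star> w) \<star> z + ((y \<star> z) \<star> w) \<star> x + ((z \<star> x) \<star> w) \<star> y =
   (x \<star> y) \<star> (w \<star> z) + (y \<star> z) \<star> (w \<star> x) + (z \<star> x) \<star> (w \<star> y)" (is "?L = ?R")
proof -
  \<comment> \<open>\<open>F\<close> is cubic in \<open>u\<close>, so its alternating sum over the
    nonempty partial sums of \<open>x\<close>, \<open>y\<close>, \<open>z\<close> keeps only the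
    trilinear part. Commutativity makes every term occur twice, whence the factor 2.\<close>
  define F where "F u = u \<star> (w \<star> (u \<star> u)) - (u \<star> w) \<star> (u \<star> u)" for u
  have F0: "F u = 0" for u by (simp add: F_def jordan)
  have "2 *\<^sub>R (?L - ?R) = F (x + y + z) - F (x + y) - F (y + z) - F (x + z) + F x + F y + F z"
    unfolding F_def by (simp add: bilin comm scaleR_2)
  then have "2 *\<^sub>R (?L - ?R) = 0" by (simp only: F0, simp)
  then show ?thesis by simp
qed

text \<open>Jordan theory calls this operator commutativity; the commutative law of the product says
  nothing about it.\<close>

definition commuting :: "'v \<Rightarrow> 'v \<Rightarrow> bool" where
  "commuting x y \<longleftrightarrow> (\<forall>w. x \<star> (y \<star> w) = y \<star> (x \<star> w))"

lemma commutingD: "commuting x y \<Longrightarrow> x \<star> (y \<star> w) = y \<star> (x \<star> w)"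
  by (simp add: commuting_def)

lemma commuting_sym: "commuting x y \<Longrightarrow> commuting y x"
  by (simp add: commuting_def)

text \<open>This is the Jordan identity itself, read through commutativity.\<close>

lemma commuting_square: "commuting (x \<star> x) x"
proof -
  have "(x \<star> x) \<star> (x \<star> w) = x \<star> ((x \<star> x) \<star> w)" for w
    using jordan[of x w] by (simp add: comm)
  then show ?thesis by (simp add: commuting_def)
qed

lemma commuting_unit: "commuting e x"
  by (simp add: commuting_def unit_prod unit_absorb_right)

text \<open>The polarized identity as an operator acting on \<open>w\<close>: the commutators
  [L_{xy}, L_z], summed cyclically, vanish. Repeating arguments turns this into commutation rules
  for idempotents and squares.\<close>

lemma commutator_cycle:
  "(x \<star> y) \<star> (z \<star> w) - z \<star> ((x \<star> y) \<star> w) + ((y \<star> z) \<star> (x \<star> w) - x \<star> ((y \<star> z) \<star> w))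
   + ((z \<star> x) \<star> (y \<star> w) - y \<star> ((z \<star> x) \<star> w)) = 0"
  using jordan_polarized[of x y w z] by (simp add: comm algebra_simps)

text \<open>The polarized identity read as an identity of operators in its argument \<open>z\<close>.\<close>

lemma prod3_operator:
  "((x \<star> y) \<star> w) \<star> z = (x \<star> y) \<star> (w \<star> z) + (w \<star> x) \<star> (y \<star> z) + (w \<star> y) \<star> (x \<star> z)
     - x \<star> (w \<star> (y \<star> z)) - y \<star> (w \<star> (x \<star> z))"
  using jordan_polarized[of x y w z] by (simp add: comm algebra_simps)


section \<open>Polynomials in a multiplication operator\<close>

definition evalp :: "'v \<Rightarrow> real poly \<Rightarrow> 'v \<Rightarrow> 'v" where
  "evalp c f x = fold_coeffs (\<lambda>a y. a *\<^sub>R x + c \<star> y) f 0"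

lemma evalp_0 [simp]: "evalp c 0 x = 0"
  by (simp add: evalp_def)

lemma evalp_pCons [simp]: "evalp c (pCons a f) x = a *\<^sub>R x + c \<star> evalp c f x"
  by (cases "a = 0 \<and> f = 0") (auto simp: evalp_def)

lemma evalp_1 [simp]: "evalp c 1 x = x"
  by (simp add: one_pCons)

lemma evalp_add: "evalp c (f + g) x = evalp c f x + evalp c g x"
  by (induction f g rule: poly_induct2) (auto simp: bilin algebra_simps)

lemma evalp_smult: "evalp c (Polynomial.smult a f) x = a *\<^sub>R evalp c f x"
  by (induction f) (auto simp: bilin algebra_simps)

lemma evalp_minus: "evalp c (- f) x = - evalp c f x"
  using evalp_smult[of c "-1" f x] by simp

lemma evalp_diff: "evalp c (f - g) x = evalp c f x - evalp c g x"
  by (metis diff_conv_add_uminus evalp_add evalp_minus)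

lemma evalp_shift: "evalp c f (c \<star> x) = c \<star> evalp c f x"
  by (induction f) (auto simp: bilin)

text \<open>\<open>evalp c f\<close> is the operator f(L_c), and operators compose associatively
  even though the Jordan product does not.\<close>

lemma evalp_mult: "evalp c (f * g) x = evalp c f (evalp c g x)"
  by (induction f) (auto simp: evalp_add evalp_smult)

lemma evalp_add_right: "evalp c f (x + y) = evalp c f x + evalp c f y"
  by (induction f) (auto simp: bilin algebra_simps)

lemma evalp_scale_right: "evalp c f (a *\<^sub>R x) = a *\<^sub>R evalp c f x"
  by (induction f) (auto simp: bilin algebra_simps)

lemma evalp_zero_right [simp]: "evalp c f 0 = 0"
  by (induction f) auto

lemma evalp_commute: "commuting x c \<Longrightarrow> x \<star> evalp c f v = evalp c f (x \<star> v)"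
  by (induction f) (auto simp: bilin commutingD)

text \<open>Commutation with \<open>c\<close> has to survive multiplication by \<open>c\<close>;
  demanding it of \<open>u\<close> and of \<open>c \<star> u\<close> at once makes the property
  hereditary.\<close>

definition central_for :: "'v \<Rightarrow> 'v \<Rightarrow> bool" where
  "central_for c u \<longleftrightarrow> commuting u c \<and> commuting (c \<star> u) c"

text \<open>\<open>prod3_operator\<close> writes multiplication by
  \<open>c \<star> (c \<star> v)\<close> through the multiplications by \<open>c\<close>,
  \<open>v\<close>, \<open>c \<star> v\<close> and \<open>c \<star> c\<close>, all of which commute
  with that by \<open>c\<close>.\<close>

lemma central_for_mult:
  assumes "central_for c v"
  shows "central_for c (c \<star> v)"
proof -
  have 1: "v \<star> (c \<star> w) = c \<star> (v \<star> w)" and 2: "(c \<star> v) \<star> (c \<star> w) = c \<star> ((c \<star> v) \<star> w)"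
    and 3: "(c \<star> c) \<star> (c \<star> w) = c \<star> ((c \<star> c) \<star> w)" for w
    using assms commuting_square[of c] by (simp_all add: central_for_def commuting_def)
  have *: "(c \<star> (c \<star> v)) \<star> z = 2 *\<^sub>R ((c \<star> v) \<star> (c \<star> z)) + (c \<star> c) \<star> (v \<star> z)
      - c \<star> (c \<star> (v \<star> z)) - v \<star> (c \<star> (c \<star> z))" for z
    using prod3_operator[of c v c z] by (simp add: comm scaleR_2)
  have "(c \<star> (c \<star> v)) \<star> (c \<star> w) = c \<star> ((c \<star> (c \<star> v)) \<star> w)" for w
    unfolding * by (simp add: bilin 1 2 3)
  then show ?thesis using assms by (simp add: central_for_def commuting_def)
qed

lemma central_for_evalp: "central_for c u \<Longrightarrow> commuting (evalp c f u) c"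
proof (induction f arbitrary: u)
  case (pCons a f)
  have "commuting (evalp c f (c \<star> u)) c"
    using pCons central_for_mult by blast
  then show ?case
    using pCons.prems by (simp add: central_for_def commuting_def evalp_shift bilin)
qed (simp add: commuting_def)

text \<open>Multiplication by \<open>evalp c f u\<close> commutes with that by \<open>c\<close>, so
  \<open>evalp c g\<close> is pulled out first; then \<open>evalp c f\<close> is pulled past
  \<open>v\<close>. Polynomials in \<open>c\<close> thus behave like scalars.\<close>

lemma evalp_prod:
  assumes "central_for c u" "commuting v c"
  shows "evalp c f u \<star> evalp c g v = evalp c (f * g) (u \<star> v)"
proof -
  have "evalp c f u \<star> evalp c g v = evalp c g (v \<star> evalp c f u)"
    using evalp_commute[OF central_for_evalp[OF assms(1)]] by (simp add: comm)
  also have "\<dots> = evalp c (g * f) (v \<star> u)"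
    by (simp add: evalp_commute[OF assms(2)] evalp_mult)
  finally show ?thesis by (simp add: mult.commute comm)
qed

lemma central_for_add: "central_for c u \<Longrightarrow> central_for c v \<Longrightarrow> central_for c (u + v)"
  by (simp add: central_for_def commuting_def bilin)

lemma central_for_scale: "central_for c u \<Longrightarrow> central_for c (a *\<^sub>R u)"
  by (simp add: central_for_def commuting_def bilin)

lemma central_for_diff: "central_for c u \<Longrightarrow> central_for c v \<Longrightarrow> central_for c (u - v)"
  by (simp add: central_for_def commuting_def bilin)

lemma central_for_unit: "central_for c e"
  by (metis central_for_def comm commuting_sym commuting_unit commuting_def unit_absorb)

text \<open>L_p has eigenvalues 0, 1/2 and 1, so the hypothesis on \<open>z\<close> says that its
  Peirce half component vanishes. The cycle at p, p, u gives [L_p, L_u] + 2 [L_{pu}, L_p] = 0; at u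
  = pz this kills the commutator with pz, and then u = z gives the claim.\<close>

lemma idempotent_commuting:
  assumes "p \<star> p = p" "p \<star> (p \<star> z) = p \<star> z"
  shows "commuting p z"
proof -
  have *: "p \<star> (u \<star> w) - u \<star> (p \<star> w) + 2 *\<^sub>R ((p \<star> u) \<star> (p \<star> w) - p \<star> ((p \<star> u) \<star> w)) = 0" for u w
    using commutator_cycle[of p p u w] by (simp add: assms comm[of u p] scaleR_2 algebra_simps)
  have 1: "(p \<star> z) \<star> (p \<star> w) = p \<star> ((p \<star> z) \<star> w)" for w
    using *[of "p \<star> z" w] by (simp add: assms scaleR_2)
  show ?thesis using *[of z] unfolding commuting_def by (simp add: 1)
qed

text \<open>\<open>c \<star> c\<close> has no Peirce half component relative to \<open>p\<close>,
  hence commutes with \<open>p\<close>. The commutator cycle at c, c, p then leaves twice the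
  commutator of \<open>c \<star> p\<close> with \<open>c\<close>.\<close>

lemma idempotent_central_for:
  assumes p: "p \<star> p = p" and pc: "commuting p c"
  shows "central_for c p"
proof -
  have "p \<star> (p \<star> (c \<star> c)) = p \<star> (c \<star> c)"
    using pc p by (simp add: commutingD comm[of p c])
  then have "commuting p (c \<star> c)"
    using p by (rule idempotent_commuting[rotated])
  from commutingD[OF this] have "2 *\<^sub>R ((c \<star> p) \<star> (c \<star> w) - c \<star> ((c \<star> p) \<star> w)) = 0" for w
    using commutator_cycle[of c c p w] by (simp add: comm[of p c] scaleR_2)
  then show ?thesis using pc by (simp add: central_for_def commuting_def)
qed

end

locale jordan_two_idempotents = jordan_space +
  fixes p q
  assumes p_idem: "p \<star> p = p" and q_idem: "q \<star> q = q"
    and unit_p: "e \<star> p = p" and unit_q: "e \<star> q = q"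
begin

definition c where "c = e - p - q + 2 *\<^sub>R (p \<star> q)"

lemma commuting_p_c: "commuting p c"
  unfolding commuting_def
proof
  fix w
  have "2 *\<^sub>R ((p \<star> q) \<star> (p \<star> w)) - 2 *\<^sub>R (p \<star> ((p \<star> q) \<star> w)) + (p \<star> (q \<star> w) - q \<star> (p \<star> w)) = 0"
    using commutator_cycle[of p q p w] by (simp add: p_idem comm[of q p] scaleR_2 algebra_simps)
  moreover have "p \<star> (e \<star> w) = e \<star> (p \<star> w)"
    by (simp add: unit_prod unit_absorb_right)
  ultimately show "p \<star> (c \<star> w) = c \<star> (p \<star> w)"
    by (simp add: c_def bilin algebra_simps)
qed

lemma central_p: "central_for c p"
  using p_idem commuting_p_c by (rule idempotent_central_for)

lemma central_q: "central_for c q"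
proof -
  interpret swap: jordan_two_idempotents jp e q p
    by unfold_locales (rule p_idem q_idem unit_p unit_q)+
  have "swap.c = c"
    by (simp add: swap.c_def c_def comm[of q p] algebra_simps)
  then show ?thesis using swap.central_p by simp
qed

lemma unit_c: "e \<star> c = c"
  by (simp add: c_def bilin unit_idem unit_p unit_q unit_prod)

lemma p_q: "p \<star> q = (1/2) *\<^sub>R (c - e + p + q)"
  by (simp add: c_def scaleR_add_left[symmetric])

lemma c_prod: "central_for c u \<Longrightarrow> u \<star> (c \<star> v) = c \<star> (u \<star> v)"
  using commutingD central_for_def by blast

text \<open>Solved from the Peirce decomposition
  \<open>q = c \<star> p + (e - c) \<star> (e - p) + y\<close> relative to \<open>p\<close>, with
  the diagonal parts multiplied out.\<close>

definition y where "y = p + q - e + c - 2 *\<^sub>R (c \<star> p)"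

lemma p_y: "p \<star> y = (1/2) *\<^sub>R y"
  using scaleR_add_left[of "1/2" "1/2" "c \<star> p"]
  by (simp add: y_def bilin p_idem p_q comm[of _ e] comm[of p c] unit_p c_prod[OF central_p] scaleR_2 algebra_simps)

lemma central_c: "central_for c c"
  by (simp add: central_for_def commuting_square) (simp add: commuting_def)

lemma central_y: "central_for c y"
  unfolding y_def by (intro central_for_add central_for_diff central_for_scale central_for_mult
    central_p central_q central_for_unit central_c)

lemma unit_y: "e \<star> y = y"
  by (simp add: y_def bilin unit_idem unit_p unit_q unit_c unit_prod)

lemma y_y: "y \<star> y = c - c \<star> c"
proof -
  have "q \<star> (c \<star> p) = c \<star> (p \<star> q)"
    by (simp only: c_prod[OF central_q] comm[of q p])
  then have q_y: "q \<star> y = (1/2) *\<^sub>R (c - e + p + q) + c \<star> q - c \<star> (c - e + p + q)"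
    unfolding y_def by (simp add: bilin q_idem unit_q comm[of q p] comm[of q e] comm[of q c] p_q)
  \<comment> \<open>Only the left factor is expanded, so that \<open>p_y\<close> and the centrality
    of \<open>y\<close> reduce everything to \<open>q \<star> y\<close>.\<close>
  have "y \<star> y = (p + q - e + c - 2 *\<^sub>R (c \<star> p)) \<star> y"
    by (simp only: y_def[symmetric])
  also have "\<dots> = p \<star> y + q \<star> y - y + c \<star> y - 2 *\<^sub>R (c \<star> (p \<star> y))"
    by (simp only: bilin unit_y comm[of "c \<star> p" y] c_prod[OF central_y] comm[of y p])
  also have "\<dots> = q \<star> y - (1/2) *\<^sub>R y"
    by (simp add: p_y bilin algebra_simps flip: scaleR_add_left)
  also have "\<dots> = c - c \<star> c"
    unfolding q_y by (simp add: y_def bilin comm[of c e] unit_c algebra_simps)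
  finally show ?thesis .
qed

end

section \<open>Positive polynomials on the unit interval\<close>

abbreviation cpoly :: "real poly \<Rightarrow> complex \<Rightarrow> complex" where
  "cpoly f z \<equiv> poly (map_poly complex_of_real f) z"

lemma cpoly_pCons: "cpoly (pCons a f) z = of_real a + z * cpoly f z"
  by (simp add: map_poly_pCons)

lemma cpoly_add: "cpoly (f + g) z = cpoly f z + cpoly g z"
  by (induction f g rule: poly_induct2) (auto simp: cpoly_pCons algebra_simps)

lemma cpoly_smult: "cpoly (Polynomial.smult a f) z = of_real a * cpoly f z"
  by (induction f) (auto simp: cpoly_pCons algebra_simps)

lemma cpoly_mult: "cpoly (f * g) z = cpoly f z * cpoly g z"
  by (induction f) (auto simp: cpoly_pCons cpoly_add cpoly_smult algebra_simps)

lemma cpoly_of_real: "cpoly f (of_real x) = of_real (poly f x)"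
  by (induction f) (auto simp: cpoly_pCons)

text \<open>A nonreal root is also a root of the remainder modulo its real quadratic
  \<open>Q\<close>, and a nonzero real polynomial of degree below 2 has no nonreal root.\<close>

lemma real_poly_root_factor:
  fixes f :: "real poly"
  assumes "degree f \<noteq> 0"
  shows "(\<exists>x. [:- x, 1:] dvd f) \<or> (\<exists>a b. b \<noteq> 0 \<and> [:a\<^sup>2 + b\<^sup>2, - 2 * a, 1:] dvd f)"
proof -
  have "degree (map_poly complex_of_real f) \<noteq> 0"
    using assms by (simp add: degree_map_poly)
  then have "\<not> constant (poly (map_poly complex_of_real f))"
    by (simp add: constant_degree)
  then obtain z where z: "cpoly f z = 0"
    using fundamental_theorem_of_algebra by blast
  show ?thesis
  proof (cases "Im z = 0")
    case True
    then have "z = of_real (Re z)" by (simp add: complex_eq_iff)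
    then have "poly f (Re z) = 0"
      using z cpoly_of_real[of f "Re z"] by simp
    then show ?thesis by (auto simp: poly_eq_0_iff_dvd)
  next
    case False
    define Q where "Q = [:(Re z)\<^sup>2 + (Im z)\<^sup>2, - 2 * Re z, 1:]"
    have deg: "degree Q = 2" and Q0: "Q \<noteq> 0" by (simp_all add: Q_def)
    have "cpoly Q z = 0"
      by (simp add: Q_def cpoly_pCons complex_eq_iff power2_eq_square algebra_simps)
    then have r0: "cpoly (f mod Q) z = 0"
      using z cpoly_add[of "f div Q * Q" "f mod Q" z] by (simp add: cpoly_mult)
    have "degree (f mod Q) < 2"
      using degree_mod_less[OF Q0, of f] deg by auto
    then have r: "f mod Q = [:coeff (f mod Q) 0, coeff (f mod Q) 1:]"
      by (auto intro!: poly_eqI simp: coeff_pCons coeff_eq_0 split: nat.split)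
    have "cpoly [:coeff (f mod Q) 0, coeff (f mod Q) 1:] z = 0"
      using r0 by (subst (asm) r)
    then have "coeff (f mod Q) 1 = 0 \<and> coeff (f mod Q) 0 = 0"
      using False by (auto simp: cpoly_pCons complex_eq_iff)
    then have "f mod Q = 0" by (subst r) simp
    then show ?thesis using False unfolding Q_def by (auto simp: mod_eq_0_iff_dvd)
  qed
qed

text \<open>The preordering generated by X and 1 - X. Allowing all exponents, and not only 0 and 1,
  makes multiplication by X or 1 - X a mere shift of exponents.\<close>

inductive pos_unit :: "real poly \<Rightarrow> bool" where
  pos_unit_monomial: "pos_unit ([:0, 1:] ^ i * [:1, -1:] ^ j * (r * r))"
| pos_unit_add: "pos_unit f \<Longrightarrow> pos_unit g \<Longrightarrow> pos_unit (f + g)"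

lemma pos_unit_mult_X: "pos_unit f \<Longrightarrow> pos_unit ([:0, 1:] * f)"
proof (induction rule: pos_unit.induct)
  case (pos_unit_monomial i j r)
  then show ?case using pos_unit.pos_unit_monomial[of "Suc i" j r] by (simp only: power_Suc mult.assoc)
qed (simp only: distrib_left pos_unit_add)

lemma pos_unit_mult_1_minus_X: "pos_unit f \<Longrightarrow> pos_unit ([:1, -1:] * f)"
proof (induction rule: pos_unit.induct)
  case (pos_unit_monomial i j r)
  then show ?case using pos_unit.pos_unit_monomial[of i "Suc j" r] by (simp only: power_Suc ac_simps)
qed (simp only: distrib_left pos_unit_add)

lemma pos_unit_mult_square: "pos_unit f \<Longrightarrow> pos_unit (h * h * f)"
proof (induction rule: pos_unit.induct)
  case (pos_unit_monomial i j r)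
  then show ?case using pos_unit.pos_unit_monomial[of i j "h * r"] by (simp only: ac_simps)
qed (simp only: distrib_left pos_unit_add)

lemma pos_unit_smult: "pos_unit f \<Longrightarrow> 0 \<le> a \<Longrightarrow> pos_unit (Polynomial.smult a f)"
  using pos_unit_mult_square[of f "[:sqrt a:]"] by simp

text \<open>Induction on the degree, splitting off a root factor. Strict positivity excludes real
  roots in [0,1], so the factor has constant sign there, and up to that sign the quotient is again
  strictly positive.\<close>

lemma pos_unit_if_pos:
  assumes "\<And>t. 0 \<le> t \<Longrightarrow> t \<le> 1 \<Longrightarrow> 0 < poly f t"
  shows "pos_unit f"
  using assms
proof (induction "degree f" arbitrary: f rule: less_induct)
  case less
  show ?case
  proof (cases "degree f = 0")
    case True
    then obtain a where a: "f = [:a:]" by (rule degree_eq_zeroE)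
    then have "0 < a" using less.prems[of 0] by simp
    then show ?thesis
      using pos_unit_monomial[of 0 0 "[:sqrt a:]"] by (simp add: a)
  next
    case False
    then have f0: "f \<noteq> 0" by auto
    consider (lin) x where "[:- x, 1:] dvd f" | (quad) a b where "b \<noteq> 0" "[:a\<^sup>2 + b\<^sup>2, - 2 * a, 1:] dvd f"
      using real_poly_root_factor[OF False] by blast
    then show ?thesis
    proof cases
      case lin
      then obtain g where g: "f = [:- x, 1:] * g" by (rule dvdE)
      with f0 have "g \<noteq> 0" by auto
      then have deg: "degree g < degree f"
        unfolding g by (subst degree_mult_eq) auto
      have pos: "0 < (t - x) * poly g t" if "0 \<le> t" "t \<le> 1" for t
        using less.prems[OF that] by (simp add: g algebra_simps)
      consider "x < 0" | "x > 1"
        using pos[of x] by fastforce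
      then show ?thesis
      proof cases
        case 1
        have "0 < poly g t" if "0 \<le> t" "t \<le> 1" for t
          using pos[OF that] that 1 by (simp add: zero_less_mult_iff)
        then have "pos_unit g" using less.hyps deg by blast
        then have "pos_unit ([:0, 1:] * g + Polynomial.smult (- x) g)"
          using 1 by (intro pos_unit_add pos_unit_mult_X pos_unit_smult) auto
        then show ?thesis by (simp add: g)
      next
        case 2
        have "0 < poly (- g) t" if "0 \<le> t" "t \<le> 1" for t
          using pos[OF that] that 2 by (simp add: zero_less_mult_iff)
        then have "pos_unit (- g)" using less.hyps[of "- g"] deg by simp
        \<comment> \<open>Here the positive factor is x - X = (1 - X) + (x - 1); the sign moves into
          the quotient.\<close>
        then have "pos_unit ([:1, -1:] * (- g) + Polynomial.smult (x - 1) (- g))"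
          using 2 by (intro pos_unit_add pos_unit_mult_1_minus_X pos_unit_smult) auto
        also have "[:1, -1:] * (- g) + Polynomial.smult (x - 1) (- g) = f"
          by (simp add: g smult_diff_left)
        finally show ?thesis .
      qed
    next
      case quad
      then obtain g where g: "f = [:a\<^sup>2 + b\<^sup>2, - 2 * a, 1:] * g" by (auto elim: dvdE)
      with f0 have "g \<noteq> 0" by auto
      then have deg: "degree g < degree f"
        unfolding g by (subst degree_mult_eq) auto
      have "0 < poly g t" if "0 \<le> t" "t \<le> 1" for t
      proof -
        have "0 < ((t - a)\<^sup>2 + b\<^sup>2) * poly g t"
          using less.prems[OF that] by (simp add: g power2_eq_square algebra_simps)
        moreover have "0 < (t - a)\<^sup>2 + b\<^sup>2"
          using quad(1) by (simp add: add_nonneg_pos)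
        ultimately show ?thesis by (simp add: zero_less_mult_iff)
      qed
      then have "pos_unit g" using less.hyps deg by blast
      then have "pos_unit ([:- a, 1:] * [:- a, 1:] * g + [:b:] * [:b:] * g)"
        by (intro pos_unit_add pos_unit_mult_square)
      also have "[:- a, 1:] * [:- a, 1:] * g + [:b:] * [:b:] * g = f"
        by (simp add: g power2_eq_square algebra_simps flip: smult_add_left)
      finally show ?thesis .
    qed
  qed
qed

section \<open>Nonnegative coefficients and the square root iteration\<close>

definition nonneg_poly :: "real poly \<Rightarrow> bool" where
  "nonneg_poly f \<longleftrightarrow> (\<forall>i. 0 \<le> coeff f i)"

lemma nonneg_poly_add: "nonneg_poly f \<Longrightarrow> nonneg_poly g \<Longrightarrow> nonneg_poly (f + g)"
  by (simp add: nonneg_poly_def)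

lemma nonneg_poly_mult: "nonneg_poly f \<Longrightarrow> nonneg_poly g \<Longrightarrow> nonneg_poly (f * g)"
  by (simp add: nonneg_poly_def coeff_mult sum_nonneg)

lemma nonneg_poly_smult: "nonneg_poly f \<Longrightarrow> 0 \<le> a \<Longrightarrow> nonneg_poly (Polynomial.smult a f)"
  by (simp add: nonneg_poly_def)

lemma nonneg_poly_pCons_iff: "nonneg_poly (pCons a f) \<longleftrightarrow> 0 \<le> a \<and> nonneg_poly f"
  by (auto simp: nonneg_poly_def coeff_pCons split: nat.splits)

lemma nonneg_poly_0 [simp]: "nonneg_poly 0"
  by (simp add: nonneg_poly_def)

lemma poly_1_nonneg: "nonneg_poly f \<Longrightarrow> 0 \<le> poly f 1"
  by (induction f) (auto simp: nonneg_poly_pCons_iff)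

text \<open>Iterates of \<open>w \<mapsto> (u + w\<^sup>2) / 2\<close>, whose fixed point is \<open>1 - sqrt (1 - u)\<close>, as polynomials in \<open>u\<close>.\<close>

primrec sqrt_iter :: "nat \<Rightarrow> real poly" where
  "sqrt_iter 0 = 0"
| "sqrt_iter (Suc n) = Polynomial.smult (1/2) ([:0, 1:] + sqrt_iter n * sqrt_iter n)"

lemma nonneg_sqrt_iter: "nonneg_poly (sqrt_iter n)"
  by (induction n) (auto intro!: nonneg_poly_smult nonneg_poly_add nonneg_poly_mult simp: nonneg_poly_pCons_iff)

text \<open>A difference of squares: one step turns w_k - w_m into half of (w_k - w_m)(w_k + w_m).
  The iteration is thus monotone in every coefficient, which is what controls it in norm.\<close>

lemma nonneg_sqrt_iter_diff: "m \<le> n \<Longrightarrow> nonneg_poly (sqrt_iter n - sqrt_iter m)"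
proof (induction m arbitrary: n)
  case 0
  then show ?case by (simp add: nonneg_sqrt_iter)
next
  case (Suc m)
  then obtain k where k: "n = Suc k" "m \<le> k" by (cases n) auto
  have "sqrt_iter n - sqrt_iter (Suc m) = Polynomial.smult (1/2) ((sqrt_iter k - sqrt_iter m) * (sqrt_iter k + sqrt_iter m))"
    by (simp add: k algebra_simps flip: smult_diff_right)
  then show ?case
    using Suc.IH[OF k(2)] by (auto intro!: nonneg_poly_smult nonneg_poly_mult nonneg_poly_add nonneg_sqrt_iter)
qed

lemma sqrt_iter_at_1_le: "poly (sqrt_iter n) 1 \<le> 1"
proof (induction n)
  case (Suc n)
  then have "(poly (sqrt_iter n) 1)\<^sup>2 \<le> 1"
    using poly_1_nonneg[OF nonneg_sqrt_iter] by (simp add: power_le_one)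
  then show ?case by (simp add: power2_eq_square)
qed simp

lemma sqrt_iter_at_1_Cauchy: "Cauchy (\<lambda>n. poly (sqrt_iter n) 1)"
proof -
  have "mono (\<lambda>n. poly (sqrt_iter n) 1)"
    using poly_1_nonneg[OF nonneg_sqrt_iter_diff] by (intro monoI) simp
  then have "convergent (\<lambda>n. poly (sqrt_iter n) 1)"
    using sqrt_iter_at_1_le by (metis incseq_convergent convergentI)
  then show ?thesis by (rule convergent_Cauchy)
qed

section \<open>Square roots and positivity in a JB-algebra\<close>

text \<open>\<open>N\<close> is only a seminorm on the ambient space: its null space is the kernel
  of multiplication by \<open>e\<close>. Limits are therefore determined only after multiplication
  by \<open>e\<close>.\<close>

locale jb_space = jordan_space +
  fixes N :: "'a \<Rightarrow> real"
  assumes N_add: "N (x + y) \<le> N x + N y"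
    and N_scale: "N (a *\<^sub>R x) = \<bar>a\<bar> * N x"
    and N_prod: "N (x \<star> y) \<le> N x * N y"
    and N_square: "(N x)\<^sup>2 = N (x \<star> x)"
    and N_square_add: "N (x \<star> x) \<le> N (x \<star> x + y \<star> y)"
    and N_unit: "N (e \<star> x) = N x"
    and N_zero: "N x = 0 \<Longrightarrow> e \<star> x = 0"
    and N_complete: "(\<And>r. 0 < r \<Longrightarrow> \<exists>M. \<forall>m\<ge>M. \<forall>n\<ge>M. N (X m - X n) < r) \<Longrightarrow>
      \<exists>l. (\<lambda>n. N (X n - l)) \<longlonglongrightarrow> 0"
begin

lemma N_0 [simp]: "N 0 = 0"
  using N_scale[of 0 0] by simp

lemma N_minus [simp]: "N (- x) = N x"
  using N_scale[of "-1" x] by simp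

lemma N_nonneg [simp]: "0 \<le> N x"
  using N_add[of x "- x"] by simp

lemma N_diff: "N (x - y) \<le> N x + N y"
  using N_add[of x "- y"] by simp

lemma N_idempotent_le: "p \<star> p = p \<Longrightarrow> N p \<le> 1"
  using N_square[of p] by (auto simp: power2_eq_square)

lemma N_e_le: "N e \<le> 1"
  using unit_idem by (rule N_idempotent_le)

text \<open>Horner's scheme and the triangle inequality. Because the coefficients are nonnegative
  the bound is the value at 1, so convergence in norm reduces to convergence of real
  numbers.\<close>

lemma N_evalp_le:
  assumes "N u \<le> 1" "nonneg_poly f"
  shows "N (evalp u f e) \<le> poly f 1"
  using assms(2)
proof (induction f)
  case (pCons a f)
  have "N (evalp u (pCons a f) e) \<le> N (a *\<^sub>R e) + N (u \<star> evalp u f e)"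
    using N_add by simp
  also have "N (a *\<^sub>R e) \<le> a"
    using N_e_le pCons.prems by (simp add: N_scale nonneg_poly_pCons_iff mult_left_le)
  also have "N (u \<star> evalp u f e) \<le> N u * N (evalp u f e)"
    by (rule N_prod)
  also have "\<dots> \<le> N (evalp u f e)"
    using assms(1) by (simp add: mult_left_le_one_le)
  also have "\<dots> \<le> poly f 1"
    using pCons by (simp add: nonneg_poly_pCons_iff)
  finally show ?case by simp
qed simp

lemma unit_evalp: "e \<star> x = x \<Longrightarrow> e \<star> evalp u f x = evalp u f x"
  by (induction f) (auto simp: bilin unit_prod)

lemma limit_unique:
  assumes "(\<lambda>n. N (X n - x)) \<longlonglongrightarrow> 0" "(\<lambda>n. N (X n - y)) \<longlonglongrightarrow> 0"
  shows "e \<star> x = e \<star> y"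
proof -
  have "N (x - y) \<le> N (X n - x) + N (X n - y)" for n
    using N_diff[of "X n - y" "X n - x"] by simp
  then have "N (x - y) \<le> 0"
    using LIMSEQ_le_const[OF tendsto_add[OF assms]] by simp
  then have "e \<star> (x - y) = 0"
    using N_zero N_nonneg by (meson order_antisym)
  then show ?thesis by (simp add: bilin)
qed

lemma limit_add:
  assumes "(\<lambda>n. N (X n - x)) \<longlonglongrightarrow> 0" "(\<lambda>n. N (Y n - y)) \<longlonglongrightarrow> 0"
  shows "(\<lambda>n. N (X n + Y n - (x + y))) \<longlonglongrightarrow> 0"
proof (rule tendsto_sandwich[OF _ _ tendsto_const])
  show "(\<lambda>n. N (X n - x) + N (Y n - y)) \<longlonglongrightarrow> 0"
    using tendsto_add[OF assms] by simp
  show "\<forall>\<^sub>F n in sequentially. N (X n + Y n - (x + y)) \<le> N (X n - x) + N (Y n - y)"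
    using N_add[of "X n - x" "Y n - y" for n] by (simp add: algebra_simps)
qed simp

lemma limit_scale:
  assumes "(\<lambda>n. N (X n - x)) \<longlonglongrightarrow> 0"
  shows "(\<lambda>n. N (a *\<^sub>R X n - a *\<^sub>R x)) \<longlonglongrightarrow> 0"
  using tendsto_mult_left[OF assms, of "\<bar>a\<bar>"] by (simp add: N_scale flip: scaleR_diff_right)

lemma limit_prod:
  assumes "(\<lambda>n. N (X n - x)) \<longlonglongrightarrow> 0" "(\<lambda>n. N (Y n - y)) \<longlonglongrightarrow> 0"
  shows "(\<lambda>n. N (X n \<star> Y n - x \<star> y)) \<longlonglongrightarrow> 0"
proof (rule tendsto_sandwich[OF _ _ tendsto_const])
  let ?U = "\<lambda>n. N (X n - x) * N (Y n - y) + N (X n - x) * N y + N x * N (Y n - y)"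
  have "?U \<longlonglongrightarrow> 0 * 0 + 0 * N y + N x * 0"
    by (intro tendsto_intros assms)
  then show "?U \<longlonglongrightarrow> 0" by simp
  have "N (X n \<star> Y n - x \<star> y) \<le> ?U n" for n
  proof -
    have "X n \<star> Y n - x \<star> y = (X n - x) \<star> (Y n - y) + (X n - x) \<star> y + x \<star> (Y n - y)"
      by (simp add: bilin)
    then have "N (X n \<star> Y n - x \<star> y) \<le> N ((X n - x) \<star> (Y n - y)) + N ((X n - x) \<star> y) + N (x \<star> (Y n - y))"
      by (metis N_add add_right_mono order_trans)
    then show ?thesis
      using N_prod[of "X n - x" "Y n - y"] N_prod[of "X n - x" y] N_prod[of x "Y n - y"] by linarith
  qed
  then show "\<forall>\<^sub>F n in sequentially. N (X n \<star> Y n - x \<star> y) \<le> ?U n" by simp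
qed simp

lemma limit_unit:
  "(\<lambda>n. N (X n - x)) \<longlonglongrightarrow> 0 \<Longrightarrow> (\<lambda>n. N (e \<star> X n - e \<star> x)) \<longlonglongrightarrow> 0"
  using N_unit by (simp flip: diff_right)

section \<open>Squares as the positive cone\<close>

definition square :: "'a \<Rightarrow> bool" where
  "square x \<longleftrightarrow> (\<exists>z. x = z \<star> z)"

text \<open>The differences of \<open>sqrt_iter\<close> have nonnegative coefficients, so their
  values at 1 bound the norms: convergence of the real sequence at 1 forces \<open>W\<close> to be
  Cauchy, the boundary case \<open>N u = 1\<close> included.\<close>

lemma square_unit_minus:
  assumes u: "e \<star> u = u" and "N u \<le> 1"
  shows "square (e - u)"
proof -
  define W where "W n = evalp u (sqrt_iter n) e" for n
  have W_diff: "N (W n - W m) \<le> \<bar>poly (sqrt_iter n) 1 - poly (sqrt_iter m) 1\<bar>" for m n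
  proof (induction m n rule: linorder_wlog)
    case (le m n)
    have "N (W n - W m) \<le> poly (sqrt_iter n - sqrt_iter m) 1"
      unfolding W_def evalp_diff[symmetric]
      by (rule N_evalp_le[OF assms(2) nonneg_sqrt_iter_diff[OF le]])
    then show ?case by simp
  next
    case (sym m n)
    then show ?case by (metis N_minus abs_minus_commute minus_diff_eq)
  qed
  have "\<exists>l. (\<lambda>n. N (W n - l)) \<longlonglongrightarrow> 0"
  proof (rule N_complete)
    fix r :: real assume "0 < r"
    then obtain M where "\<forall>m\<ge>M. \<forall>n\<ge>M. \<bar>poly (sqrt_iter m) 1 - poly (sqrt_iter n) 1\<bar> < r"
      using sqrt_iter_at_1_Cauchy by (auto simp: Cauchy_def dist_real_def)
    then show "\<exists>M. \<forall>m\<ge>M. \<forall>n\<ge>M. N (W m - W n) < r"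
      using W_diff by (meson le_less_trans)
  qed
  then obtain l where l: "(\<lambda>n. N (W n - l)) \<longlonglongrightarrow> 0" by blast
  have uu: "central_for u e" and eu: "commuting e u"
    using central_for_unit commuting_unit by auto
  have "W (Suc n) = (1/2) *\<^sub>R (u + W n \<star> W n)" for n
    unfolding W_def sqrt_iter.simps evalp_smult evalp_add evalp_prod[OF uu eu] unit_idem
    using u by (simp add: comm[of u e])
  then have "(\<lambda>n. N (W (Suc n) - (1/2) *\<^sub>R (u + l \<star> l))) \<longlonglongrightarrow> 0"
    using limit_scale[OF limit_add[OF _ limit_prod[OF l l]], of "\<lambda>_. u" u "1/2"] by simp
  then have "e \<star> l = e \<star> ((1/2) *\<^sub>R (u + l \<star> l))"
    by (rule limit_unique[OF LIMSEQ_Suc[OF l]])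
  then have el: "2 *\<^sub>R (e \<star> l) = u + l \<star> l"
    by (simp add: bilin u unit_prod)
  \<comment> \<open>The limit equation is l = (u + l^2) / 2, known only after multiplication by
    \<open>e\<close>; completing the square turns it into (1 - l)^2 = 1 - u.\<close>
  have "(e - e \<star> l) \<star> (e - e \<star> l) = e - 2 *\<^sub>R (e \<star> l) + l \<star> l"
    by (simp add: bilin unit_prod unit_absorb unit_absorb_right unit_idem comm[of l e] scaleR_2)
  also have "\<dots> = e - u" by (simp add: el)
  finally show ?thesis unfolding square_def by metis
qed

lemma square_scale: "square x \<Longrightarrow> 0 \<le> a \<Longrightarrow> square (a *\<^sub>R x)"
  unfolding square_def by (metis scale_left scale_right scaleR_scaleR real_sqrt_mult_self abs_of_nonneg)

lemma square_unit: "square x \<Longrightarrow> e \<star> x = x"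
  by (auto simp: square_def unit_prod)

lemma square_N_le: "square x \<Longrightarrow> square y \<Longrightarrow> N x \<le> N (x + y)"
  by (auto simp: square_def N_square_add)

text \<open>After division by \<open>r\<close> both x and e - x are squares with sum
  \<open>e\<close>, so the inequality for sums of squares bounds the second by \<open>N e\<close>,
  which is at most 1.\<close>

lemma N_unit_minus_square:
  assumes "square x" "N x \<le> r" "0 < r"
  shows "N (r *\<^sub>R e - x) \<le> r"
proof -
  let ?x = "(1/r) *\<^sub>R x"
  have x: "square ?x" using assms by (simp add: square_scale)
  moreover have "N ?x \<le> 1" using assms by (simp add: N_scale)
  ultimately have "square (e - ?x)"
    by (intro square_unit_minus) (simp_all add: square_unit)
  then have "N (e - ?x) \<le> N e"
    using square_N_le[OF _ x] by force
  then have "N (e - ?x) \<le> 1" using N_e_le by linarith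
  moreover have "r *\<^sub>R e - x = r *\<^sub>R (e - ?x)" using assms by (simp add: algebra_simps)
  ultimately show ?thesis using assms by (simp add: N_scale)
qed

text \<open>The sum is a positive multiple of some \<open>e - u\<close> with
  \<open>N u \<le> 1\<close>, where \<open>u\<close> averages the two defects r e - x and s e - y;
  then \<open>square_unit_minus\<close> applies.\<close>

lemma square_add:
  assumes "square x" "square y"
  shows "square (x + y)"
proof -
  \<comment> \<open>The summand 1 keeps the scale positive when \<open>x\<close> has norm 0.\<close>
  define r where "r = N x + 1"
  define s where "s = N y + 1"
  have rs: "0 < r" "0 < s" by (simp_all add: r_def s_def add_nonneg_pos)
  have "N (r *\<^sub>R e - x) \<le> r" "N (s *\<^sub>R e - y) \<le> s"
    using assms rs by (auto intro!: N_unit_minus_square simp: r_def s_def)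
  then have le: "N ((r *\<^sub>R e - x) + (s *\<^sub>R e - y)) \<le> r + s"
    using N_add[of "r *\<^sub>R e - x" "s *\<^sub>R e - y"] by linarith
  define u where "u = (1 / (r + s)) *\<^sub>R ((r *\<^sub>R e - x) + (s *\<^sub>R e - y))"
  have "N u \<le> 1" using le rs by (simp add: u_def N_scale)
  moreover have "e \<star> u = u"
    using assms by (simp add: u_def bilin unit_idem square_unit)
  ultimately have "square ((r + s) *\<^sub>R (e - u))"
    using rs by (intro square_scale square_unit_minus) auto
  also have "(r + s) *\<^sub>R (e - u) = x + y"
    using rs by (simp add: u_def scaleR_diff_right) (simp add: algebra_simps)
  finally show ?thesis .
qed

text \<open>The hypotheses place \<open>x\<close> between -a g and a g. The constant 3 is 2 for a g
  + x, which is dominated by 2 a g, plus 1 for subtracting a g again.\<close>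

lemma N_le_if_squares:
  assumes "square (a *\<^sub>R g - x)" "square (a *\<^sub>R g + x)" "N g \<le> 1" "0 \<le> a"
  shows "N x \<le> 3 * a"
proof -
  have "N (a *\<^sub>R g + x) \<le> N ((2 * a) *\<^sub>R g)"
    using square_N_le[OF assms(2,1)] by (simp add: algebra_simps flip: scaleR_2)
  also have "\<dots> \<le> 2 * a"
    using assms by (simp add: N_scale mult_left_le)
  finally have "N (a *\<^sub>R g + x) \<le> 2 * a" .
  moreover have "N x \<le> N (a *\<^sub>R g + x) + N (a *\<^sub>R g)"
    using N_diff[of "a *\<^sub>R g + x" "a *\<^sub>R g"] by simp
  moreover have "N (a *\<^sub>R g) \<le> a"
    using assms by (simp add: N_scale mult_left_le)
  ultimately show ?thesis by simp
qed

end

section \<open>Two projections\<close>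

locale jb_two_projections = jb_space jp e N + jordan_two_idempotents jp e p q
  for jp (infixl \<open>\<star>\<close> 70) and e N p q
begin

text \<open>Used with \<open>w\<close> equal to \<open>e\<close>, \<open>e - p - q\<close> and
  \<open>p - q\<close>, whose squares are 1, X and 1 - X evaluated at \<open>c\<close>.\<close>

lemma square_evalp:
  assumes "central_for c w" "w \<star> w = evalp c g e"
  shows "square (evalp c (r * r * g) e)"
proof -
  have "evalp c (r * r * g) e = evalp c r w \<star> evalp c r w"
    using assms by (simp add: evalp_prod central_for_def evalp_mult)
  then show ?thesis unfolding square_def by blast
qed

lemma c_square: "(e - p - q) \<star> (e - p - q) = c"
  by (simp add: c_def bilin unit_idem p_idem q_idem unit_p unit_q comm[of p e] comm[of q e] comm[of q p] scaleR_2)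

lemma one_minus_c_square: "(p - q) \<star> (p - q) = e - c"
  by (simp add: c_def bilin p_idem q_idem comm[of q p] scaleR_2)

lemma square_c_monomial: "square (evalp c ([:0, 1:] ^ i * [:1, -1:] ^ j * (r * r)) e)"
proof -
  let ?X = "[:0, 1:] :: real poly" and ?Y = "[:1, -1:] :: real poly"
  have c: "c = evalp c ?X e" "e - c = evalp c ?Y e"
    using unit_c by (simp_all add: comm[of c e] bilin)
  have eps: "central_for c (e - p - q)" "central_for c (p - q)"
    using central_for_diff central_for_unit central_p central_q by auto
  have 0: "square (evalp c (s * s) e)" for s
    using square_evalp[OF central_for_unit, of 1 s] by (simp add: unit_idem)
  have X: "square (evalp c (s * s * ?X) e)" for s
    by (rule square_evalp[OF eps(1), unfolded c_square, OF c(1)])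
  have Y: "square (evalp c (s * s * ?Y) e)" for s
    by (rule square_evalp[OF eps(2), unfolded one_minus_c_square, OF c(2)])
  \<comment> \<open>Even powers are absorbed into \<open>s * s\<close>, so only the parities of the
    exponents remain to be treated.\<close>
  obtain k l where k: "i = k + k \<or> i = k + k + 1" and l: "j = l + l \<or> j = l + l + 1"
    by (metis mult_2 oddE evenE)
  define s where "s = ?X ^ k * ?Y ^ l * r"
  \<comment> \<open>Multiplying by X + (1 - X) = 1 splits the mixed case into the two single ones,
    at the cost of \<open>square_add\<close>.\<close>
  have XY: "s * s * (?X * ?Y) = s * ?X * (s * ?X) * ?Y + s * ?Y * (s * ?Y) * ?X"
  proof -
    have "?X + ?Y = 1" by (simp add: one_pCons)
    then have "s * s * (?X * ?Y) = s * s * (?X * ?Y) * (?X + ?Y)" by (simp only: mult_1_right)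
    then show ?thesis by (simp only: distrib_left mult.assoc mult.left_commute mult.commute)
  qed
  consider "i = k + k" "j = l + l" | "i = k + k + 1" "j = l + l" | "i = k + k" "j = l + l + 1"
    | "i = k + k + 1" "j = l + l + 1" using k l by blast
  then show ?thesis
  proof cases
    case 1
    then have "?X ^ i * ?Y ^ j * (r * r) = s * s" by (simp only: s_def power_add mult.assoc mult.left_commute mult.commute)
    then show ?thesis using 0 by metis
  next
    case 2
    then have "?X ^ i * ?Y ^ j * (r * r) = s * s * ?X" by (simp only: s_def power_add power_one_right mult.assoc mult.left_commute mult.commute)
    then show ?thesis using X by metis
  next
    case 3
    then have "?X ^ i * ?Y ^ j * (r * r) = s * s * ?Y" by (simp only: s_def power_add power_one_right mult.assoc mult.left_commute mult.commute)
    then show ?thesis using Y by metis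
  next
    case 4
    then have "?X ^ i * ?Y ^ j * (r * r) = s * s * (?X * ?Y)" by (simp only: s_def power_add power_one_right mult.assoc mult.left_commute mult.commute)
    then show ?thesis using square_add[OF Y X] by (simp only: XY evalp_add)
  qed
qed

lemma square_evalp_pos: "pos_unit f \<Longrightarrow> square (evalp c f e)"
  by (induction rule: pos_unit.induct) (simp_all only: square_c_monomial evalp_add square_add)

lemma N_evalp_c_le:
  assumes "\<And>t. 0 \<le> t \<Longrightarrow> t \<le> 1 \<Longrightarrow> \<bar>poly f t\<bar> \<le> B"
  shows "N (evalp c f e) \<le> 3 * B"
proof (rule field_le_epsilon)
  fix r :: real assume "0 < r"
  \<comment> \<open>The certificate requires strict positivity, so \<open>B\<close> is enlarged; r /
    3 becomes r under the factor 3 of \<open>N_le_if_squares\<close>.\<close>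
  define a where "a = B + r / 3"
  have a: "0 \<le> a" using assms[of 0] \<open>0 < r\<close> by (simp add: a_def)
  have bd: "\<bar>poly f t\<bar> < a" if "0 \<le> t" "t \<le> 1" for t
    using assms[OF that] \<open>0 < r\<close> by (simp add: a_def)
  have "square (evalp c ([:a:] - f) e)" "square (evalp c ([:a:] + f) e)"
    using bd by (force intro!: square_evalp_pos pos_unit_if_pos simp: abs_less_iff)+
  then have "N (evalp c f e) \<le> 3 * a"
    using a N_e_le by (intro N_le_if_squares[where g = e]) (simp_all add: evalp_add evalp_diff)
  then show "N (evalp c f e) \<le> 3 * B + r" by (simp add: a_def)
qed

text \<open>The intended image of the symmetric matrix function with diagonal entries
  \<open>P\<close>, \<open>Q\<close> and off-diagonal entry \<open>R\<close> times sqrt (t (1 - t)),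
  which is called \<open>repJ\<close> below.\<close>

definition rep :: "real poly \<Rightarrow> real poly \<Rightarrow> real poly \<Rightarrow> 'a" where
  "rep P Q R = evalp c P p + evalp c Q (e - p) + evalp c R y"

text \<open>The Peirce rules relative to \<open>p\<close>, together with \<open>y_y\<close>, which
  contributes the factor X - X^2. The polynomials on the right are those of
  \<open>repJ_mult\<close>, so products correspond on the level of triples.\<close>

lemma rep_prod:
  "rep P Q R \<star> rep P' Q' R' =
   rep (P * P' + [:0, 1, -1:] * (R * R')) (Q * Q' + [:0, 1, -1:] * (R * R'))
     (Polynomial.smult (1/2) (R * (P' + Q') + R' * (P + Q)))"
proof -
  have cp': "central_for c (e - p)"
    by (simp add: central_for_diff central_for_unit central_p)
  have 1: "p \<star> (e - p) = 0" "(e - p) \<star> p = 0" "(e - p) \<star> (e - p) = e - p"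
    by (simp_all add: bilin p_idem unit_p unit_idem comm[of p e])
  have 2: "p \<star> y = (1/2) *\<^sub>R y" "y \<star> p = (1/2) *\<^sub>R y" "(e - p) \<star> y = (1/2) *\<^sub>R y" "y \<star> (e - p) = (1/2) *\<^sub>R y"
    using p_y unit_y scaleR_add_left[of "1/2" "1/2" y]
    by (simp_all add: bilin comm[of y] algebra_simps)
  have 3: "y \<star> y = evalp c [:0, 1, -1:] p + evalp c [:0, 1, -1:] (e - p)"
    by (simp add: y_y bilin comm[of c e] unit_c)
  have comms: "commuting p c" "commuting (e - p) c" "commuting y c"
    using central_p cp' central_y by (auto simp: central_for_def)
  note prods = evalp_prod[OF central_p comms(1)] evalp_prod[OF central_p comms(2)] evalp_prod[OF central_p comms(3)]
    evalp_prod[OF cp' comms(1)] evalp_prod[OF cp' comms(2)] evalp_prod[OF cp' comms(3)]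
    evalp_prod[OF central_y comms(1)] evalp_prod[OF central_y comms(2)] evalp_prod[OF central_y comms(3)]
  have "rep P Q R \<star> rep P' Q' R' = evalp c (P * P') p + evalp c (Q * Q') (e - p)
     + (1/2) *\<^sub>R evalp c (P * R') y + (1/2) *\<^sub>R evalp c (R * P') y + (1/2) *\<^sub>R evalp c (Q * R') y + (1/2) *\<^sub>R evalp c (R * Q') y
     + evalp c (R * R') (evalp c [:0, 1, -1:] p + evalp c [:0, 1, -1:] (e - p))"
    unfolding rep_def by (simp only: add_left add_right prods 1 2 3 p_idem evalp_zero_right evalp_scale_right) (simp only: ac_simps add_0)
  also have "\<dots> = rep (P * P' + [:0, 1, -1:] * (R * R')) (Q * Q' + [:0, 1, -1:] * (R * R'))
     (Polynomial.smult (1/2) (R * (P' + Q') + R' * (P + Q)))"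
    unfolding rep_def by (simp only: evalp_add_right evalp_mult[symmetric] evalp_add evalp_smult distrib_left scaleR_add_right ac_simps)
  finally show ?thesis .
qed

lemma rep_add: "rep P Q R + rep P' Q' R' = rep (P + P') (Q + Q') (R + R')"
  by (simp add: rep_def evalp_add)

lemma rep_scale: "a *\<^sub>R rep P Q R = rep (Polynomial.smult a P) (Polynomial.smult a Q) (Polynomial.smult a R)"
  by (simp add: rep_def evalp_smult algebra_simps)

lemma unit_rep: "e \<star> rep P Q R = rep P Q R"
  by (simp add: rep_def bilin unit_evalp unit_p unit_y unit_idem)

text \<open>8 = 3 + 3 + 2. The diagonal parts are an idempotent times a polynomial in
  \<open>c\<close>; the square of the off-diagonal part is a polynomial in \<open>c\<close> bounded
  by 3 B^2, and sqrt 3 is rounded up to 2.\<close>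

lemma N_rep_le:
  assumes P: "\<And>t. 0 \<le> t \<Longrightarrow> t \<le> 1 \<Longrightarrow> \<bar>poly P t\<bar> \<le> B"
    and Q: "\<And>t. 0 \<le> t \<Longrightarrow> t \<le> 1 \<Longrightarrow> \<bar>poly Q t\<bar> \<le> B"
    and R: "\<And>t. 0 \<le> t \<Longrightarrow> t \<le> 1 \<Longrightarrow> \<bar>poly R t * sqrt (t * (1 - t))\<bar> \<le> B"
  shows "N (rep P Q R) \<le> 8 * B"
proof -
  have B: "0 \<le> B" using P[of 0] by simp
  have *: "N (evalp c f u) \<le> 3 * B" if "u \<star> u = u" "central_for c u" "e \<star> u = u"
    "\<And>t. 0 \<le> t \<Longrightarrow> t \<le> 1 \<Longrightarrow> \<bar>poly f t\<bar> \<le> B" for f u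
  proof -
    have "evalp c f u = u \<star> evalp c f e"
      using evalp_commute[of u c f e] that by (simp add: central_for_def comm[of u e])
    then have "N (evalp c f u) \<le> N u * N (evalp c f e)" using N_prod by simp
    also have "\<dots> \<le> 1 * (3 * B)"
      using that N_idempotent_le N_evalp_c_le by (intro mult_mono) auto
    finally show ?thesis by simp
  qed
  have 1: "N (evalp c P p) \<le> 3 * B"
    by (rule *[OF p_idem central_p unit_p P])
  have 2: "N (evalp c Q (e - p)) \<le> 3 * B"
    by (rule *[OF _ _ _ Q])
      (simp_all add: bilin p_idem unit_p unit_idem comm[of p e] central_for_diff central_for_unit central_p)
  have "commuting y c" using central_y by (simp add: central_for_def)
  then have "(N (evalp c R y))\<^sup>2 = N (evalp c (R * R * [:0, 1, -1:]) e)"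
    unfolding N_square evalp_prod[OF central_y \<open>commuting y c\<close>] y_y evalp_mult
    by (simp add: comm[of c e] unit_c bilin)
  also have "\<dots> \<le> 3 * B\<^sup>2"
  proof (rule N_evalp_c_le)
    fix t :: real assume t: "0 \<le> t" "t \<le> 1"
    have "\<bar>poly R t * sqrt (t * (1 - t))\<bar>\<^sup>2 \<le> B\<^sup>2"
      using R[OF t] by (intro power_mono) auto
    moreover have "poly (R * R * [:0, 1, -1:]) t = (poly R t * sqrt (t * (1 - t)))\<^sup>2"
    proof -
      have "(sqrt (t * (1 - t)))\<^sup>2 = t * (1 - t)" using t by simp
      then show ?thesis
        unfolding power_mult_distrib by (simp add: power2_eq_square algebra_simps)
    qed
    ultimately show "\<bar>poly (R * R * [:0, 1, -1:]) t\<bar> \<le> B\<^sup>2"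
      by (simp only: power2_abs abs_power2)
  qed
  also have "\<dots> \<le> (2 * B)\<^sup>2" by (simp add: power_mult_distrib)
  finally have 3: "N (evalp c R y) \<le> 2 * B"
    by (rule power2_le_imp_le) (use B in simp)
  have "N (rep P Q R) \<le> N (evalp c P p) + N (evalp c Q (e - p)) + N (evalp c R y)"
    unfolding rep_def by (metis N_add add_right_mono order_trans)
  then show ?thesis using 1 2 3 by linarith
qed

end

section \<open>Embedding a JB-algebra into a vector space type\<close>

text \<open>Common ground for the norms of JB-algebras, of the Hilbert space and of its operators.
  Homogeneity enters only through \<open>N_uminus\<close>, so that real and complex scalars are
  covered alike.\<close>

locale normed_group = abelian_group M
  for M :: "('k::field, 'a, 'm) module_scheme" (structure) +
  fixes N :: "'a \<Rightarrow> real"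
  assumes N_ge_0: "x \<in> carrier M \<Longrightarrow> 0 \<le> N x"
    and N_eq_0: "x \<in> carrier M \<Longrightarrow> N x = 0 \<longleftrightarrow> x = \<zero>"
    and N_triangle: "\<lbrakk>x \<in> carrier M; y \<in> carrier M\<rbrakk> \<Longrightarrow> N (x \<oplus> y) \<le> N x + N y"
    and N_uminus: "x \<in> carrier M \<Longrightarrow> N (\<ominus> x) = N x"
begin

lemma minus_telescope:
  "\<lbrakk>x \<in> carrier M; y \<in> carrier M; z \<in> carrier M\<rbrakk> \<Longrightarrow> x \<ominus> z = (x \<ominus> y) \<oplus> (y \<ominus> z)"
  by (simp add: a_minus_def a_assoc) (metis a_inv_closed l_neg local.add.m_assoc local.add.l_one)

lemma minus_eq_0_iff:
  assumes "x \<in> carrier M" "y \<in> carrier M"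
  shows "x \<ominus> y = \<zero> \<longleftrightarrow> x = y"
proof -
  have "(x \<ominus> y) \<oplus> y = x"
    using assms by (simp add: a_minus_def a_assoc l_neg)
  then show ?thesis using assms by (metis a_minus_def l_zero r_neg)
qed

lemma minus_swap: "\<lbrakk>x \<in> carrier M; y \<in> carrier M\<rbrakk> \<Longrightarrow> \<ominus> (x \<ominus> y) = y \<ominus> x"
  by (simp add: a_minus_def minus_add a_comm)

lemma metric: "Metric_space (carrier M) (norm_dist M N)"
proof
  fix x y z
  show "0 \<le> norm_dist M N x y"
    by (simp add: norm_dist_def N_ge_0)
  show "norm_dist M N x y = norm_dist M N y x"
    using N_uminus[of "x \<ominus> y"] minus_swap[of x y] by (auto simp: norm_dist_def)
  assume xy: "x \<in> carrier M" "y \<in> carrier M"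
  then show "norm_dist M N x y = 0 \<longleftrightarrow> x = y"
    by (simp add: norm_dist_def N_eq_0 minus_eq_0_iff)
  assume "z \<in> carrier M"
  then show "norm_dist M N x z \<le> norm_dist M N x y + norm_dist M N y z"
    using xy N_triangle[of "x \<ominus> y" "y \<ominus> z"] by (simp add: norm_dist_def minus_telescope[of x y z])
qed

lemma limitin_iff:
  assumes "range X \<subseteq> carrier M"
  shows "limitin (Metric_space.mtopology (carrier M) (norm_dist M N)) X l sequentially \<longleftrightarrow>
    l \<in> carrier M \<and> (\<lambda>n. N (X n \<ominus> l)) \<longlonglongrightarrow> 0"
proof -
  have "X n \<in> carrier M" for n using assms by auto
  then show ?thesis
    by (auto simp: Metric_space.limitin_metric_dist_null[OF metric] norm_dist_def)
qed

lemma mcomplete_iff: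
  "Metric_space.mcomplete (carrier M) (norm_dist M N) \<longleftrightarrow>
   (\<forall>X. range X \<subseteq> carrier M \<and> (\<forall>r>0. \<exists>K. \<forall>m\<ge>K. \<forall>n\<ge>K. N (X m \<ominus> X n) < r) \<longrightarrow>
     (\<exists>l\<in>carrier M. (\<lambda>n. N (X n \<ominus> l)) \<longlonglongrightarrow> 0))"
proof -
  have MCauchy_iff: "Metric_space.MCauchy (carrier M) (norm_dist M N) X \<longleftrightarrow>
    range X \<subseteq> carrier M \<and> (\<forall>r>0. \<exists>K. \<forall>m\<ge>K. \<forall>n\<ge>K. N (X m \<ominus> X n) < r)" for X
  proof (cases "range X \<subseteq> carrier M")
    case True
    then have "X n \<in> carrier M" for n by auto
    then show ?thesis
      by (simp add: Metric_space.MCauchy_def[OF metric] norm_dist_def True)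
  qed (simp add: Metric_space.MCauchy_def[OF metric])
  show ?thesis
    unfolding Metric_space.mcomplete_def[OF metric] MCauchy_iff Bex_def
    by (intro all_cong1 imp_cong refl ex_cong1) (simp add: limitin_iff)
qed

end

section \<open>Fields as rings of scalars, and modules over them\<close>

lemma cring_scalar_ring: "cring (scalar_ring :: 'k::field ring)"
proof -
  have "\<exists>y. y + x = 0" for x :: 'k by (rule exI[of _ "- x"]) simp
  then show ?thesis
    by (intro cringI abelian_groupI comm_monoidI) (auto simp: scalar_ring_def algebra_simps)
qed

lemma scalar_ring_simps [simp]:
  "carrier scalar_ring = UNIV" "a \<oplus>\<^bsub>scalar_ring\<^esub> b = a + b" "a \<otimes>\<^bsub>scalar_ring\<^esub> b = a * b"
  "\<one>\<^bsub>scalar_ring\<^esub> = 1" "\<zero>\<^bsub>scalar_ring\<^esub> = 0"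
  by (simp_all add: scalar_ring_def)

lemma scalar_ring_a_inv [simp]: "\<ominus>\<^bsub>scalar_ring\<^esub> (a :: 'k::field) = - a"
proof -
  interpret cring "scalar_ring :: 'k ring" by (rule cring_scalar_ring)
  show ?thesis using minus_equality[of "- a" a] by simp
qed

lemma module_scalar_ringI:
  fixes M :: "('k::field, 'a, 'm) module_scheme" (structure)
  assumes "abelian_group M"
    and "\<And>a x. x \<in> carrier M \<Longrightarrow> a \<odot> x \<in> carrier M"
    and "\<And>a b x. x \<in> carrier M \<Longrightarrow> (a + b) \<odot> x = a \<odot> x \<oplus> b \<odot> x"
    and "\<And>a x y. \<lbrakk>x \<in> carrier M; y \<in> carrier M\<rbrakk> \<Longrightarrow> a \<odot> (x \<oplus> y) = a \<odot> x \<oplus> a \<odot> y"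
    and "\<And>a b x. x \<in> carrier M \<Longrightarrow> (a * b) \<odot> x = a \<odot> (b \<odot> x)"
    and "\<And>x. x \<in> carrier M \<Longrightarrow> 1 \<odot> x = x"
  shows "Module.module scalar_ring M"
  using assms by (intro moduleI cring_scalar_ring) auto

lemma uminus_eq_smult:
  fixes M :: "('k::field, 'a, 'm) module_scheme"
  assumes "Module.module scalar_ring M" "x \<in> carrier M"
  shows "\<ominus>\<^bsub>M\<^esub> x = (- 1) \<odot>\<^bsub>M\<^esub> x"
proof -
  interpret Module.module scalar_ring M by (rule assms)
  show ?thesis using smult_l_minus[of 1 x] smult_one[of x] assms(2) by simp
qed

context jb_algebra
begin

lemma normed_group: "normed_group A (nrm A)"
proof
  fix x assume x: "x \<in> carrier A"
  then show "nrm A (\<ominus> x) = nrm A x"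
    using nrm_smult[OF x, of "-1"] by (simp add: uminus_eq_smult[OF module_axioms])
qed (auto simp: nrm_nonneg nrm_eq_zero nrm_triangle)

end

text \<open>A basis of \<open>R\<close> is extended to the whole space and sent to 0, which leaves a
  projection onto a complement of \<open>R\<close>. With the kernel of a surjection as
  \<open>R\<close> it produces a linear section.\<close>

lemma linear_projection_with_kernel:
  fixes R :: "'v::real_vector set"
  assumes "subspace R"
  obtains g :: "'v \<Rightarrow> 'v" where "linear g" "\<And>x. x \<in> R \<Longrightarrow> g x = 0" "\<And>x. x - g x \<in> R"
proof -
  obtain B where B: "B \<subseteq> R" "independent B" "R \<subseteq> span B"
    using maximal_independent_subset by blast
  obtain g where g: "linear g" "\<forall>b\<in>extend_basis B. g b = (if b \<in> B then 0 else b)"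
    using linear_independent_extend[OF independent_extend_basis[OF B(2)], of "\<lambda>b. if b \<in> B then 0 else b"]
    by blast
  have BE: "B \<subseteq> extend_basis B" by (rule extend_basis_superset[OF B(2)])
  interpret g: linear g by (rule g(1))
  have "x - g x \<in> span B" for x
  proof -
    have "x \<in> span (extend_basis B)" using span_extend_basis[OF B(2)] by simp
    then show ?thesis
    proof (induction rule: span_induct_alt)
      case (step a b y)
      have "b - g b \<in> span B" using g(2) step(1) by (auto simp: span_base span_zero)
      then have "a *\<^sub>R (b - g b) + (y - g y) \<in> span B"
        using step(2) by (intro span_add span_scale)
      then show ?case by (simp add: g.add g.scaleR algebra_simps)
    qed (simp add: g.zero span_zero)
  qed
  moreover have "span B = R"
    using B assms by (meson span_minimal subset_antisym)
  moreover have "g x = 0" if "x \<in> R" for x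
  proof -
    have "x \<in> span B" using that B by auto
    then show ?thesis
      by (induction rule: span_induct_alt) (use g(2) BE in \<open>auto simp: g.zero g.add g.scaleR\<close>)
  qed
  ultimately show ?thesis by (intro that[OF g(1)]) (simp_all only:)
qed

lemma lookup_scaleR: "Poly_Mapping.lookup (a *\<^sub>R f) x = a *\<^sub>R Poly_Mapping.lookup f x"
proof -
  have "finite {x. a *\<^sub>R Poly_Mapping.lookup f x \<noteq> 0}"
    by (rule finite_subset[OF _ finite_lookup[of f]]) auto
  then show ?thesis by (simp add: scaleR_poly_mapping_def)
qed

text \<open>No type can depend on the algebra \<open>T\<close>. The carrier is therefore made a retract, with projection \<open>k\<close>
  and linear section \<open>i\<close>, of the free vector space on its element type, and the product is transported
  there.\<close>

lemma real_module_retract: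
  fixes T :: "(real, 'b, 'm) module_scheme" (structure)
  assumes "Module.module scalar_ring T"
  obtains k :: "('b \<Rightarrow>\<^sub>0 real) \<Rightarrow> 'b" and i where
    "\<And>v. k v \<in> carrier T" "\<And>u v. k (u + v) = k u \<oplus> k v" "\<And>a v. k (a *\<^sub>R v) = a \<odot> k v"
    "\<And>x. x \<in> carrier T \<Longrightarrow> k (i x) = x"
    "\<And>x y. \<lbrakk>x \<in> carrier T; y \<in> carrier T\<rbrakk> \<Longrightarrow> i (x \<oplus> y) = i x + i y"
    "\<And>a x. x \<in> carrier T \<Longrightarrow> i (a \<odot> x) = a *\<^sub>R i x"
proof -
  interpret Module.module scalar_ring T by (rule assms)
  \<comment> \<open>The free space is built on the whole element type; basis vectors outside the
    carrier are sent to zero.\<close>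
  define k where "k f = finsum T (\<lambda>x. Poly_Mapping.lookup f x \<odot> x) (Poly_Mapping.keys f \<inter> carrier T)" for f :: "'b \<Rightarrow>\<^sub>0 real"
  have k_eq: "k f = finsum T (\<lambda>x. Poly_Mapping.lookup f x \<odot> x) A"
    if "finite A" "Poly_Mapping.keys f \<inter> carrier T \<subseteq> A" "A \<subseteq> carrier T" for f A
    unfolding k_def
  proof (rule add.finprod_mono_neutral_cong_left[OF that(1,2)])
    fix x assume "x \<in> A - Poly_Mapping.keys f \<inter> carrier T"
    then have "x \<in> carrier T" "Poly_Mapping.lookup f x = 0"
      using that by (auto simp: in_keys_iff)
    then show "Poly_Mapping.lookup f x \<odot> x = \<zero>"
      using smult_l_null[of x] by simp
  qed (use that in auto)
  have k_closed: "k f \<in> carrier T" for f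
    unfolding k_def by (rule finsum_closed) auto
  have k_add: "k (f + g) = k f \<oplus> k g" for f g
  proof -
    define A where "A = (Poly_Mapping.keys f \<union> Poly_Mapping.keys g) \<inter> carrier T"
    have A: "finite A" "A \<subseteq> carrier T" by (auto simp: A_def)
    have k_A: "k (f + g) = finsum T (\<lambda>x. Poly_Mapping.lookup (f + g) x \<odot> x) A"
      "k f = finsum T (\<lambda>x. Poly_Mapping.lookup f x \<odot> x) A"
      "k g = finsum T (\<lambda>x. Poly_Mapping.lookup g x \<odot> x) A"
      using A Poly_Mapping.keys_add[of f g] by (auto intro!: k_eq simp: A_def)
    have "k (f + g) = finsum T (\<lambda>x. Poly_Mapping.lookup f x \<odot> x \<oplus> Poly_Mapping.lookup g x \<odot> x) A"
      unfolding k_A(1) using A by (intro finsum_cong') (auto simp: lookup_add smult_l_distr[simplified])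
    also have "\<dots> = k f \<oplus> k g"
      unfolding k_A using A by (intro finsum_addf) auto
    finally show ?thesis .
  qed
  have k_single: "k (Poly_Mapping.single x 1) = x" if "x \<in> carrier T" for x
    using that finsum_insert[of "{}" x "\<lambda>y. Poly_Mapping.lookup (Poly_Mapping.single x 1) y \<odot> y"]
    by (simp add: k_eq[of "{x}"] smult_one[simplified])
  have k_scale: "k (a *\<^sub>R f) = a \<odot> k f" for a f
  proof -
    have "additive_hom": "finsum T (\<lambda>x. a \<odot> h x) A = a \<odot> finsum T h A"
      if "finite A" "h \<in> A \<rightarrow> carrier T" for h :: "'b \<Rightarrow> 'b" and A
      using that by (induction rule: finite_induct) (auto simp: smult_r_distr Pi_iff)
    have "k (a *\<^sub>R f) = finsum T (\<lambda>x. a \<odot> (Poly_Mapping.lookup f x \<odot> x)) (Poly_Mapping.keys f \<inter> carrier T)"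
      using smult_assoc1 by (subst k_eq[of "Poly_Mapping.keys f \<inter> carrier T"])
        (auto simp: lookup_scaleR in_keys_iff intro!: finsum_cong')
    also have "\<dots> = a \<odot> k f"
      unfolding k_def by (rule additive_hom) auto
    finally show ?thesis .
  qed
  have k_0: "k 0 = \<zero>" by (simp add: k_def)
  have "subspace {f. k f = \<zero>}"
    by (auto simp: subspace_def k_0 k_add k_scale)
  then obtain g where g: "linear g" "\<And>f. k f = \<zero> \<Longrightarrow> g f = 0" "\<And>f. k (f - g f) = \<zero>"
    using linear_projection_with_kernel[of "{f. k f = \<zero>}"] by auto
  interpret g: linear g by (rule g(1))
  have kg: "k (g f) = k f" for f
    using k_add[of "f - g f" "g f"] g(3)[of f] by (simp add: k_closed)
  have g_cong: "g f = g h" if "k f = k h" for f h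
  proof -
    have "k (f - h) \<oplus> k h = \<zero> \<oplus> k h"
      using k_add[of "f - h" h] that by (simp add: k_closed)
    then have "k (f - h) = \<zero>" by (simp add: k_closed)
    then show ?thesis using g(2) g.diff[of f h] by simp
  qed
  \<comment> \<open>\<open>g\<close> takes the same value on all preimages of an element under
    \<open>k\<close>, and this makes the choice of preimage linear.\<close>
  define i where "i x = g (Poly_Mapping.single x 1)" for x
  show ?thesis
  proof
    show "k (i x) = x" if "x \<in> carrier T" for x
      using that by (simp add: i_def kg k_single)
    show "i (x \<oplus> y) = i x + i y" if "x \<in> carrier T" "y \<in> carrier T" for x y
      unfolding i_def g.add[symmetric] using that by (intro g_cong) (simp add: k_add k_single)
    show "i (a \<odot> x) = a *\<^sub>R i x" if "x \<in> carrier T" for a x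
      unfolding i_def g.scaleR[symmetric] using that by (intro g_cong) (simp add: k_scale k_single)
  qed (rule k_closed k_add k_scale)+
qed

text \<open>Every product lies in the range of \<open>i\<close>, where the transported unit acts as
  the identity. The laws of \<open>T\<close> transfer by cancelling \<open>k\<close> against
  \<open>i\<close>, and the seminorm vanishes exactly on the kernel of \<open>k\<close>.\<close>

lemma unital_jb_algebra_as_jb_space:
  fixes T :: "'b normed_alg" (structure)
  assumes "unital_jb_algebra T"
  obtains k :: "('b \<Rightarrow>\<^sub>0 real) \<Rightarrow> 'b" and i where
    "\<And>v. k v \<in> carrier T" "\<And>u v. k (u + v) = k u \<oplus> k v" "\<And>a v. k (a *\<^sub>R v) = a \<odot> k v"
    "\<And>x. x \<in> carrier T \<Longrightarrow> k (i x) = x"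
    "\<And>x y. \<lbrakk>x \<in> carrier T; y \<in> carrier T\<rbrakk> \<Longrightarrow> i (x \<oplus> y) = i x + i y"
    "\<And>a x. x \<in> carrier T \<Longrightarrow> i (a \<odot> x) = a *\<^sub>R i x"
    "jb_space (\<lambda>u v. i (k u \<otimes> k v)) (i \<one>) (\<lambda>v. nrm T (k v))"
proof -
  interpret unital_jb_algebra T by (rule assms)
  interpret G: normed_group T "nrm T" by (rule normed_group)
  show ?thesis
  proof (rule real_module_retract[OF module_axioms])
    fix k :: "('b \<Rightarrow>\<^sub>0 real) \<Rightarrow> 'b" and i
    assume k: "\<And>v. k v \<in> carrier T" "\<And>u v. k (u + v) = k u \<oplus> k v" "\<And>a v. k (a *\<^sub>R v) = a \<odot> k v"
      and ki: "\<And>x. x \<in> carrier T \<Longrightarrow> k (i x) = x"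
      and i: "\<And>x y. \<lbrakk>x \<in> carrier T; y \<in> carrier T\<rbrakk> \<Longrightarrow> i (x \<oplus> y) = i x + i y"
      "\<And>a x. x \<in> carrier T \<Longrightarrow> i (a \<odot> x) = a *\<^sub>R i x"
    have k_diff: "k (u - v) = k u \<ominus> k v" for u v
    proof -
      have "k (u + (-1) *\<^sub>R v) = k u \<ominus> k v"
        by (simp only: k(2,3) a_minus_def uminus_eq_smult[OF module_axioms k(1)])
      then show ?thesis by simp
    qed
    have i0: "i \<zero> = 0" using i(2)[of \<zero> 0] by simp
    note closed = k(1) jprod_closed unit_closed
    have "jb_space (\<lambda>u v. i (k u \<otimes> k v)) (i \<one>) (\<lambda>v. nrm T (k v))"
    proof
      show "\<exists>l. (\<lambda>n. nrm T (k (X n - l))) \<longlonglongrightarrow> 0"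
        if "\<And>r. 0 < r \<Longrightarrow> \<exists>M. \<forall>m\<ge>M. \<forall>n\<ge>M. nrm T (k (X m - X n)) < r" for X
      proof -
        have "range (\<lambda>n. k (X n)) \<subseteq> carrier T" using k by auto
        moreover have "\<forall>r>0. \<exists>M. \<forall>m\<ge>M. \<forall>n\<ge>M. nrm T (k (X m) \<ominus> k (X n)) < r"
          using that by (simp add: k_diff)
        ultimately obtain l where "l \<in> carrier T" "(\<lambda>n. nrm T (k (X n) \<ominus> l)) \<longlonglongrightarrow> 0"
          using complete[unfolded G.mcomplete_iff, rule_format, of "\<lambda>n. k (X n)"] by auto
        then show ?thesis by (intro exI[of _ "i l"]) (simp add: k_diff ki)
      qed
      show "i (k x \<otimes> k (i (k y \<otimes> k (i (k x \<otimes> k x))))) = i (k (i (k x \<otimes> k y)) \<otimes> k (i (k x \<otimes> k x)))" for x y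
        by (simp add: ki closed jordan_identity)
      show "i (k (x + y) \<otimes> k z) = i (k x \<otimes> k z) + i (k y \<otimes> k z)" for x y z
        by (simp add: k i closed jprod_add)
      show "i (k (a *\<^sub>R x) \<otimes> k y) = a *\<^sub>R i (k x \<otimes> k y)" for a x y
        by (simp add: k i closed jprod_smult)
      show "i (k x \<otimes> k y) = i (k y \<otimes> k x)" for x y
        by (simp add: closed jprod_comm)
      show "nrm T (k (x + y)) \<le> nrm T (k x) + nrm T (k y)" for x y
        by (simp add: k nrm_triangle)
      show "nrm T (k (a *\<^sub>R x)) = \<bar>a\<bar> * nrm T (k x)" for a x
        by (simp add: k nrm_smult)
      show "nrm T (k (i (k x \<otimes> k x))) \<le> nrm T (k (i (k x \<otimes> k x) + i (k y \<otimes> k y)))" for x y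
        by (simp add: k(1,2) ki closed nrm_square_add)
      show "i (k (i \<one>) \<otimes> k x) = 0" if "nrm T (k x) = 0" for x
        using that by (simp add: ki closed unit nrm_eq_zero i0)
    qed (simp_all add: ki closed unit nrm_jprod nrm_square)
    with k ki i show thesis by (rule that)
  qed
qed

section \<open>The algebra of matrix functions\<close>

definition sym2 :: "real \<Rightarrow> real \<Rightarrow> real \<Rightarrow> real^2^2" where
  "sym2 a b d = (\<chi> i j. if i = j then if i = 1 then a else d else b)"

lemma sym2_nth [simp]:
  "sym2 a b d $ 1 $ 1 = a" "sym2 a b d $ 1 $ 2 = b" "sym2 a b d $ 2 $ 1 = b" "sym2 a b d $ 2 $ 2 = d"
  by (simp_all add: sym2_def)

lemma mat2_eq_iff:
  fixes A :: "'a^2^2"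
  shows "A = B \<longleftrightarrow> A $ 1 $ 1 = B $ 1 $ 1 \<and> A $ 1 $ 2 = B $ 1 $ 2 \<and> A $ 2 $ 1 = B $ 2 $ 1 \<and> A $ 2 $ 2 = B $ 2 $ 2"
  by (auto simp: vec_eq_iff forall_2)

lemma sym2_eq_iff [simp]: "sym2 a b d = sym2 a' b' d' \<longleftrightarrow> a = a' \<and> b = b' \<and> d = d'"
  by (auto simp: mat2_eq_iff)

lemma sym2_vector: "vector [vector [a, b], vector [b, d]] = sym2 a b d"
  by (simp add: mat2_eq_iff vector_2)

lemma sym2_add: "sym2 a b d + sym2 a' b' d' = sym2 (a + a') (b + b') (d + d')"
  by (simp add: mat2_eq_iff)

lemma sym2_scaleR: "r *\<^sub>R sym2 a b d = sym2 (r * a) (r * b) (r * d)"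
  by (simp add: mat2_eq_iff)

lemma sym2_one: "mat 1 = sym2 1 0 1"
  by (simp add: mat2_eq_iff mat_def)

lemma sym2_zero: "0 = sym2 0 0 0"
  by (simp add: mat2_eq_iff)

lemma sym2_jprod:
  "(1/2) *\<^sub>R (sym2 a b d ** sym2 a' b' d' + sym2 a' b' d' ** sym2 a b d) =
   sym2 (a * a' + b * b') (((a + d) * b' + (a' + d') * b) / 2) (d * d' + b * b')"
  by (simp add: mat2_eq_iff matrix_matrix_mult_def sum_2 field_simps)

lemma transpose_sym2 [simp]: "transpose (sym2 a b d) = sym2 a b d"
  by (simp add: mat2_eq_iff transpose_def)

lemma symmetric_eq_sym2:
  assumes "transpose M = M"
  shows "M = sym2 (M $ 1 $ 1) (M $ 1 $ 2) (M $ 2 $ 2)"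
proof -
  have "M $ 2 $ 1 = transpose M $ 1 $ 2" by (simp add: transpose_def)
  also have "\<dots> = M $ 1 $ 2" by (simp only: assms)
  finally show ?thesis by (simp add: mat2_eq_iff)
qed

lemma is_diagonal_sym2 [simp]: "is_diagonal (sym2 a b d) \<longleftrightarrow> b = 0"
  by (simp add: is_diagonal_def forall_2)

abbreviation "J \<equiv> carrier J_alg"
abbreviation J_plus (infixl \<open>\<oplus>\<^sub>J\<close> 65) where "f \<oplus>\<^sub>J g \<equiv> f \<oplus>\<^bsub>J_alg\<^esub> g"
abbreviation J_minus (infixl \<open>\<ominus>\<^sub>J\<close> 65) where "f \<ominus>\<^sub>J g \<equiv> f \<ominus>\<^bsub>J_alg\<^esub> g"
abbreviation J_times (infixl \<open>\<otimes>\<^sub>J\<close> 70) where "f \<otimes>\<^sub>J g \<equiv> f \<otimes>\<^bsub>J_alg\<^esub> g"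
abbreviation J_scale (infixl \<open>\<odot>\<^sub>J\<close> 70) where "r \<odot>\<^sub>J f \<equiv> r \<odot>\<^bsub>J_alg\<^esub> f"

section \<open>Operator norm of real 2x2 matrices\<close>

abbreviation opn :: "real^2^2 \<Rightarrow> real" where
  "opn M \<equiv> onorm (\<lambda>x. M *v x)"

lemma opn_bound: "norm (M *v x) \<le> opn M * norm x"
  by (rule onorm) (rule matrix_vector_mul_bounded_linear)

lemma opn_nonneg: "0 \<le> opn M"
  by (rule onorm_pos_le) (rule matrix_vector_mul_bounded_linear)

lemma opn_add: "opn (A + B) \<le> opn A + opn B"
  using onorm_triangle[OF matrix_vector_mul_bounded_linear matrix_vector_mul_bounded_linear, of A B]
  by (simp add: matrix_vector_mult_add_rdistrib)

lemma opn_scaleR: "opn (r *\<^sub>R A) = \<bar>r\<bar> * opn A"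
  using onorm_scaleR[OF matrix_vector_mul_bounded_linear, of r A]
  by (simp add: scaleR_matrix_vector_assoc)

lemma opn_mult: "opn (A ** B) \<le> opn A * opn B"
  using onorm_compose[OF matrix_vector_mul_bounded_linear matrix_vector_mul_bounded_linear, of A B]
  by (simp add: o_def matrix_vector_mul_assoc)

lemma opn_jprod: "opn ((1/2) *\<^sub>R (A ** B + B ** A)) \<le> opn A * opn B"
proof -
  have "opn (A ** B + B ** A) \<le> 2 * (opn A * opn B)"
    using opn_add[of "A ** B" "B ** A"] opn_mult[of A B] opn_mult[of B A] by (simp add: mult.commute)
  then show ?thesis by (simp add: opn_scaleR)
qed

lemma opn_component: "\<bar>M $ i $ j\<bar> \<le> opn M"
  by (rule matrix_component_le_onorm)

lemma opn_le_components: "(\<And>i j. \<bar>M $ i $ j\<bar> \<le> B) \<Longrightarrow> opn M \<le> 4 * B"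
  using onorm_le_matrix_component[of M B] by simp

lemma opn_sym2_le: "\<bar>a\<bar> \<le> B \<Longrightarrow> \<bar>b\<bar> \<le> B \<Longrightarrow> \<bar>d\<bar> \<le> B \<Longrightarrow> opn (sym2 a b d) \<le> 4 * B"
  by (rule opn_le_components) (simp add: sym2_def)

lemma symmetric_inner: "transpose M = M \<Longrightarrow> (M *v x) \<bullet> y = x \<bullet> (M *v y)" for M :: "real^2^2"
  by (metis dot_lmul_matrix transpose_matrix_vector)

text \<open>Cauchy-Schwarz on the quadratic form of \<open>K\<close>. It yields the norm identity
  for squares with \<open>K = M ** M\<close>, and the inequality for sums of squares when
  \<open>K\<close> is such a sum.\<close>

lemma opn_square_le_of_form:
  assumes "\<And>x. (norm (M *v x))\<^sup>2 \<le> x \<bullet> (K *v x)"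
  shows "(opn M)\<^sup>2 \<le> opn K"
proof -
  have "norm (M *v x) \<le> sqrt (opn K) * norm x" for x
  proof -
    have "(norm (M *v x))\<^sup>2 \<le> norm x * norm (K *v x)"
      using assms[of x] norm_cauchy_schwarz[of x "K *v x"] by linarith
    also have "\<dots> \<le> norm x * (opn K * norm x)"
      by (intro mult_left_mono opn_bound) simp
    also have "\<dots> = (sqrt (opn K) * norm x)\<^sup>2"
      using opn_nonneg[of K] by (simp add: power_mult_distrib) (simp add: power2_eq_square)
    finally show ?thesis
      by (rule power2_le_imp_le) (simp add: opn_nonneg)
  qed
  then have "opn M \<le> sqrt (opn K)" by (rule onorm_le)
  then show ?thesis
    using power_mono[of "opn M" "sqrt (opn K)" 2] opn_nonneg by simp
qed

lemma norm_square_symmetric: "transpose M = M \<Longrightarrow> (norm (M *v x))\<^sup>2 = x \<bullet> ((M ** M) *v x)" for M :: "real^2^2"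
  by (simp add: power2_norm_eq_inner symmetric_inner matrix_vector_mul_assoc)

lemma opn_square:
  assumes "transpose M = M"
  shows "opn (M ** M) = (opn M)\<^sup>2"
proof (rule order_antisym)
  show "opn (M ** M) \<le> (opn M)\<^sup>2"
    using opn_mult[of M M] by (simp add: power2_eq_square)
  show "(opn M)\<^sup>2 \<le> opn (M ** M)"
    by (rule opn_square_le_of_form) (simp add: norm_square_symmetric assms)
qed

lemma opn_square_add:
  assumes "transpose M = M" "transpose K = K"
  shows "opn (M ** M) \<le> opn (M ** M + K ** K)"
proof -
  have "(norm (M *v x))\<^sup>2 \<le> x \<bullet> ((M ** M + K ** K) *v x)" for x
    using norm_square_symmetric[OF assms(2), of x, symmetric]
    by (simp add: norm_square_symmetric[OF assms(1)] matrix_vector_mult_add_rdistrib inner_add_right)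
  then show ?thesis
    unfolding opn_square[OF assms(1)] by (rule opn_square_le_of_form)
qed

section \<open>The matrix algebra in terms of entry functions\<close>

definition mk :: "(real \<Rightarrow> real) \<Rightarrow> (real \<Rightarrow> real) \<Rightarrow> (real \<Rightarrow> real) \<Rightarrow> real \<Rightarrow> real^2^2" where
  "mk a b d = (\<lambda>t\<in>{0..1}. sym2 (a t) (b t) (d t))"

definition J_entries :: "(real \<Rightarrow> real) \<Rightarrow> (real \<Rightarrow> real) \<Rightarrow> (real \<Rightarrow> real) \<Rightarrow> bool" where
  "J_entries a b d \<longleftrightarrow> continuous_on {0..1} a \<and> continuous_on {0..1} b \<and> continuous_on {0..1} d \<and>
     b 0 = 0 \<and> b 1 = 0"

abbreviation "E11 a \<equiv> mk a (\<lambda>_. 0) (\<lambda>_. 0)"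
abbreviation "E12 b \<equiv> mk (\<lambda>_. 0) b (\<lambda>_. 0)"
abbreviation "E22 d \<equiv> mk (\<lambda>_. 0) (\<lambda>_. 0) d"

lemma mk_eq_iff: "mk a b d = mk a' b' d' \<longleftrightarrow> (\<forall>t. 0 \<le> t \<and> t \<le> 1 \<longrightarrow> a t = a' t \<and> b t = b' t \<and> d t = d' t)"
  by (auto simp: mk_def restrict_def fun_eq_iff)

lemma continuous_on_sym2:
  assumes "continuous_on S a" "continuous_on S b" "continuous_on S d"
  shows "continuous_on S (\<lambda>t. sym2 (a t) (b t) (d t))"
  unfolding sym2_def
proof (intro continuous_on_vec_lambda)
  show "continuous_on S (\<lambda>t. if i = j then if i = 1 then a t else d t else b t)" for i j :: 2
    using assms by (cases "i = j"; cases "i = 1") simp_all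
qed

lemma mk_in_J:
  assumes "J_entries a b d"
  shows "mk a b d \<in> J"
proof -
  have "continuous_on {0..1} (\<lambda>t. sym2 (a t) (b t) (d t))"
    using assms by (intro continuous_on_sym2) (simp_all add: J_entries_def)
  then have "continuous_on {0..1} (mk a b d)"
    by (rule continuous_on_eq) (simp add: mk_def)
  then show ?thesis
    using assms by (auto simp: J_alg_def C01_M2_sa_def J_entries_def mk_def)
qed

lemma J_cases:
  assumes "f \<in> J"
  obtains a b d where "f = mk a b d" "J_entries a b d"
proof
  have f: "f \<in> {0..1} \<rightarrow>\<^sub>E {M. transpose M = M}" "continuous_on {0..1} f" "is_diagonal (f 0)" "is_diagonal (f 1)"
    using assms by (auto simp: J_alg_def C01_M2_sa_def)
  show "f = mk (\<lambda>t. f t $ 1 $ 1) (\<lambda>t. f t $ 1 $ 2) (\<lambda>t. f t $ 2 $ 2)"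
  proof
    fix t
    show "f t = mk (\<lambda>t. f t $ 1 $ 1) (\<lambda>t. f t $ 1 $ 2) (\<lambda>t. f t $ 2 $ 2) t"
    proof (cases "t \<in> {0..1}")
      case True
      then have "transpose (f t) = f t" using f(1) by auto
      then have "f t = sym2 (f t $ 1 $ 1) (f t $ 1 $ 2) (f t $ 2 $ 2)" by (rule symmetric_eq_sym2)
      also have "\<dots> = mk (\<lambda>t. f t $ 1 $ 1) (\<lambda>t. f t $ 1 $ 2) (\<lambda>t. f t $ 2 $ 2) t"
        using True by (simp only: mk_def restrict_apply' if_P)
      finally show ?thesis .
    next
      case False
      then show ?thesis using PiE_arb[OF f(1) False] by (simp only: mk_def restrict_apply if_False)
    qed
  qed
  show "J_entries (\<lambda>t. f t $ 1 $ 1) (\<lambda>t. f t $ 1 $ 2) (\<lambda>t. f t $ 2 $ 2)"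
    unfolding J_entries_def
  proof (intro conjI)
    have "continuous_on {0..1} (\<lambda>t. f t $ i $ j)" for i j
      by (intro bounded_linear.continuous_on[OF bounded_linear_vec_nth] f(2))
    then show "continuous_on {0..1} (\<lambda>t. f t $ 1 $ 1)" "continuous_on {0..1} (\<lambda>t. f t $ 1 $ 2)"
      "continuous_on {0..1} (\<lambda>t. f t $ 2 $ 2)" by this+
    show "f 0 $ 1 $ 2 = 0" "f 1 $ 1 $ 2 = 0"
      using f(3,4) by (simp_all add: is_diagonal_def)
  qed
qed

lemma J_one: "\<one>\<^bsub>J_alg\<^esub> = mk (\<lambda>_. 1) (\<lambda>_. 0) (\<lambda>_. 1)"
  by (simp add: J_alg_def C01_M2_sa_def mk_def sym2_one)

lemma J_zero: "\<zero>\<^bsub>J_alg\<^esub> = mk (\<lambda>_. 0) (\<lambda>_. 0) (\<lambda>_. 0)"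
  unfolding J_alg_def C01_M2_sa_def mk_def sym2_zero[symmetric] by simp

lemma J_add: "mk a b d \<oplus>\<^sub>J mk a' b' d' = mk (\<lambda>t. a t + a' t) (\<lambda>t. b t + b' t) (\<lambda>t. d t + d' t)"
  by (auto simp: J_alg_def C01_M2_sa_def mk_def sym2_add restrict_def)

lemma J_smult: "r \<odot>\<^sub>J mk a b d = mk (\<lambda>t. r * a t) (\<lambda>t. r * b t) (\<lambda>t. r * d t)"
  by (auto simp: J_alg_def C01_M2_sa_def mk_def sym2_scaleR restrict_def)

lemma J_mult: "mk a b d \<otimes>\<^sub>J mk a' b' d' =
  mk (\<lambda>t. a t * a' t + b t * b' t) (\<lambda>t. ((a t + d t) * b' t + (a' t + d' t) * b t) / 2) (\<lambda>t. d t * d' t + b t * b' t)"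
  using sym2_jprod by (auto simp: J_alg_def C01_M2_sa_def mk_def restrict_def fun_eq_iff)

lemma J_nrm: "nrm J_alg f = (SUP t\<in>{0..1}. opn (f t))"
  by (simp add: J_alg_def C01_M2_sa_def)

lemma mk_apply: "0 \<le> t \<Longrightarrow> t \<le> 1 \<Longrightarrow> mk a b d t = sym2 (a t) (b t) (d t)"
  by (simp add: mk_def)

lemma J_bdd_above:
  assumes "f \<in> J"
  shows "bdd_above ((\<lambda>t. opn (f t)) ` {0..1})"
proof -
  obtain a b d where f: "f = mk a b d" "J_entries a b d" using assms by (rule J_cases)
  have bd: "\<exists>B. \<forall>t\<in>{0..1}. \<bar>h t\<bar> \<le> B" if "continuous_on {0..1} h" for h :: "real \<Rightarrow> real"
    using compact_imp_bounded[OF compact_continuous_image[OF that compact_Icc]]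
    by (auto simp: bounded_iff)
  obtain A B D where "\<forall>t\<in>{0..1}. \<bar>a t\<bar> \<le> A" "\<forall>t\<in>{0..1}. \<bar>b t\<bar> \<le> B" "\<forall>t\<in>{0..1}. \<bar>d t\<bar> \<le> D"
    using f(2) bd unfolding J_entries_def by metis
  then have "opn (f t) \<le> 4 * max A (max B D)" if "t \<in> {0..1}" for t
    using that unfolding f(1) by (simp add: mk_def) (intro opn_sym2_le, auto simp: le_max_iff_disj)
  then show ?thesis by (rule bdd_aboveI2)
qed

lemma J_nrm_upper: "f \<in> J \<Longrightarrow> 0 \<le> t \<Longrightarrow> t \<le> 1 \<Longrightarrow> opn (f t) \<le> nrm J_alg f"
  unfolding J_nrm by (intro cSUP_upper J_bdd_above) auto

lemma J_nrm_least: "(\<And>t. 0 \<le> t \<Longrightarrow> t \<le> 1 \<Longrightarrow> opn (f t) \<le> B) \<Longrightarrow> nrm J_alg f \<le> B"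
  unfolding J_nrm by (intro cSUP_least) auto

lemma J_nrm_ge_entries:
  assumes "J_entries a b d" "0 \<le> t" "t \<le> 1"
  shows "\<bar>a t\<bar> \<le> nrm J_alg (mk a b d)" "\<bar>b t\<bar> \<le> nrm J_alg (mk a b d)" "\<bar>d t\<bar> \<le> nrm J_alg (mk a b d)"
  using J_nrm_upper[OF mk_in_J[OF assms(1)] assms(2,3)]
    opn_component[of "sym2 (a t) (b t) (d t)" 1 1] opn_component[of "sym2 (a t) (b t) (d t)" 1 2]
    opn_component[of "sym2 (a t) (b t) (d t)" 2 2]
  by (simp_all add: mk_apply assms)

text \<open>The factor 4 counts matrix entries. Together with \<open>J_nrm_ge_entries\<close> it
  makes norm convergence the same as uniform convergence of the entries.\<close>

lemma J_nrm_le_entries: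
  assumes "\<And>t. 0 \<le> t \<Longrightarrow> t \<le> 1 \<Longrightarrow> \<bar>a t\<bar> \<le> B" "\<And>t. 0 \<le> t \<Longrightarrow> t \<le> 1 \<Longrightarrow> \<bar>b t\<bar> \<le> B"
    "\<And>t. 0 \<le> t \<Longrightarrow> t \<le> 1 \<Longrightarrow> \<bar>d t\<bar> \<le> B"
  shows "nrm J_alg (mk a b d) \<le> 4 * B"
  by (rule J_nrm_least) (simp add: mk_apply opn_sym2_le assms)

lemma J_entries_add: "J_entries a b d \<Longrightarrow> J_entries a' b' d' \<Longrightarrow>
    J_entries (\<lambda>t. a t + a' t) (\<lambda>t. b t + b' t) (\<lambda>t. d t + d' t)"
  and J_entries_smult: "J_entries a b d \<Longrightarrow> J_entries (\<lambda>t. r * a t) (\<lambda>t. r * b t) (\<lambda>t. r * d t)"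
  and J_entries_mult: "J_entries a b d \<Longrightarrow> J_entries a' b' d' \<Longrightarrow>
    J_entries (\<lambda>t. a t * a' t + b t * b' t) (\<lambda>t. ((a t + d t) * b' t + (a' t + d' t) * b t) / 2)
      (\<lambda>t. d t * d' t + b t * b' t)"
  by (auto simp: J_entries_def intro!: continuous_on_add continuous_on_diff continuous_on_mult continuous_on_divide continuous_on_const)

lemmas J_ops = J_one J_zero J_add J_smult J_mult
lemmas J_entries_intros = J_entries_add J_entries_smult J_entries_mult

lemma J_closed:
  assumes "f \<in> J" "g \<in> J"
  shows "f \<otimes>\<^sub>J g \<in> J" "f \<oplus>\<^sub>J g \<in> J"
proof -
  obtain a b d a' b' d' where "f = mk a b d" "J_entries a b d" "g = mk a' b' d'" "J_entries a' b' d'"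
    using assms by (elim J_cases)
  then show "f \<otimes>\<^sub>J g \<in> J" "f \<oplus>\<^sub>J g \<in> J"
    by (simp_all only: J_ops) (intro mk_in_J J_entries_intros; assumption)+
qed

lemma J_smult_closed: "f \<in> J \<Longrightarrow> r \<odot>\<^sub>J f \<in> J"
  by (erule J_cases) (simp add: J_smult mk_in_J J_entries_smult)

lemma J_one_zero_closed: "\<one>\<^bsub>J_alg\<^esub> \<in> J" "\<zero>\<^bsub>J_alg\<^esub> \<in> J"
  by (simp_all add: J_ops mk_in_J J_entries_def)

lemma J_module: "Module.module scalar_ring J_alg"
proof (rule module_scalar_ringI)
  show "abelian_group J_alg"
  proof (rule abelian_groupI)
    fix x y z
    assume x: "x \<in> J"
    show "\<exists>y\<in>J. y \<oplus>\<^sub>J x = \<zero>\<^bsub>J_alg\<^esub>"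
    proof (rule bexI[of _ "(-1) \<odot>\<^sub>J x"])
      show "(-1) \<odot>\<^sub>J x \<oplus>\<^sub>J x = \<zero>\<^bsub>J_alg\<^esub>"
        using x by (elim J_cases) (simp add: J_ops)
    qed (rule J_smult_closed[OF x])
    show "\<zero>\<^bsub>J_alg\<^esub> \<oplus>\<^sub>J x = x"
      using x by (elim J_cases) (simp add: J_ops)
    assume y: "y \<in> J"
    show "x \<oplus>\<^sub>J y = y \<oplus>\<^sub>J x"
      using x y by (elim J_cases) (simp add: J_ops mk_eq_iff)
    assume z: "z \<in> J"
    show "x \<oplus>\<^sub>J y \<oplus>\<^sub>J z = x \<oplus>\<^sub>J (y \<oplus>\<^sub>J z)"
      using x y z by (elim J_cases) (simp add: J_ops mk_eq_iff)
  qed (simp_all add: J_closed J_one_zero_closed)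
next
  fix r s x
  assume x: "x \<in> J"
  show "(r + s) \<odot>\<^sub>J x = r \<odot>\<^sub>J x \<oplus>\<^sub>J s \<odot>\<^sub>J x"
    "(r * s) \<odot>\<^sub>J x = r \<odot>\<^sub>J (s \<odot>\<^sub>J x)" "1 \<odot>\<^sub>J x = x"
    using x by (elim J_cases; simp add: J_ops mk_eq_iff algebra_simps)+
  fix y assume y: "y \<in> J"
  show "r \<odot>\<^sub>J (x \<oplus>\<^sub>J y) = r \<odot>\<^sub>J x \<oplus>\<^sub>J r \<odot>\<^sub>J y"
    using x y by (elim J_cases) (simp add: J_ops mk_eq_iff algebra_simps)
qed (simp_all add: J_closed J_smult_closed)

lemma J_diff_mk:
  assumes "J_entries a' b' d'"
  shows "mk a b d \<ominus>\<^sub>J mk a' b' d' = mk (\<lambda>t. a t - a' t) (\<lambda>t. b t - b' t) (\<lambda>t. d t - d' t)"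
  unfolding a_minus_def uminus_eq_smult[OF J_module mk_in_J[OF assms]] J_ops by simp

lemma J_entries_diff: "J_entries a b d \<Longrightarrow> J_entries a' b' d' \<Longrightarrow>
    J_entries (\<lambda>t. a t - a' t) (\<lambda>t. b t - b' t) (\<lambda>t. d t - d' t)"
  by (auto simp: J_entries_def intro!: continuous_on_add continuous_on_diff continuous_on_mult continuous_on_divide continuous_on_const)

lemma J_apply:
  assumes "0 \<le> t" "t \<le> 1"
  shows "(f \<oplus>\<^sub>J g) t = f t + g t" "(r \<odot>\<^sub>J f) t = r *\<^sub>R f t"
    "(f \<otimes>\<^sub>J g) t = (1/2) *\<^sub>R (f t ** g t + g t ** f t)"
  using assms by (simp_all add: J_alg_def C01_M2_sa_def)

lemma J_symmetric: "f \<in> J \<Longrightarrow> 0 \<le> t \<Longrightarrow> t \<le> 1 \<Longrightarrow> transpose (f t) = f t"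
  by (erule J_cases) (simp add: mk_apply)

lemma J_square_apply: "0 \<le> t \<Longrightarrow> t \<le> 1 \<Longrightarrow> (f \<otimes>\<^sub>J f) t = f t ** f t"
  by (simp only: J_apply(3) scaleR_half_double)

text \<open>The entries are uniformly Cauchy, and uniform limits preserve continuity and the
  vanishing of the off-diagonal entry at both endpoints.\<close>

lemma J_complete: "Metric_space.mcomplete J (norm_dist J_alg (nrm J_alg))"
  if "normed_group J_alg (nrm J_alg)"
proof -
  interpret normed_group J_alg "nrm J_alg" by (rule that)
  have "\<exists>l\<in>J. (\<lambda>n. nrm J_alg (X n \<ominus>\<^sub>J l)) \<longlonglongrightarrow> 0"
    if X: "range X \<subseteq> J" and C: "\<forall>r>0. \<exists>K. \<forall>m\<ge>K. \<forall>n\<ge>K. nrm J_alg (X m \<ominus>\<^sub>J X n) < r" for X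
  proof -
    have "X n \<in> J" for n using X by auto
    then have "\<exists>a b d. X n = mk a b d \<and> J_entries a b d" for n
      by (metis J_cases)
    then obtain a b d where abd: "\<And>n. X n = mk (a n) (b n) (d n)" "\<And>n. J_entries (a n) (b n) (d n)"
      by metis
    have lim: "\<exists>l. uniform_limit {0..1} u l sequentially"
      if u: "\<And>m n t. 0 \<le> t \<Longrightarrow> t \<le> 1 \<Longrightarrow> \<bar>u m t - u n t\<bar> \<le> nrm J_alg (X m \<ominus>\<^sub>J X n)" for u :: "nat \<Rightarrow> real \<Rightarrow> real"
    proof -
      have "uniformly_Cauchy_on {0..1} u"
        unfolding uniformly_Cauchy_on_def dist_real_def
      proof (intro allI impI)
        fix r :: real assume "0 < r"
        then obtain K where "\<forall>m\<ge>K. \<forall>n\<ge>K. nrm J_alg (X m \<ominus>\<^sub>J X n) < r" using C by blast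
        then show "\<exists>K. \<forall>t\<in>{0..1}. \<forall>m\<ge>K. \<forall>n\<ge>K. \<bar>u m t - u n t\<bar> < r"
          using u by (meson atLeastAtMost_iff le_less_trans)
      qed
      then show ?thesis
        using Cauchy_uniformly_convergent uniformly_convergent_on_def by blast
    qed
    have le: "\<bar>a m t - a n t\<bar> \<le> nrm J_alg (X m \<ominus>\<^sub>J X n)"
      "\<bar>b m t - b n t\<bar> \<le> nrm J_alg (X m \<ominus>\<^sub>J X n)"
      "\<bar>d m t - d n t\<bar> \<le> nrm J_alg (X m \<ominus>\<^sub>J X n)" if "0 \<le> t" "t \<le> 1" for m n t
      unfolding abd(1) J_diff_mk[OF abd(2)]
      using J_nrm_ge_entries[OF J_entries_diff[OF abd(2)[of m] abd(2)[of n]] that] by simp_all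
    obtain A where A: "uniform_limit {0..1} a A sequentially"
      using lim[of a, OF le(1)] by auto
    obtain B where B: "uniform_limit {0..1} b B sequentially"
      using lim[of b, OF le(2)] by auto
    obtain D where D: "uniform_limit {0..1} d D sequentially"
      using lim[of d, OF le(3)] by auto
    note lims = A B D
    have "(\<lambda>n. b n t) \<longlonglongrightarrow> B t" if "t \<in> {0..1}" for t
      using lims(2) that by (rule tendsto_uniform_limitI)
    from this[of 0] this[of 1] have "B 0 = 0" "B 1 = 0"
      using abd(2) by (auto simp: J_entries_def LIMSEQ_const_iff)
    moreover have "continuous_on {0..1} A" "continuous_on {0..1} B" "continuous_on {0..1} D"
      using abd(2) by (auto intro!: uniform_limit_theorem[OF _ lims(1)] uniform_limit_theorem[OF _ lims(2)]
        uniform_limit_theorem[OF _ lims(3)] simp: J_entries_def)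
    ultimately have L: "J_entries A B D" by (simp add: J_entries_def)
    have "(\<lambda>n. nrm J_alg (X n \<ominus>\<^sub>J mk A B D)) \<longlonglongrightarrow> 0"
    proof (rule LIMSEQ_I)
      fix r :: real assume "0 < r"
      \<comment> \<open>\<open>J_nrm_le_entries\<close> costs a factor 4, and 4 (r / 5) is still
        strictly below r.\<close>
      then have r: "0 < r / 5" by simp
      have "\<forall>\<^sub>F n in sequentially. \<forall>t\<in>{0..1}. \<bar>a n t - A t\<bar> < r / 5 \<and> \<bar>b n t - B t\<bar> < r / 5 \<and> \<bar>d n t - D t\<bar> < r / 5"
        using uniform_limitD[OF lims(1) r] uniform_limitD[OF lims(2) r] uniform_limitD[OF lims(3) r]
        by eventually_elim (auto simp: dist_real_def)
      then obtain K where K: "\<And>n t. n \<ge> K \<Longrightarrow> t \<in> {0..1} \<Longrightarrow> \<bar>a n t - A t\<bar> < r / 5 \<and> \<bar>b n t - B t\<bar> < r / 5 \<and> \<bar>d n t - D t\<bar> < r / 5"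
        unfolding eventually_sequentially by blast
      have "norm (nrm J_alg (X n \<ominus>\<^sub>J mk A B D) - 0) < r" if "n \<ge> K" for n
      proof -
        have "nrm J_alg (X n \<ominus>\<^sub>J mk A B D) \<le> 4 * (r / 5)"
          unfolding abd(1) J_diff_mk[OF L] using K[OF that]
          by (intro J_nrm_le_entries) (auto intro!: less_imp_le)
        moreover have "0 \<le> nrm J_alg (X n \<ominus>\<^sub>J mk A B D)"
          using X mk_in_J[OF L] by (intro N_ge_0) auto
        ultimately show ?thesis using \<open>0 < r\<close> by simp
      qed
      then show "\<exists>K. \<forall>n\<ge>K. norm (nrm J_alg (X n \<ominus>\<^sub>J mk A B D) - 0) < r" by blast
    qed
    then show ?thesis using mk_in_J[OF L] by blast
  qed
  then show ?thesis unfolding mcomplete_iff by blast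
qed

text \<open>Here (a, b, d) are the entries of x and (p, q, r) those of y; (u, s, v) are the entries
  of the square of x, while m and n are the off-diagonal entries of the products of y with x and
  with that square. Doubling clears the halves in m and n before everything is expanded.\<close>

lemma sym2_jordan_identity:
  fixes a b d p q r :: real
  defines "s \<equiv> ((a + d) * b + (a + d) * b) / 2" and "u \<equiv> a * a + b * b" and "v \<equiv> d * d + b * b"
  defines "m \<equiv> ((a + d) * q + (p + r) * b) / 2" and "n \<equiv> ((p + r) * s + (u + v) * q) / 2"
  shows "a * (p * u + q * s) + b * n = (a * p + b * q) * u + m * s"
   "((a + d) * n + ((p * u + q * s) + (r * v + q * s)) * b) / 2 =
     (((a * p + b * q) + (d * r + b * q)) * s + (u + v) * m) / 2"
   "d * (r * v + q * s) + b * n = (d * r + b * q) * v + m * s"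
proof -
  have s: "s = (a + d) * b" by (simp add: s_def)
  have m: "2 * m = (a + d) * q + (p + r) * b" and n: "2 * n = (p + r) * s + (u + v) * q"
    by (simp_all add: m_def n_def)
  have "2 * (a * (p * u + q * s) + b * n) = 2 * a * (p * u + q * s) + b * (2 * n)" by (simp add: algebra_simps)
  also have "\<dots> = 2 * (a * p + b * q) * u + (2 * m) * s"
    unfolding m n unfolding s u_def v_def by (simp add: algebra_simps)
  also have "\<dots> = 2 * ((a * p + b * q) * u + m * s)" by (simp add: algebra_simps)
  finally have "2 * (a * (p * u + q * s) + b * n) = 2 * ((a * p + b * q) * u + m * s)" .
  then show "a * (p * u + q * s) + b * n = (a * p + b * q) * u + m * s" by simp
  have "2 * (d * (r * v + q * s) + b * n) = 2 * d * (r * v + q * s) + b * (2 * n)" by (simp add: algebra_simps)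
  also have "\<dots> = 2 * (d * r + b * q) * v + (2 * m) * s"
    unfolding m n unfolding s u_def v_def by (simp add: algebra_simps)
  also have "\<dots> = 2 * ((d * r + b * q) * v + m * s)" by (simp add: algebra_simps)
  finally have "2 * (d * (r * v + q * s) + b * n) = 2 * ((d * r + b * q) * v + m * s)" .
  then show "d * (r * v + q * s) + b * n = (d * r + b * q) * v + m * s" by simp
  have "2 * ((a + d) * n + ((p * u + q * s) + (r * v + q * s)) * b) = (a + d) * (2 * n) + 2 * ((p * u + q * s) + (r * v + q * s)) * b" by (simp add: algebra_simps)
  also have "\<dots> = 2 * ((a * p + b * q) + (d * r + b * q)) * s + (u + v) * (2 * m)"
    unfolding m n unfolding s u_def v_def by (simp add: algebra_simps)
  also have "\<dots> = 2 * (((a * p + b * q) + (d * r + b * q)) * s + (u + v) * m)" by (simp add: algebra_simps)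
  finally have "2 * ((a + d) * n + ((p * u + q * s) + (r * v + q * s)) * b) = 2 * (((a * p + b * q) + (d * r + b * q)) * s + (u + v) * m)" .
  then show "((a + d) * n + ((p * u + q * s) + (r * v + q * s)) * b) / 2 =
     (((a * p + b * q) + (d * r + b * q)) * s + (u + v) * m) / 2" by simp
qed

lemma J_jordan_identity:
  assumes "x \<in> J" "y \<in> J"
  shows "x \<otimes>\<^sub>J (y \<otimes>\<^sub>J (x \<otimes>\<^sub>J x)) = (x \<otimes>\<^sub>J y) \<otimes>\<^sub>J (x \<otimes>\<^sub>J x)"
proof -
  obtain a b d where x: "x = mk a b d" using assms(1) by (rule J_cases)
  obtain p q r where y: "y = mk p q r" using assms(2) by (rule J_cases)
  show ?thesis
    unfolding x y J_mult mk_eq_iff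
    by (intro allI impI conjI; rule sym2_jordan_identity)
qed

lemma J_unital_jb_algebra: "unital_jb_algebra J_alg"
proof -
  interpret M: Module.module scalar_ring J_alg by (rule J_module)
  have nonneg: "0 \<le> nrm J_alg x" if "x \<in> J" for x
    using J_nrm_upper[OF that, of 0] opn_nonneg[of "x 0"] by simp
  have zero: "nrm J_alg x = 0 \<longleftrightarrow> x = \<zero>\<^bsub>J_alg\<^esub>" if x: "x \<in> J" for x
    using x
  proof (rule J_cases)
    fix a b d assume abd: "x = mk a b d" "J_entries a b d"
    show ?thesis
    proof
      assume "nrm J_alg x = 0"
      then have "a t = 0 \<and> b t = 0 \<and> d t = 0" if "0 \<le> t" "t \<le> 1" for t
        using J_nrm_ge_entries[OF abd(2) that] by (simp add: abd)
      then show "x = \<zero>\<^bsub>J_alg\<^esub>" by (simp add: abd J_zero mk_eq_iff)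
    next
      assume "x = \<zero>\<^bsub>J_alg\<^esub>"
      then show "nrm J_alg x = 0"
        using J_nrm_le_entries[of "\<lambda>_. 0" 0 "\<lambda>_. 0" "\<lambda>_. 0"] nonneg[OF x] by (simp add: J_zero)
    qed
  qed
  have triangle: "nrm J_alg (x \<oplus>\<^sub>J y) \<le> nrm J_alg x + nrm J_alg y"
    if "x \<in> J" "y \<in> J" for x y
  proof (rule J_nrm_least)
    fix t :: real assume t: "0 \<le> t" "t \<le> 1"
    show "opn ((x \<oplus>\<^sub>J y) t) \<le> nrm J_alg x + nrm J_alg y"
      using opn_add[of "x t" "y t"] J_nrm_upper[OF that(1) t] J_nrm_upper[OF that(2) t]
      by (simp add: J_apply t)
  qed
  have smult_le: "nrm J_alg (r \<odot>\<^sub>J x) \<le> \<bar>r\<bar> * nrm J_alg x" if "x \<in> J" for r x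
    by (rule J_nrm_least) (simp add: J_apply opn_scaleR J_nrm_upper that mult_left_mono)
  have smult: "nrm J_alg (r \<odot>\<^sub>J x) = \<bar>r\<bar> * nrm J_alg x" if x: "x \<in> J" for r x
  proof (cases "r = 0")
    case True
    then have "r \<odot>\<^sub>J x = \<zero>\<^bsub>J_alg\<^esub>" using M.smult_l_null[OF x] by simp
    then show ?thesis using zero[of "\<zero>\<^bsub>J_alg\<^esub>"] True by simp
  next
    case False
    \<comment> \<open>The inequality already proved, taken at the inverse scalar, supplies the
      reverse one.\<close>
    have "nrm J_alg (inverse r \<odot>\<^sub>J (r \<odot>\<^sub>J x)) \<le> \<bar>inverse r\<bar> * nrm J_alg (r \<odot>\<^sub>J x)"
      using x by (intro smult_le) auto
    moreover have "inverse r \<odot>\<^sub>J (r \<odot>\<^sub>J x) = x"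
      using M.smult_assoc1[of "inverse r" r x] M.smult_one[OF x] x False by simp
    ultimately have "\<bar>r\<bar> * nrm J_alg x \<le> nrm J_alg (r \<odot>\<^sub>J x)"
      using False by (simp add: field_simps abs_inverse)
    then show ?thesis using smult_le[OF x, of r] by simp
  qed
  have "nrm J_alg (\<ominus>\<^bsub>J_alg\<^esub> x) = nrm J_alg x" if "x \<in> J" for x
    using smult[OF that, of "-1"] by (simp add: uminus_eq_smult[OF J_module that])
  with nonneg zero triangle have ng: "normed_group J_alg (nrm J_alg)"
    by (intro normed_group.intro[OF M.abelian_group_axioms] normed_group_axioms.intro)
  have prod: "nrm J_alg (x \<otimes>\<^sub>J y) \<le> nrm J_alg x * nrm J_alg y"
    if "x \<in> J" "y \<in> J" for x y
  proof (rule J_nrm_least)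
    fix t :: real assume t: "0 \<le> t" "t \<le> 1"
    have "opn ((x \<otimes>\<^sub>J y) t) \<le> opn (x t) * opn (y t)"
      unfolding J_apply(3)[OF t] by (rule opn_jprod)
    also have "\<dots> \<le> nrm J_alg x * nrm J_alg y"
      by (intro mult_mono J_nrm_upper that t opn_nonneg nonneg)
    finally show "opn ((x \<otimes>\<^sub>J y) t) \<le> nrm J_alg x * nrm J_alg y" .
  qed
  have square: "(nrm J_alg x)\<^sup>2 = nrm J_alg (x \<otimes>\<^sub>J x)" if x: "x \<in> J" for x
  proof (rule order_antisym)
    have "nrm J_alg x \<le> sqrt (nrm J_alg (x \<otimes>\<^sub>J x))"
    proof (rule J_nrm_least)
      fix t :: real assume t: "0 \<le> t" "t \<le> 1"
      have "(opn (x t))\<^sup>2 \<le> nrm J_alg (x \<otimes>\<^sub>J x)"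
        using J_nrm_upper[OF J_closed(1)[OF x x] t]
        by (simp add: J_square_apply t opn_square J_symmetric[OF x t])
      then show "opn (x t) \<le> sqrt (nrm J_alg (x \<otimes>\<^sub>J x))" by (rule real_le_rsqrt)
    qed
    then have "(nrm J_alg x)\<^sup>2 \<le> (sqrt (nrm J_alg (x \<otimes>\<^sub>J x)))\<^sup>2"
      by (rule power_mono) (rule nonneg[OF x])
    then show "(nrm J_alg x)\<^sup>2 \<le> nrm J_alg (x \<otimes>\<^sub>J x)"
      using nonneg[OF J_closed(1)[OF x x]] by simp
    show "nrm J_alg (x \<otimes>\<^sub>J x) \<le> (nrm J_alg x)\<^sup>2"
      using prod[OF x x] by (simp add: power2_eq_square)
  qed
  have square_add: "nrm J_alg (x \<otimes>\<^sub>J x) \<le> nrm J_alg ((x \<otimes>\<^sub>J x) \<oplus>\<^sub>J (y \<otimes>\<^sub>J y))"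
    if x: "x \<in> J" and y: "y \<in> J" for x y
  proof (rule J_nrm_least)
    fix t :: real assume t: "0 \<le> t" "t \<le> 1"
    have "opn (x t ** x t) \<le> opn (x t ** x t + y t ** y t)"
      by (intro opn_square_add J_symmetric x y t)
    also have "\<dots> \<le> nrm J_alg ((x \<otimes>\<^sub>J x) \<oplus>\<^sub>J (y \<otimes>\<^sub>J y))"
      using J_nrm_upper[OF J_closed(2)[OF J_closed(1)[OF x x] J_closed(1)[OF y y]] t]
      by (simp add: J_apply(1) J_square_apply t)
    finally show "opn ((x \<otimes>\<^sub>J x) t) \<le> nrm J_alg ((x \<otimes>\<^sub>J x) \<oplus>\<^sub>J (y \<otimes>\<^sub>J y))"
      by (simp add: J_square_apply t)
  qed
  show ?thesis
  proof (intro unital_jb_algebra.intro jb_algebra.intro real_jordan_algebra.intro J_module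
      real_jordan_algebra_axioms.intro jb_algebra_axioms.intro unital_jb_algebra_axioms.intro)
    show "\<one>\<^bsub>J_alg\<^esub> \<in> J" by (rule J_one_zero_closed)
    show "\<one>\<^bsub>J_alg\<^esub> \<otimes>\<^sub>J x = x" if "x \<in> J" for x
      using that by (elim J_cases) (simp add: J_ops mk_eq_iff)
    show "x \<otimes>\<^sub>J y = y \<otimes>\<^sub>J x" if "x \<in> J" "y \<in> J" for x y
      using that by (elim J_cases) (simp add: J_ops mk_eq_iff algebra_simps)
    show "(x \<oplus>\<^sub>J y) \<otimes>\<^sub>J z = (x \<otimes>\<^sub>J z) \<oplus>\<^sub>J (y \<otimes>\<^sub>J z)"
      if "x \<in> J" "y \<in> J" "z \<in> J" for x y z
      using that by (elim J_cases) (simp add: J_ops mk_eq_iff field_simps)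
    show "(r \<odot>\<^sub>J x) \<otimes>\<^sub>J y = r \<odot>\<^sub>J (x \<otimes>\<^sub>J y)"
      if "x \<in> J" "y \<in> J" for r x y
      using that by (elim J_cases) (simp add: J_ops mk_eq_iff field_simps)
    show "x \<otimes>\<^sub>J (y \<otimes>\<^sub>J (x \<otimes>\<^sub>J x)) = (x \<otimes>\<^sub>J y) \<otimes>\<^sub>J (x \<otimes>\<^sub>J x)"
      if "x \<in> J" "y \<in> J" for x y
      using that by (rule J_jordan_identity)
    show "Metric_space.mcomplete J (norm_dist J_alg (nrm J_alg))"
      by (rule J_complete[OF ng])
  qed (fact J_closed nonneg zero triangle smult prod square square_add)+
qed

section \<open>Density and extension of homomorphisms\<close>

lemma poly_approximation:
  assumes "continuous_on {0..1} a" "0 < r"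
  obtains P :: "real poly" where "\<And>t. 0 \<le> t \<Longrightarrow> t \<le> 1 \<Longrightarrow> \<bar>a t - poly P t\<bar> < r"
proof -
  obtain g where g: "real_polynomial_function g" "\<And>t. t \<in> {0..1} \<Longrightarrow> \<bar>a t - g t\<bar> < r"
    using Stone_Weierstrass_real_polynomial_function[OF compact_Icc assms] by blast
  obtain k n where "g = (\<lambda>x. \<Sum>i\<le>n. k i * x ^ i)"
    using g(1) real_polynomial_function_iff_sum by blast
  then have "g t = poly (\<Sum>i\<le>n. monom (k i) i) t" for t
    by (simp add: poly_sum poly_monom)
  then show ?thesis
    using g(2) by (intro that[of "\<Sum>i\<le>n. monom (k i) i"]) simp
qed

abbreviation root01 :: "real \<Rightarrow> real" where
  "root01 t \<equiv> sqrt (t * (1 - t))"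

lemma root01_square: "0 \<le> t \<Longrightarrow> t \<le> 1 \<Longrightarrow> root01 t * root01 t = t * (1 - t)"
  by simp

lemma root01_le_1: "0 \<le> t \<Longrightarrow> t \<le> 1 \<Longrightarrow> root01 t \<le> 1"
  by (simp add: mult_le_one)

text \<open>A polynomial vanishing at 0 and 1 is \<open>t (1 - t) k\<close>; then \<open>sqrt (t (1 - t)) * k\<close> is
  approximated by a polynomial once more.\<close>

lemma root01_poly_approximation:
  assumes b: "continuous_on {0..1} b" "b 0 = 0" "b 1 = 0" and r: "0 < r"
  obtains R :: "real poly" where "\<And>t. 0 \<le> t \<Longrightarrow> t \<le> 1 \<Longrightarrow> \<bar>b t - poly R t * root01 t\<bar> < r"
proof -
  have "0 < r / 4" using r by simp
  obtain g where g: "\<And>t. 0 \<le> t \<Longrightarrow> t \<le> 1 \<Longrightarrow> \<bar>b t - poly g t\<bar> < r / 4"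
    using poly_approximation[OF b(1) \<open>0 < r / 4\<close>] by blast
  \<comment> \<open>Subtracting the linear interpolant of the endpoint values makes \<open>g\<close>
    divisible by X (1 - X). It changes \<open>g\<close> by at most r / 4, because \<open>b\<close>
    vanishes at the endpoints.\<close>
  define h where "h = g - Polynomial.smult (poly g 0) [:1, -1:] - Polynomial.smult (poly g 1) [:0, 1:]"
  have "poly h 0 = 0" by (simp add: h_def)
  then obtain h' where h': "h = [:0, 1:] * h'"
    using poly_eq_0_iff_dvd[of h 0] by (auto elim: dvdE)
  have "poly h 1 = 0" by (simp add: h_def)
  then have "poly h' 1 = 0" by (simp add: h')
  then obtain k where k: "h' = [:-1, 1:] * k"
    using poly_eq_0_iff_dvd[of h' 1] by (auto elim: dvdE)
  have "continuous_on {0..1} (\<lambda>t. - (root01 t * poly k t))"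
    by (intro continuous_intros)
  then obtain R where R: "\<And>t. 0 \<le> t \<Longrightarrow> t \<le> 1 \<Longrightarrow> \<bar>- (root01 t * poly k t) - poly R t\<bar> < r / 4"
    using poly_approximation[OF _ \<open>0 < r / 4\<close>] by blast
  have "\<bar>b t - poly R t * root01 t\<bar> < r" if t: "0 \<le> t" "t \<le> 1" for t
  proof -
    have ht: "poly h t = root01 t * (- (root01 t * poly k t))"
      using root01_square[OF t] by (simp add: h' k algebra_simps)
    have "\<bar>poly h t - poly R t * root01 t\<bar> = root01 t * \<bar>- (root01 t * poly k t) - poly R t\<bar>"
    proof -
      have "poly h t - poly R t * root01 t = root01 t * (- (root01 t * poly k t) - poly R t)"
        unfolding ht by (simp only: right_diff_distrib mult.commute)
      then show ?thesis using t by (simp only: abs_mult) simp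
    qed
    also have "\<dots> \<le> \<bar>- (root01 t * poly k t) - poly R t\<bar>"
      using root01_le_1[OF t] t by (intro mult_left_le_one_le) auto
    finally have 1: "\<bar>poly h t - poly R t * root01 t\<bar> < r / 4"
      using R[OF t] by linarith
    have 2: "\<bar>poly g 0\<bar> < r / 4" "\<bar>poly g 1\<bar> < r / 4"
      using g[of 0] g[of 1] b by simp_all
    have "\<bar>poly g t - poly h t\<bar> = \<bar>(1 - t) * poly g 0 + t * poly g 1\<bar>"
      by (simp add: h_def algebra_simps)
    also have "\<dots> \<le> (1 - t) * \<bar>poly g 0\<bar> + t * \<bar>poly g 1\<bar>"
      using t abs_triangle_ineq[of "(1 - t) * poly g 0" "t * poly g 1"] by (simp add: abs_mult)
    also have "\<dots> \<le> (1 - t) * (r / 4) + t * (r / 4)"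
      using 2 t by (intro add_mono mult_left_mono) auto
    also have "\<dots> = r / 4" by (simp flip: distrib_right)
    finally show ?thesis using 1 g[OF t] by linarith
  qed
  then show ?thesis by (rule that)
qed

section \<open>Polynomial elements of the matrix algebra\<close>

definition repJ :: "real poly \<Rightarrow> real poly \<Rightarrow> real poly \<Rightarrow> real \<Rightarrow> real^2^2" where
  "repJ P Q R = mk (poly P) (\<lambda>t. poly R t * root01 t) (poly Q)"

lemma J_entries_rep: "J_entries (poly P) (\<lambda>t. poly R t * root01 t) (poly Q)"
  unfolding J_entries_def by (auto intro!: continuous_intros)

lemma repJ_in_J: "repJ P Q R \<in> J"
  unfolding repJ_def by (rule mk_in_J[OF J_entries_rep])

lemma repJ_add: "repJ P Q R \<oplus>\<^sub>J repJ P' Q' R' = repJ (P + P') (Q + Q') (R + R')"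
  by (simp add: repJ_def J_add mk_eq_iff algebra_simps)

lemma repJ_smult: "r \<odot>\<^sub>J repJ P Q R = repJ (Polynomial.smult r P) (Polynomial.smult r Q) (Polynomial.smult r R)"
  by (simp add: repJ_def J_smult mk_eq_iff)

lemma repJ_mult: "repJ P Q R \<otimes>\<^sub>J repJ P' Q' R' =
   repJ (P * P' + [:0, 1, -1:] * (R * R')) (Q * Q' + [:0, 1, -1:] * (R * R'))
     (Polynomial.smult (1/2) (R * (P' + Q') + R' * (P + Q)))"
proof -
  have "poly R t * root01 t * (poly R' t * root01 t) = poly ([:0, 1, -1:] * (R * R')) t"
    if "0 \<le> t" "t \<le> 1" for t
  proof -
    have "poly R t * root01 t * (poly R' t * root01 t) = (root01 t * root01 t) * (poly R t * poly R' t)"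
      by (simp only: ac_simps)
    then show ?thesis unfolding root01_square[OF that] by (simp add: algebra_simps)
  qed
  then show ?thesis
    unfolding repJ_def J_mult mk_eq_iff by (auto simp: field_simps)
qed

lemma repJ_dense:
  assumes "f \<in> J" "0 < r"
  shows "\<exists>P Q R. nrm J_alg (repJ P Q R \<ominus>\<^sub>J f) < r"
proof -
  obtain a b d where f: "f = mk a b d" and abd: "J_entries a b d"
    using assms(1) by (rule J_cases)
  have r: "0 < r / 5" using assms(2) by simp
  have cont: "continuous_on {0..1} a" "continuous_on {0..1} b" "continuous_on {0..1} d"
    and b0: "b 0 = 0" "b 1 = 0"
    using abd by (simp_all add: J_entries_def)
  obtain P where P: "\<And>t. 0 \<le> t \<Longrightarrow> t \<le> 1 \<Longrightarrow> \<bar>a t - poly P t\<bar> < r / 5"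
    using poly_approximation[OF cont(1) r] by blast
  obtain Q where Q: "\<And>t. 0 \<le> t \<Longrightarrow> t \<le> 1 \<Longrightarrow> \<bar>d t - poly Q t\<bar> < r / 5"
    using poly_approximation[OF cont(3) r] by blast
  obtain R where R: "\<And>t. 0 \<le> t \<Longrightarrow> t \<le> 1 \<Longrightarrow> \<bar>b t - poly R t * root01 t\<bar> < r / 5"
    using root01_poly_approximation[OF cont(2) b0 r] by blast
  have "nrm J_alg (repJ P Q R \<ominus>\<^sub>J f) \<le> 4 * (r / 5)"
    unfolding f repJ_def J_diff_mk[OF abd]
    using P Q R by (intro J_nrm_le_entries) (auto simp: abs_minus_commute intro!: less_imp_le)
  then show ?thesis using assms(2) by (intro exI[of _ P] exI[of _ Q] exI[of _ R]) simp
qed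

lemma J_one_repJ: "\<one>\<^bsub>J_alg\<^esub> = repJ 1 1 0"
  by (simp add: J_one repJ_def mk_eq_iff)

lemma J_p1_mk: "J_p1 = mk (\<lambda>_. 1) (\<lambda>_. 0) (\<lambda>_. 0)"
  by (simp add: J_p1_def mk_def sym2_vector)

lemma J_p2_mk: "J_p2 = mk (\<lambda>t. t) root01 (\<lambda>t. 1 - t)"
  by (simp add: J_p2_def mk_def sym2_vector)

lemma J_p1_repJ: "J_p1 = repJ 1 0 0"
  by (simp add: J_p1_mk repJ_def mk_eq_iff)

lemma J_p2_repJ: "J_p2 = repJ [:0, 1:] [:1, -1:] 1"
  by (simp add: J_p2_mk repJ_def mk_eq_iff)

lemma J_p1_projection: "J_p1 \<in> projections J_alg"
  by (simp add: projections_def J_p1_repJ repJ_in_J repJ_mult)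

lemma J_p2_projection: "J_p2 \<in> projections J_alg"
proof -
  have "[:0, 1:] * [:0, 1:] + [:0, 1, -1:] = [:0, 1 :: real:]"
    "[:1, -1:] * [:1, -1:] + [:0, 1, -1:] = [:1, -1 :: real:]"
    "Polynomial.smult (1/2) (([:0, 1:] + [:1, -1:]) + ([:0, 1:] + [:1, -1:])) = (1 :: real poly)"
    by (simp_all add: one_pCons)
  then show ?thesis by (simp only: projections_def J_p2_repJ repJ_in_J repJ_mult mult_1_right mult_1_left mem_Collect_eq simp_thms)
qed

text \<open>A family of pairs encodes the homomorphism on a dense subalgebra before it is known to
  be well defined; the bound supplies that. The extension is the closure of this graph, and the
  algebraic laws follow along approximating sequences.\<close>

lemma dense_hom_extension:
  fixes rA :: "'i \<Rightarrow> 'u::real_vector" and rB :: "'i \<Rightarrow> 'v::real_vector"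
  assumes A: "jb_space mA eA NA" and B: "jb_space mB eB NB"
    and add: "\<And>i j. \<exists>k. rA k = rA i + rA j \<and> rB k = rB i + rB j"
    and scale: "\<And>a i. \<exists>k. rA k = a *\<^sub>R rA i \<and> rB k = a *\<^sub>R rB i"
    and mult: "\<And>i j. \<exists>k. rA k = mA (rA i) (rA j) \<and> rB k = mB (rB i) (rB j)"
    and bound: "\<And>i. NB (rB i) \<le> K * NA (rA i)"
    and dense: "\<And>x r. 0 < r \<Longrightarrow> \<exists>i. NA (rA i - x) < r"
    and unit: "\<And>i. mB eB (rB i) = rB i"
  obtains \<phi> where "\<And>x y. \<phi> (x + y) = \<phi> x + \<phi> y" "\<And>a x. \<phi> (a *\<^sub>R x) = a *\<^sub>R \<phi> x"
    "\<And>x y. \<phi> (mA x y) = mB (\<phi> x) (\<phi> y)" "\<And>i. \<phi> (rA i) = rB i"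
proof -
  interpret A: jb_space mA eA NA by (rule A)
  interpret B: jb_space mB eB NB by (rule B)
  have diff: "NB (rB i - rB j) \<le> K * NA (rA i - rA j)" for i j
  proof -
    obtain k where k: "rA k = (-1) *\<^sub>R rA j" "rB k = (-1) *\<^sub>R rB j" using scale by blast
    obtain l where l: "rA l = rA i + rA k" "rB l = rB i + rB k" using add by blast
    show ?thesis using bound[of l] by (simp add: k l)
  qed
  \<comment> \<open>\<open>NB\<close> is a seminorm, so a limit becomes unique only among elements
    fixed by \<open>mB eB\<close>.\<close>
  define G where "G x y \<longleftrightarrow> mB eB y = y \<and>
    (\<exists>X. (\<lambda>n. NA (rA (X n) - x)) \<longlonglongrightarrow> 0 \<and> (\<lambda>n. NB (rB (X n) - y)) \<longlonglongrightarrow> 0)" for x y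
  have ex: "\<exists>y. G x y" for x
  proof -
    have "\<exists>i. NA (rA i - x) < inverse (real (Suc n))" for n
      by (rule dense) simp
    then obtain X where X: "\<And>n. NA (rA (X n) - x) < inverse (real (Suc n))" by metis
    have lim: "(\<lambda>n. NA (rA (X n) - x)) \<longlonglongrightarrow> 0"
    proof (rule tendsto_sandwich[OF _ _ tendsto_const LIMSEQ_inverse_real_of_nat])
      show "\<forall>\<^sub>F n in sequentially. NA (rA (X n) - x) \<le> inverse (real (Suc n))"
        using X by (intro always_eventually allI less_imp_le)
    qed simp
    have "\<exists>l. (\<lambda>n. NB (rB (X n) - l)) \<longlonglongrightarrow> 0"
    proof (rule B.N_complete)
      fix r :: real assume "0 < r"
      \<comment> \<open>\<open>K\<close> may be zero or negative, whence |K| + 1 in the denominator;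
        the 2 pays for the triangle inequality through \<open>x\<close>.\<close>
      then have r: "0 < r / (2 * (\<bar>K\<bar> + 1))" by simp
      obtain M where M: "\<And>n. n \<ge> M \<Longrightarrow> NA (rA (X n) - x) < r / (2 * (\<bar>K\<bar> + 1))"
        using order_tendstoD(2)[OF lim r] by (auto simp: eventually_sequentially)
      have "NB (rB (X m) - rB (X n)) < r" if "M \<le> m" "M \<le> n" for m n
      proof -
        have "NA (rA (X m) - rA (X n)) \<le> NA (rA (X m) - x) + NA (rA (X n) - x)"
          using A.N_diff[of "rA (X m) - x" "rA (X n) - x"] by simp
        also have "\<dots> < r / (\<bar>K\<bar> + 1)"
          using M[OF that(1)] M[OF that(2)] by (simp add: field_simps)
        finally have *: "NA (rA (X m) - rA (X n)) * (\<bar>K\<bar> + 1) < r"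
          by (simp add: pos_less_divide_eq)
        have "K * NA (rA (X m) - rA (X n)) \<le> (\<bar>K\<bar> + 1) * NA (rA (X m) - rA (X n))"
          by (intro mult_right_mono) auto
        then show ?thesis using diff[of "X m" "X n"] * by (simp add: mult.commute)
      qed
      then show "\<exists>M. \<forall>m\<ge>M. \<forall>n\<ge>M. NB (rB (X m) - rB (X n)) < r" by blast
    qed
    then obtain l where "(\<lambda>n. NB (rB (X n) - l)) \<longlonglongrightarrow> 0" by blast
    from B.limit_unit[OF this] have "(\<lambda>n. NB (rB (X n) - mB eB l)) \<longlonglongrightarrow> 0"
      by (simp add: unit)
    then have "G x (mB eB l)"
      unfolding G_def using lim by (auto simp: B.unit_prod)
    then show ?thesis ..
  qed
  have uniq: "y = z" if xy: "G x y" and xz: "G x z" for x y z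
  proof -
    obtain X where X: "(\<lambda>n. NA (rA (X n) - x)) \<longlonglongrightarrow> 0" "(\<lambda>n. NB (rB (X n) - y)) \<longlonglongrightarrow> 0"
      using xy unfolding G_def by blast
    obtain Z where Z: "(\<lambda>n. NA (rA (Z n) - x)) \<longlonglongrightarrow> 0" "(\<lambda>n. NB (rB (Z n) - z)) \<longlonglongrightarrow> 0"
      using xz unfolding G_def by blast
    have "(\<lambda>n. \<bar>K\<bar> * (NA (rA (X n) - x) + NA (rA (Z n) - x)) + NB (rB (Z n) - z)) \<longlonglongrightarrow> \<bar>K\<bar> * (0 + 0) + 0"
      by (intro tendsto_intros X Z)
    then have lim: "(\<lambda>n. \<bar>K\<bar> * (NA (rA (X n) - x) + NA (rA (Z n) - x)) + NB (rB (Z n) - z)) \<longlonglongrightarrow> 0" by simp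
    have "NB (rB (X n) - z) \<le> \<bar>K\<bar> * (NA (rA (X n) - x) + NA (rA (Z n) - x)) + NB (rB (Z n) - z)" for n
    proof -
      have "NB (rB (X n) - z) \<le> NB (rB (X n) - rB (Z n)) + NB (rB (Z n) - z)"
        using B.N_add[of "rB (X n) - rB (Z n)" "rB (Z n) - z"] by simp
      moreover have "K * NA (rA (X n) - rA (Z n)) \<le> \<bar>K\<bar> * (NA (rA (X n) - x) + NA (rA (Z n) - x))"
        using A.N_diff[of "rA (X n) - x" "rA (Z n) - x"] by (intro mult_mono) auto
      ultimately show ?thesis using diff[of "X n" "Z n"] by linarith
    qed
    then have "(\<lambda>n. NB (rB (X n) - z)) \<longlonglongrightarrow> 0"
      by (intro tendsto_sandwich[OF _ _ tendsto_const lim]) auto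
    from B.limit_unique[OF X(2) this] xy xz show ?thesis by (simp add: G_def)
  qed
  have G_add: "G (x + x') (y + y')" if xy: "G x y" and xz: "G x' y'" for x y x' y'
  proof -
    obtain X where X: "(\<lambda>n. NA (rA (X n) - x)) \<longlonglongrightarrow> 0" "(\<lambda>n. NB (rB (X n) - y)) \<longlonglongrightarrow> 0"
      using xy unfolding G_def by blast
    obtain Z where Z: "(\<lambda>n. NA (rA (Z n) - x')) \<longlonglongrightarrow> 0" "(\<lambda>n. NB (rB (Z n) - y')) \<longlonglongrightarrow> 0"
      using xz unfolding G_def by blast
    have "\<forall>n. \<exists>k. rA k = rA (X n) + rA (Z n) \<and> rB k = rB (X n) + rB (Z n)"
      by (intro allI add)
    from choice[OF this] obtain W where "\<forall>n. rA (W n) = rA (X n) + rA (Z n) \<and> rB (W n) = rB (X n) + rB (Z n)" ..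
    then have W: "\<And>n. rA (W n) = rA (X n) + rA (Z n)" "\<And>n. rB (W n) = rB (X n) + rB (Z n)" by blast+
    show ?thesis
      unfolding G_def using xy xz A.limit_add[OF X(1) Z(1)] B.limit_add[OF X(2) Z(2)]
      by (intro conjI exI[of _ W]) (simp_all add: G_def B.add_right W)
  qed
  have G_scale: "G (a *\<^sub>R x) (a *\<^sub>R y)" if xy: "G x y" for a x y
  proof -
    obtain X where X: "(\<lambda>n. NA (rA (X n) - x)) \<longlonglongrightarrow> 0" "(\<lambda>n. NB (rB (X n) - y)) \<longlonglongrightarrow> 0"
      using xy unfolding G_def by blast
    have "\<forall>n. \<exists>k. rA k = a *\<^sub>R rA (X n) \<and> rB k = a *\<^sub>R rB (X n)"
      by (intro allI scale)
    from choice[OF this] obtain W where "\<forall>n. rA (W n) = a *\<^sub>R rA (X n) \<and> rB (W n) = a *\<^sub>R rB (X n)" ..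
    then have W: "\<And>n. rA (W n) = a *\<^sub>R rA (X n)" "\<And>n. rB (W n) = a *\<^sub>R rB (X n)" by blast+
    show ?thesis
      unfolding G_def using xy A.limit_scale[OF X(1), of a] B.limit_scale[OF X(2), of a]
      by (intro conjI exI[of _ W]) (simp_all add: G_def B.scale_right W)
  qed
  have G_mult: "G (mA x x') (mB y y')" if xy: "G x y" and xz: "G x' y'" for x y x' y'
  proof -
    obtain X where X: "(\<lambda>n. NA (rA (X n) - x)) \<longlonglongrightarrow> 0" "(\<lambda>n. NB (rB (X n) - y)) \<longlonglongrightarrow> 0"
      using xy unfolding G_def by blast
    obtain Z where Z: "(\<lambda>n. NA (rA (Z n) - x')) \<longlonglongrightarrow> 0" "(\<lambda>n. NB (rB (Z n) - y')) \<longlonglongrightarrow> 0"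
      using xz unfolding G_def by blast
    have "\<forall>n. \<exists>k. rA k = mA (rA (X n)) (rA (Z n)) \<and> rB k = mB (rB (X n)) (rB (Z n))"
      by (intro allI mult)
    from choice[OF this] obtain W where "\<forall>n. rA (W n) = mA (rA (X n)) (rA (Z n)) \<and> rB (W n) = mB (rB (X n)) (rB (Z n))" ..
    then have W: "\<And>n. rA (W n) = mA (rA (X n)) (rA (Z n))" "\<And>n. rB (W n) = mB (rB (X n)) (rB (Z n))" by blast+
    show ?thesis
      unfolding G_def using A.limit_prod[OF X(1) Z(1)] B.limit_prod[OF X(2) Z(2)]
      by (intro conjI exI[of _ W]) (simp_all add: B.unit_prod W)
  qed
  have G_rep: "G (rA i) (rB i)" for i
    unfolding G_def by (intro conjI unit exI[of _ "\<lambda>_. i"]) simp_all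
  define \<phi> where "\<phi> x = (THE y. G x y)" for x
  have \<phi>_eq: "\<phi> x = y" if xy: "G x y" for x y
    unfolding \<phi>_def using xy by (rule the_equality) (rule uniq[OF _ xy])
  have G\<phi>: "G x (\<phi> x)" for x
    using ex[of x] \<phi>_eq[of x] by auto
  show ?thesis
  proof (rule that)
    show "\<phi> (x + y) = \<phi> x + \<phi> y" for x y by (intro \<phi>_eq G_add G\<phi>)
    show "\<phi> (a *\<^sub>R x) = a *\<^sub>R \<phi> x" for a x by (intro \<phi>_eq G_scale G\<phi>)
    show "\<phi> (mA x y) = mB (\<phi> x) (\<phi> y)" for x y by (intro \<phi>_eq G_mult G\<phi>)
    show "\<phi> (rA i) = rB i" for i by (intro \<phi>_eq G_rep)
  qed
qed

section \<open>Automatic continuity of homomorphisms on the matrix algebra\<close>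

context jb_two_projections
begin

text \<open>\<open>\<psi>\<close> stands for an arbitrary unital homomorphism with the prescribed
  values on the generators. Its values on polynomial elements are forced; a bound derived from
  squares extends this to the closure.\<close>

context
  fixes \<psi> :: "(real \<Rightarrow> real^2^2) \<Rightarrow> 'a"
  assumes \<psi>_add: "\<And>f g. \<lbrakk>f \<in> J; g \<in> J\<rbrakk> \<Longrightarrow> \<psi> (f \<oplus>\<^sub>J g) = \<psi> f + \<psi> g"
    and \<psi>_smult: "\<And>r f. f \<in> J \<Longrightarrow> \<psi> (r \<odot>\<^sub>J f) = r *\<^sub>R \<psi> f"
    and \<psi>_mult: "\<And>f g. \<lbrakk>f \<in> J; g \<in> J\<rbrakk> \<Longrightarrow> \<psi> (f \<otimes>\<^sub>J g) = \<psi> f \<star> \<psi> g"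
    and \<psi>_one: "\<psi> \<one>\<^bsub>J_alg\<^esub> = e" and \<psi>_p1: "\<psi> J_p1 = p" and \<psi>_p2: "\<psi> J_p2 = q"
begin

lemma \<psi>_mk_add: "J_entries a b d \<Longrightarrow> J_entries a' b' d' \<Longrightarrow>
    \<psi> (mk (\<lambda>t. a t + a' t) (\<lambda>t. b t + b' t) (\<lambda>t. d t + d' t)) = \<psi> (mk a b d) + \<psi> (mk a' b' d')"
  using \<psi>_add[OF mk_in_J mk_in_J] by (simp add: J_add)

lemma \<psi>_mk_smult: "J_entries a b d \<Longrightarrow> \<psi> (mk (\<lambda>t. r * a t) (\<lambda>t. r * b t) (\<lambda>t. r * d t)) = r *\<^sub>R \<psi> (mk a b d)"
  using \<psi>_smult[OF mk_in_J] by (simp add: J_smult)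

text \<open>The expression defining \<open>c\<close>, evaluated at the two matrix projections, is t
  times the identity matrix.\<close>

lemma \<psi>_mk_c: "\<psi> (mk (\<lambda>t. t) (\<lambda>_. 0) (\<lambda>t. t)) = c"
proof -
  have p: "J_p1 \<in> J" "J_p2 \<in> J"
    by (simp_all add: J_p1_repJ J_p2_repJ repJ_in_J)
  have cl: "J_p1 \<otimes>\<^sub>J J_p2 \<in> J" using p by (rule J_closed)
  note cls = J_closed(2) J_smult_closed p cl J_one_zero_closed
  have "\<psi> (\<one>\<^bsub>J_alg\<^esub> \<oplus>\<^sub>J ((-1) \<odot>\<^sub>J J_p1 \<oplus>\<^sub>J ((-1) \<odot>\<^sub>J J_p2 \<oplus>\<^sub>J 2 \<odot>\<^sub>J (J_p1 \<otimes>\<^sub>J J_p2))))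
    = e + ((-1) *\<^sub>R p + ((-1) *\<^sub>R q + 2 *\<^sub>R (p \<star> q)))"
    by (simp only: cls \<psi>_add \<psi>_smult \<psi>_mult \<psi>_one \<psi>_p1 \<psi>_p2)
  also have "\<one>\<^bsub>J_alg\<^esub> \<oplus>\<^sub>J ((-1) \<odot>\<^sub>J J_p1 \<oplus>\<^sub>J ((-1) \<odot>\<^sub>J J_p2 \<oplus>\<^sub>J 2 \<odot>\<^sub>J (J_p1 \<otimes>\<^sub>J J_p2)))
    = mk (\<lambda>t. t) (\<lambda>_. 0) (\<lambda>t. t)"
    by (simp add: J_p1_mk J_p2_mk J_ops mk_eq_iff)
  finally show ?thesis by (simp add: c_def algebra_simps)
qed

lemma \<psi>_mk_X:
  assumes "J_entries a b d"
  shows "\<psi> (mk (\<lambda>t. t * a t) (\<lambda>t. t * b t) (\<lambda>t. t * d t)) = c \<star> \<psi> (mk a b d)"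
proof -
  have z: "J_entries (\<lambda>t. t) (\<lambda>_. 0) (\<lambda>t. t)"
    by (simp add: J_entries_def continuous_on_id)
  have "mk (\<lambda>t. t) (\<lambda>_. 0) (\<lambda>t. t) \<otimes>\<^sub>J mk a b d = mk (\<lambda>t. t * a t) (\<lambda>t. t * b t) (\<lambda>t. t * d t)"
    by (simp add: J_mult mk_eq_iff)
  then show ?thesis
    using \<psi>_mult[OF mk_in_J[OF z] mk_in_J[OF assms]] by (simp add: \<psi>_mk_c)
qed

lemma \<psi>_mk_poly:
  assumes abd: "J_entries a b d"
  shows "\<psi> (mk (\<lambda>t. poly P t * a t) (\<lambda>t. poly P t * b t) (\<lambda>t. poly P t * d t)) = evalp c P (\<psi> (mk a b d))"
proof (induction P)
  case 0
  then show ?case using \<psi>_mk_smult[OF abd, of 0] by simp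
next
  case (pCons r P)
  let ?P = "\<lambda>u. (\<lambda>t. poly P t * u t)"
  have 1: "J_entries (?P a) (?P b) (?P d)"
    using abd by (auto simp: J_entries_def intro!: continuous_on_mult continuous_on_poly continuous_on_id)
  have 2: "J_entries (\<lambda>t. t * ?P a t) (\<lambda>t. t * ?P b t) (\<lambda>t. t * ?P d t)"
    using 1 by (auto simp: J_entries_def intro!: continuous_on_mult continuous_on_id)
  show ?case
    using \<psi>_mk_add[OF J_entries_smult[OF abd, of r] 2] \<psi>_mk_X[OF 1] \<psi>_mk_smult[OF abd, of r] pCons.IH
    by (simp add: algebra_simps)
qed

lemma J_entries_basis:
  "J_entries (\<lambda>_. 1) (\<lambda>_. 0) (\<lambda>_. 0)" "J_entries (\<lambda>_. 0) (\<lambda>_. 0) (\<lambda>_. 1)" "J_entries (\<lambda>_. 0) root01 (\<lambda>_. 0)"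
  unfolding J_entries_def by (auto intro!: continuous_intros)

lemma \<psi>_mk_e22: "\<psi> (E22 (\<lambda>_. 1)) = e - p"
  using \<psi>_mk_add[OF J_entries_basis(1,2)] \<psi>_one \<psi>_p1 by (simp add: J_one J_p1_mk algebra_simps)

lemma \<psi>_mk_y: "\<psi> (E12 root01) = y"
proof -
  have z: "J_entries (\<lambda>t. t) (\<lambda>_. 0) (\<lambda>t. t)"
    by (simp add: J_entries_def continuous_on_id)
  have p: "J_p1 \<in> J" "J_p2 \<in> J"
    by (simp_all add: J_p1_repJ J_p2_repJ repJ_in_J)
  have cl: "mk (\<lambda>t. t) (\<lambda>_. 0) (\<lambda>t. t) \<otimes>\<^sub>J J_p1 \<in> J" using mk_in_J[OF z] p(1) by (rule J_closed)
  note cls = J_closed(2) J_smult_closed p cl J_one_zero_closed mk_in_J[OF z]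
  let ?f = "J_p1 \<oplus>\<^sub>J (J_p2 \<oplus>\<^sub>J ((-1) \<odot>\<^sub>J \<one>\<^bsub>J_alg\<^esub> \<oplus>\<^sub>J (mk (\<lambda>t. t) (\<lambda>_. 0) (\<lambda>t. t) \<oplus>\<^sub>J (-2) \<odot>\<^sub>J (mk (\<lambda>t. t) (\<lambda>_. 0) (\<lambda>t. t) \<otimes>\<^sub>J J_p1))))"
  have "\<psi> ?f = p + (q + ((-1) *\<^sub>R e + (c + (-2) *\<^sub>R (c \<star> p))))"
    by (simp only: cls \<psi>_add \<psi>_smult \<psi>_mult \<psi>_one \<psi>_p1 \<psi>_p2 \<psi>_mk_c)
  also have "?f = E12 root01"
    by (simp add: J_p1_mk J_p2_mk J_ops mk_eq_iff)
  finally show ?thesis by (simp add: y_def algebra_simps)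
qed

lemma \<psi>_repJ: "\<psi> (repJ P Q R) = rep P Q R"
proof -
  have "J_entries (\<lambda>t. poly P t * 1) (\<lambda>t. poly P t * 0) (\<lambda>t. poly P t * 0)" for P :: "real poly"
    by (auto simp: J_entries_def intro!: continuous_intros)
  moreover have "J_entries (\<lambda>t. poly Q t * 0) (\<lambda>t. poly Q t * 0) (\<lambda>t. poly Q t * 1)" for Q :: "real poly"
    by (auto simp: J_entries_def intro!: continuous_intros)
  moreover have R: "J_entries (\<lambda>t. poly R t * 0) (\<lambda>t. poly R t * root01 t) (\<lambda>t. poly R t * 0)" for R :: "real poly"
    by (auto simp: J_entries_def intro!: continuous_intros)
  ultimately have "\<psi> (mk (\<lambda>t. poly P t * 1 + (poly Q t * 0 + poly R t * 0)) (\<lambda>t. poly P t * 0 + (poly Q t * 0 + poly R t * root01 t))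
      (\<lambda>t. poly P t * 0 + (poly Q t * 1 + poly R t * 0)))
    = \<psi> (mk (\<lambda>t. poly P t * 1) (\<lambda>t. poly P t * 0) (\<lambda>t. poly P t * 0)) +
      (\<psi> (mk (\<lambda>t. poly Q t * 0) (\<lambda>t. poly Q t * 0) (\<lambda>t. poly Q t * 1)) +
       \<psi> (mk (\<lambda>t. poly R t * 0) (\<lambda>t. poly R t * root01 t) (\<lambda>t. poly R t * 0)))"
    by (simp only: \<psi>_mk_add J_entries_add)
  also have "\<dots> = evalp c P p + (evalp c Q (e - p) + evalp c R y)"
    unfolding \<psi>_mk_poly[OF J_entries_basis(1)] \<psi>_mk_poly[OF J_entries_basis(2)] \<psi>_mk_poly[OF J_entries_basis(3)]
    by (simp only: \<psi>_mk_e22 \<psi>_mk_y J_p1_mk[symmetric] \<psi>_p1)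
  finally show ?thesis by (simp add: repJ_def rep_def)
qed

text \<open>B + a and B - a are nonnegative continuous functions, so they have square roots in the
  corner algebra, and \<open>\<psi>\<close> maps squares to squares. The images \<open>p\<close> and
  \<open>e - p\<close> of the corner units take the place of \<open>g\<close> in
  \<open>N_le_if_squares\<close>.\<close>

lemma N_\<psi>_mk_diag_le:
  assumes a: "continuous_on {0..1} a" "\<And>t. 0 \<le> t \<Longrightarrow> t \<le> 1 \<Longrightarrow> \<bar>a t\<bar> \<le> B"
  shows "N (\<psi> (E11 a)) \<le> 3 * B" "N (\<psi> (E22 a)) \<le> 3 * B"
proof -
  have B: "0 \<le> B" using a(2)[of 0] by simp
  have idem: "(e - p) \<star> (e - p) = e - p"
    by (simp add: bilin p_idem unit_p unit_idem comm[of p e])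
  have ent: "J_entries u (\<lambda>_. 0) (\<lambda>_. 0)" "J_entries (\<lambda>_. 0) (\<lambda>_. 0) u" if "continuous_on {0..1} u" for u
    using that by (simp_all add: J_entries_def continuous_on_const)
  have *: "square (B *\<^sub>R p + s *\<^sub>R \<psi> (E11 a))"
    "square (B *\<^sub>R (e - p) + s *\<^sub>R \<psi> (E22 a))" if s: "s = 1 \<or> s = -1" for s
  proof -
    have ge: "0 \<le> B + s * a t" if "0 \<le> t" "t \<le> 1" for t
      using a(2)[OF that] s by (auto simp: abs_le_iff)
    have cs: "continuous_on {0..1} (\<lambda>t. sqrt (B + s * a t))"
      by (intro continuous_intros a(1))
    note w = mk_in_J[OF ent(1)[OF cs]] mk_in_J[OF ent(2)[OF cs]]
    have "E11 (\<lambda>t. sqrt (B + s * a t)) \<otimes>\<^sub>J E11 (\<lambda>t. sqrt (B + s * a t))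
      = B \<odot>\<^sub>J J_p1 \<oplus>\<^sub>J s \<odot>\<^sub>J E11 a"
      using ge by (simp add: J_ops J_p1_mk mk_eq_iff)
    then show "square (B *\<^sub>R p + s *\<^sub>R \<psi> (E11 a))"
      using \<psi>_mult[OF w(1) w(1)] mk_in_J[OF ent(1)[OF a(1)]] mk_in_J[OF J_entries_basis(1)]
      by (auto simp: square_def \<psi>_add \<psi>_smult J_smult_closed \<psi>_p1 J_p1_mk[symmetric])
    have "E22 (\<lambda>t. sqrt (B + s * a t)) \<otimes>\<^sub>J E22 (\<lambda>t. sqrt (B + s * a t))
      = B \<odot>\<^sub>J E22 (\<lambda>_. 1) \<oplus>\<^sub>J s \<odot>\<^sub>J E22 a"
      using ge by (simp add: J_ops mk_eq_iff)
    then show "square (B *\<^sub>R (e - p) + s *\<^sub>R \<psi> (E22 a))"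
      using \<psi>_mult[OF w(2) w(2)] mk_in_J[OF ent(2)[OF a(1)]] mk_in_J[OF J_entries_basis(2)]
      by (auto simp: square_def \<psi>_add \<psi>_smult J_smult_closed \<psi>_mk_e22)
  qed
  show "N (\<psi> (E11 a)) \<le> 3 * B"
    by (rule N_le_if_squares[where g = p]) (use *[of 1] *[of "-1"] B N_idempotent_le[OF p_idem] in simp_all)
  show "N (\<psi> (E22 a)) \<le> 3 * B"
    by (rule N_le_if_squares[where g = "e - p"]) (use *[of 1] *[of "-1"] B N_idempotent_le[OF idem] in simp_all)
qed

text \<open>9 = 3 + 3 + 3. The off-diagonal part has a diagonal square with both entries b^2, so its
  squared norm is at most 6 B^2, which is below (3 B)^2.\<close>

lemma N_\<psi>_le:
  assumes "f \<in> J"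
  shows "N (\<psi> f) \<le> 9 * nrm J_alg f"
proof -
  obtain a b d where f: "f = mk a b d" and abd: "J_entries a b d"
    using assms by (rule J_cases)
  define B where "B = nrm J_alg f"
  have le: "\<bar>a t\<bar> \<le> B" "\<bar>b t\<bar> \<le> B" "\<bar>d t\<bar> \<le> B" if "0 \<le> t" "t \<le> 1" for t
    using J_nrm_ge_entries[OF abd that] by (simp_all add: B_def f)
  have B: "0 \<le> B" using le(1)[of 0] by simp
  have cont: "continuous_on {0..1} a" "continuous_on {0..1} b" "continuous_on {0..1} d" and b0: "b 0 = 0" "b 1 = 0"
    using abd by (simp_all add: J_entries_def)
  have ent: "J_entries a (\<lambda>_. 0) (\<lambda>_. 0)" "J_entries (\<lambda>_. 0) b (\<lambda>_. 0)" "J_entries (\<lambda>_. 0) (\<lambda>_. 0) d"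
    "J_entries (\<lambda>t. b t * b t) (\<lambda>_. 0) (\<lambda>_. 0)" "J_entries (\<lambda>_. 0) (\<lambda>_. 0) (\<lambda>t. b t * b t)"
    using cont b0 by (simp_all add: J_entries_def continuous_on_const continuous_on_mult)
  have bb: "\<bar>b t * b t\<bar> \<le> B * B" if "0 \<le> t" "t \<le> 1" for t
    unfolding abs_mult using le(2)[OF that] by (intro mult_mono) auto
  have "\<psi> (E12 b) \<star> \<psi> (E12 b)
    = \<psi> (E12 b \<otimes>\<^sub>J E12 b)"
    by (rule \<psi>_mult[OF mk_in_J[OF ent(2)] mk_in_J[OF ent(2)], symmetric])
  also have "E12 b \<otimes>\<^sub>J E12 b
    = E11 (\<lambda>t. b t * b t) \<oplus>\<^sub>J E22 (\<lambda>t. b t * b t)"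
    by (simp add: J_ops)
  also have "\<psi> \<dots> = \<psi> (E11 (\<lambda>t. b t * b t)) + \<psi> (E22 (\<lambda>t. b t * b t))"
    by (rule \<psi>_add[OF mk_in_J[OF ent(4)] mk_in_J[OF ent(5)]])
  finally have bsq: "\<psi> (E12 b) \<star> \<psi> (E12 b)
    = \<psi> (E11 (\<lambda>t. b t * b t)) + \<psi> (E22 (\<lambda>t. b t * b t))" .
  have "(N (\<psi> (E12 b)))\<^sup>2 \<le> N (\<psi> (E11 (\<lambda>t. b t * b t))) + N (\<psi> (E22 (\<lambda>t. b t * b t)))"
    unfolding N_square bsq by (rule N_add)
  also have "\<dots> \<le> 3 * (B * B) + 3 * (B * B)"
    by (intro add_mono N_\<psi>_mk_diag_le bb continuous_on_mult cont)
  also have "\<dots> \<le> (3 * B)\<^sup>2" by (simp add: power2_eq_square)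
  finally have N_b: "N (\<psi> (E12 b)) \<le> 3 * B"
    by (rule power2_le_imp_le) (use B in simp)
  have "f = E11 a \<oplus>\<^sub>J (E12 b \<oplus>\<^sub>J E22 d)"
    by (simp add: f J_ops)
  then have "\<psi> f = \<psi> (E11 a) + (\<psi> (E12 b) + \<psi> (E22 d))"
    by (simp only: \<psi>_add mk_in_J ent J_closed)
  then have "N (\<psi> f) \<le> N (\<psi> (E11 a)) + N (\<psi> (E12 b) + \<psi> (E22 d))"
    using N_add by simp
  also have "\<dots> \<le> N (\<psi> (E11 a)) + (N (\<psi> (E12 b)) + N (\<psi> (E22 d)))"
    by (intro add_left_mono N_add)
  also have "\<dots> \<le> 3 * B + (3 * B + 3 * B)"
    by (intro add_mono N_\<psi>_mk_diag_le N_b le cont)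
  finally show ?thesis by (simp add: B_def)
qed

text \<open>\<open>rep P Q R\<close> does not depend on \<open>\<psi>\<close>, so two homomorphisms
  with the same values on the generators are compared through it.\<close>

lemma N_\<psi>_minus_rep_le:
  assumes "f \<in> J"
  shows "N (rep P Q R - \<psi> f) \<le> 9 * nrm J_alg (repJ P Q R \<ominus>\<^sub>J f)"
proof -
  have cl: "repJ P Q R \<ominus>\<^sub>J f \<in> J"
    unfolding a_minus_def uminus_eq_smult[OF J_module assms]
    by (intro J_closed repJ_in_J J_smult_closed assms)
  have "\<psi> (repJ P Q R \<ominus>\<^sub>J f) = rep P Q R - \<psi> f"
    by (simp add: a_minus_def uminus_eq_smult[OF J_module assms] \<psi>_add \<psi>_smult \<psi>_repJ repJ_in_J J_smult_closed assms)
  then show ?thesis using N_\<psi>_le[OF cl] by simp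
qed

end

end

section \<open>Freeness\<close>

lemma J_gens_simps: "J_gens 1 = J_p1" "J_gens 2 = J_p2"
  by (simp_all add: J_gens_def)

lemma jordan_homD:
  assumes "\<phi> \<in> unital_jordan_hom A B"
  shows "x \<in> carrier A \<Longrightarrow> \<phi> x \<in> carrier B"
    "x \<in> carrier A \<Longrightarrow> y \<in> carrier A \<Longrightarrow> \<phi> (x \<oplus>\<^bsub>A\<^esub> y) = \<phi> x \<oplus>\<^bsub>B\<^esub> \<phi> y"
    "x \<in> carrier A \<Longrightarrow> \<phi> (a \<odot>\<^bsub>A\<^esub> x) = a \<odot>\<^bsub>B\<^esub> \<phi> x"
    "x \<in> carrier A \<Longrightarrow> y \<in> carrier A \<Longrightarrow> \<phi> (x \<otimes>\<^bsub>A\<^esub> y) = \<phi> x \<otimes>\<^bsub>B\<^esub> \<phi> y"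
    "\<phi> \<one>\<^bsub>A\<^esub> = \<one>\<^bsub>B\<^esub>"
  using assms by (auto simp: unital_jordan_hom_def jordan_hom_def linear_maps_def)

lemma (in jb_two_projections) rep_simps:
  "rep 1 1 0 = e" "rep 1 0 0 = p" "rep [:0, 1:] [:1, -1:] 1 = q"
  by (simp_all add: rep_def y_def bilin comm[of c e] unit_c scaleR_2)

text \<open>The two claims rest on different bounds: existence on \<open>N_rep_le\<close>, which
  controls \<open>rep\<close> by the matrix norm, and uniqueness on the bound valid for every
  homomorphism.\<close>

lemma J_free_hom:
  fixes T :: "'b normed_alg"
  assumes T: "unital_jb_algebra T" and q: "q1 \<in> projections T" "q2 \<in> projections T"
  shows "\<exists>\<phi>. \<phi> \<in> extensional J \<and> \<phi> \<in> unital_jordan_hom J_alg T \<and> \<phi> J_p1 = q1 \<and> \<phi> J_p2 = q2"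
    and "\<lbrakk>\<phi> \<in> extensional J; \<phi> \<in> unital_jordan_hom J_alg T; \<phi> J_p1 = q1; \<phi> J_p2 = q2;
      \<phi>' \<in> extensional J; \<phi>' \<in> unital_jordan_hom J_alg T; \<phi>' J_p1 = q1; \<phi>' J_p2 = q2\<rbrakk> \<Longrightarrow> \<phi> = \<phi>'"
proof -
  interpret T: unital_jb_algebra T by (rule T)
  interpret J: unital_jb_algebra J_alg by (rule J_unital_jb_algebra)
  obtain k :: "('b \<Rightarrow>\<^sub>0 real) \<Rightarrow> 'b" and i where
    k: "\<And>v. k v \<in> carrier T" "\<And>u v. k (u + v) = k u \<oplus>\<^bsub>T\<^esub> k v" "\<And>a v. k (a *\<^sub>R v) = a \<odot>\<^bsub>T\<^esub> k v"
    and ki: "\<And>x. x \<in> carrier T \<Longrightarrow> k (i x) = x"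
    and i: "\<And>x y. \<lbrakk>x \<in> carrier T; y \<in> carrier T\<rbrakk> \<Longrightarrow> i (x \<oplus>\<^bsub>T\<^esub> y) = i x + i y"
    "\<And>a x. x \<in> carrier T \<Longrightarrow> i (a \<odot>\<^bsub>T\<^esub> x) = a *\<^sub>R i x"
    and jb: "jb_space (\<lambda>u v. i (k u \<otimes>\<^bsub>T\<^esub> k v)) (i \<one>\<^bsub>T\<^esub>) (\<lambda>v. nrm T (k v))"
    using unital_jb_algebra_as_jb_space[OF T] by blast
  have q_closed: "q1 \<in> carrier T" "q2 \<in> carrier T" and q_idem: "q1 \<otimes>\<^bsub>T\<^esub> q1 = q1" "q2 \<otimes>\<^bsub>T\<^esub> q2 = q2"
    using q by (auto simp: projections_def)
  interpret B: jb_space "\<lambda>u v. i (k u \<otimes>\<^bsub>T\<^esub> k v)" "i \<one>\<^bsub>T\<^esub>" "\<lambda>v. nrm T (k v)" by (rule jb)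
  interpret B: jb_two_projections "\<lambda>u v. i (k u \<otimes>\<^bsub>T\<^esub> k v)" "i \<one>\<^bsub>T\<^esub>" "\<lambda>v. nrm T (k v)" "i q1" "i q2"
    by unfold_locales (simp_all add: ki q_closed q_idem T.unit_closed T.unit)
  \<comment> \<open>The matrix algebra is transported as well, because
    \<open>dense_hom_extension\<close> works with total structures on both sides.\<close>
  obtain kJ :: "((real \<Rightarrow> real^2^2) \<Rightarrow>\<^sub>0 real) \<Rightarrow> (real \<Rightarrow> real^2^2)" and iJ where
    kJ: "\<And>v. kJ v \<in> J" "\<And>u v. kJ (u + v) = kJ u \<oplus>\<^sub>J kJ v" "\<And>a v. kJ (a *\<^sub>R v) = a \<odot>\<^sub>J kJ v"
    and kiJ: "\<And>x. x \<in> J \<Longrightarrow> kJ (iJ x) = x"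
    and iJ: "\<And>x y. \<lbrakk>x \<in> J; y \<in> J\<rbrakk> \<Longrightarrow> iJ (x \<oplus>\<^sub>J y) = iJ x + iJ y"
    "\<And>a x. x \<in> J \<Longrightarrow> iJ (a \<odot>\<^sub>J x) = a *\<^sub>R iJ x"
    and jbJ: "jb_space (\<lambda>u v. iJ (kJ u \<otimes>\<^sub>J kJ v)) (iJ \<one>\<^bsub>J_alg\<^esub>) (\<lambda>v. nrm J_alg (kJ v))"
    using unital_jb_algebra_as_jb_space[OF J_unital_jb_algebra] by blast
  have kJ_diff: "kJ (u - v) = kJ u \<ominus>\<^sub>J kJ v" for u v
  proof -
    have "kJ (u + (-1) *\<^sub>R v) = kJ u \<ominus>\<^sub>J kJ v"
      by (simp only: kJ(2,3) a_minus_def uminus_eq_smult[OF J_module kJ(1)])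
    then show ?thesis by simp
  qed
  define rA where "rA = (\<lambda>(P, Q, R). iJ (repJ P Q R))"
  define rB where "rB = (\<lambda>(P, Q, R). B.rep P Q R)"
  note rdef = rA_def rB_def
  show "\<exists>\<phi>. \<phi> \<in> extensional J \<and> \<phi> \<in> unital_jordan_hom J_alg T \<and> \<phi> J_p1 = q1 \<and> \<phi> J_p2 = q2"
  proof (rule dense_hom_extension[OF jbJ jb, of rA rB 8])
    show "\<exists>n. rA n = rA l + rA m \<and> rB n = rB l + rB m" for l m
    proof (cases l; cases m)
      fix P Q R P' Q' R' assume "l = (P, Q, R)" "m = (P', Q', R')"
      then show ?thesis
        by (intro exI[of _ "(P + P', Q + Q', R + R')"]) (simp add: rdef B.rep_add repJ_add[symmetric] iJ repJ_in_J)
    qed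
    show "\<exists>n. rA n = a *\<^sub>R rA l \<and> rB n = a *\<^sub>R rB l" for a l
    proof (cases l)
      fix P Q R assume "l = (P, Q, R)"
      then show ?thesis
        by (intro exI[of _ "(Polynomial.smult a P, Polynomial.smult a Q, Polynomial.smult a R)"])
          (simp add: rdef B.rep_scale repJ_smult[symmetric] iJ repJ_in_J)
    qed
    show "\<exists>n. rA n = iJ (kJ (rA l) \<otimes>\<^sub>J kJ (rA m)) \<and> rB n = i (k (rB l) \<otimes>\<^bsub>T\<^esub> k (rB m))" for l m
    proof (cases l; cases m)
      fix P Q R P' Q' R' assume "l = (P, Q, R)" "m = (P', Q', R')"
      then show ?thesis
        by (intro exI[of _ "(P * P' + [:0, 1, -1:] * (R * R'), Q * Q' + [:0, 1, -1:] * (R * R'),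
            Polynomial.smult (1/2) (R * (P' + Q') + R' * (P + Q)))"])
          (simp only: rdef prod.case B.rep_prod repJ_mult[symmetric] kiJ repJ_in_J simp_thms)
    qed
    show "nrm T (k (rB l)) \<le> 8 * nrm J_alg (kJ (rA l))" for l
    proof (cases l)
      fix P Q R assume l: "l = (P, Q, R)"
      show ?thesis
        unfolding l rdef prod.case kiJ[OF repJ_in_J]
        by (intro B.N_rep_le) (simp_all only: repJ_def J_nrm_ge_entries[OF J_entries_rep])
    qed
    show "\<exists>l. nrm J_alg (kJ (rA l - x)) < r" if r: "0 < r" for x r
    proof -
      obtain P Q R where "nrm J_alg (repJ P Q R \<ominus>\<^sub>J kJ x) < r"
        using repJ_dense[OF kJ(1) r] by blast
      then show ?thesis
        by (intro exI[of _ "(P, Q, R)"]) (simp add: rdef kJ_diff kiJ repJ_in_J)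
    qed
    show "i (k (i \<one>\<^bsub>T\<^esub>) \<otimes>\<^bsub>T\<^esub> k (rB l)) = rB l" for l
      by (cases l) (simp only: rdef prod.case B.unit_rep)
  next
    fix \<phi>0 assume \<phi>0: "\<And>x y. \<phi>0 (x + y) = \<phi>0 x + \<phi>0 y" "\<And>a x. \<phi>0 (a *\<^sub>R x) = a *\<^sub>R \<phi>0 x"
      "\<And>x y. \<phi>0 (iJ (kJ x \<otimes>\<^sub>J kJ y)) = i (k (\<phi>0 x) \<otimes>\<^bsub>T\<^esub> k (\<phi>0 y))" "\<And>l. \<phi>0 (rA l) = rB l"
    have \<phi>0_rep: "\<phi>0 (iJ (repJ P Q R)) = B.rep P Q R" for P Q R
      using \<phi>0(4)[of "(P, Q, R)"] by (simp only: rdef prod.case)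
    define \<phi> where "\<phi> = (\<lambda>f\<in>J. k (\<phi>0 (iJ f)))"
    have "\<phi> \<in> unital_jordan_hom J_alg T"
      unfolding unital_jordan_hom_def jordan_hom_def linear_maps_def mem_Collect_eq
    proof (intro conjI ballI allI funcsetI)
      fix f assume f: "f \<in> J"
      show "\<phi> f \<in> carrier T" by (simp add: \<phi>_def f k)
      show "\<phi> (a \<odot>\<^sub>J f) = a \<odot>\<^bsub>T\<^esub> \<phi> f" for a
        by (simp add: \<phi>_def f J_smult_closed iJ \<phi>0 k)
      fix g assume g: "g \<in> J"
      show "\<phi> (f \<oplus>\<^sub>J g) = \<phi> f \<oplus>\<^bsub>T\<^esub> \<phi> g"
        by (simp add: \<phi>_def f g J_closed iJ \<phi>0 k)
      show "\<phi> (f \<otimes>\<^sub>J g) = \<phi> f \<otimes>\<^bsub>T\<^esub> \<phi> g"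
        using \<phi>0(3)[of "iJ f" "iJ g"] by (simp add: \<phi>_def f g J_closed kiJ k ki T.jprod_closed)
    next
      show "\<phi> \<one>\<^bsub>J_alg\<^esub> = \<one>\<^bsub>T\<^esub>"
        using \<phi>0_rep[of 1 1 0] by (simp add: \<phi>_def J_one_zero_closed J_one_repJ[symmetric] B.rep_simps ki T.unit_closed)
    qed
    moreover have "\<phi> J_p1 = q1"
      unfolding J_p1_repJ \<phi>_def using repJ_in_J \<phi>0_rep[of 1 0 0] by (simp add: B.rep_simps ki q_closed)
    moreover have "\<phi> J_p2 = q2"
      unfolding J_p2_repJ \<phi>_def using repJ_in_J by (simp add: \<phi>0_rep B.rep_simps ki q_closed)
    moreover have "\<phi> \<in> extensional J" by (simp add: \<phi>_def)
    ultimately show ?thesis by blast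
  qed
  assume \<phi>: "\<phi> \<in> extensional J" "\<phi> \<in> unital_jordan_hom J_alg T" "\<phi> J_p1 = q1" "\<phi> J_p2 = q2"
    and \<phi>': "\<phi>' \<in> extensional J" "\<phi>' \<in> unital_jordan_hom J_alg T" "\<phi>' J_p1 = q1" "\<phi>' J_p2 = q2"
  show "\<phi> = \<phi>'"
  proof (rule extensionalityI[OF \<phi>(1) \<phi>'(1)])
    fix f assume f: "f \<in> J"
    note h = jordan_homD[OF \<phi>(2)] and h' = jordan_homD[OF \<phi>'(2)]
    have le: "nrm T (k (B.rep P Q R - i (\<phi> f))) \<le> 9 * nrm J_alg (repJ P Q R \<ominus>\<^sub>J f)" for P Q R
      by (rule B.N_\<psi>_minus_rep_le[of "\<lambda>f. i (\<phi> f)"]) (simp_all add: h i ki \<phi> f)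
    have le': "nrm T (k (B.rep P Q R - i (\<phi>' f))) \<le> 9 * nrm J_alg (repJ P Q R \<ominus>\<^sub>J f)" for P Q R
      by (rule B.N_\<psi>_minus_rep_le[of "\<lambda>f. i (\<phi>' f)"]) (simp_all add: h' i ki \<phi>' f)
    have "nrm T (k (i (\<phi> f) - i (\<phi>' f))) \<le> 0"
    proof (rule field_le_epsilon)
      fix r :: real assume "0 < r"
      \<comment> \<open>18 = 2 * 9: two homomorphisms, each within 9 times the approximation error
        of the common \<open>rep\<close>.\<close>
      then obtain P Q R where r: "nrm J_alg (repJ P Q R \<ominus>\<^sub>J f) < r / 18"
        using repJ_dense[OF f, of "r / 18"] by auto
      have "nrm T (k (i (\<phi> f) - i (\<phi>' f))) \<le> nrm T (k (B.rep P Q R - i (\<phi>' f))) + nrm T (k (B.rep P Q R - i (\<phi> f)))"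
        using B.N_diff[of "B.rep P Q R - i (\<phi>' f)" "B.rep P Q R - i (\<phi> f)"] by simp
      then show "nrm T (k (i (\<phi> f) - i (\<phi>' f))) \<le> 0 + r"
        using le[of P Q R] le'[of P Q R] r by linarith
    qed
    then have "nrm T (k (i (\<phi> f) - i (\<phi>' f))) = 0"
      using B.N_nonneg[of "i (\<phi> f) - i (\<phi>' f)"] by linarith
    then have "i (k (i \<one>\<^bsub>T\<^esub>) \<otimes>\<^bsub>T\<^esub> k (i (\<phi> f) - i (\<phi>' f))) = 0"
      by (rule B.N_zero)
    then have "i (k (i \<one>\<^bsub>T\<^esub>) \<otimes>\<^bsub>T\<^esub> k (i (\<phi> f))) = i (k (i \<one>\<^bsub>T\<^esub>) \<otimes>\<^bsub>T\<^esub> k (i (\<phi>' f)))"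
      by (simp only: B.diff_right right_minus_eq)
    then have "i (\<phi> f) = i (\<phi>' f)"
      by (simp add: ki T.unit_closed T.unit h h' f)
    then have "k (i (\<phi> f)) = k (i (\<phi>' f))" by (rule arg_cong)
    then show "\<phi> f = \<phi>' f" by (simp only: ki[OF h(1)[OF f]] ki[OF h'(1)[OF f]])
  qed
qed

lemma J_free: "free_unital_jb_algebra TYPE('b) 2 J_alg J_gens"
proof -
  have "{1..2} = {1, 2 :: nat}" by auto
  then have two: "(\<forall>i\<in>{1..2}. P i) \<longleftrightarrow> P 1 \<and> P 2" for P :: "nat \<Rightarrow> bool"
    by (simp only: ball_simps simp_thms)
  have "\<exists>!\<phi>. \<phi> \<in> extensional J \<and> \<phi> \<in> unital_jordan_hom J_alg T \<and> (\<forall>i\<in>{1..2}. \<phi> (J_gens i) = q i)"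
    if T: "unital_jb_algebra T" and q: "\<forall>i\<in>{1..2}. q i \<in> projections T" for T :: "'b normed_alg" and q
  proof -
    have q12: "q 1 \<in> projections T" "q 2 \<in> projections T" using q unfolding two by blast+
    obtain \<phi> where \<phi>: "\<phi> \<in> extensional J" "\<phi> \<in> unital_jordan_hom J_alg T" "\<phi> J_p1 = q 1" "\<phi> J_p2 = q 2"
      using J_free_hom(1)[OF T q12] by blast
    show ?thesis
      unfolding two J_gens_simps
    proof (rule ex1I[of _ \<phi>])
      show "\<phi> \<in> extensional J \<and> \<phi> \<in> unital_jordan_hom J_alg T \<and> \<phi> J_p1 = q 1 \<and> \<phi> J_p2 = q 2"
        by (intro conjI \<phi>)
      show "\<phi>' = \<phi>" if "\<phi>' \<in> extensional J \<and> \<phi>' \<in> unital_jordan_hom J_alg T \<and> \<phi>' J_p1 = q 1 \<and> \<phi>' J_p2 = q 2" for \<phi>'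
        by (intro J_free_hom(2)[OF T q12 _ _ _ _ \<phi>]) (simp_all only: that)
    qed
  qed
  then show ?thesis
    unfolding free_unital_jb_algebra_def two[of "\<lambda>i. J_gens i \<in> projections J_alg"] J_gens_simps
    using J_unital_jb_algebra J_p1_projection J_p2_projection by blast
qed

section \<open>Uniqueness of free algebras up to isomorphism\<close>

lemma unital_jordan_hom_comp:
  assumes "\<phi> \<in> unital_jordan_hom A B" "\<eta> \<in> unital_jordan_hom B C" "unital_jb_algebra A"
  shows "(\<lambda>x\<in>carrier A. \<eta> (\<phi> x)) \<in> unital_jordan_hom A C"
proof -
  interpret A: unital_jb_algebra A by (rule assms)
  note h = jordan_homD[OF assms(1)] jordan_homD[OF assms(2)]
  show ?thesis
    unfolding unital_jordan_hom_def jordan_hom_def linear_maps_def mem_Collect_eq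
    by (intro conjI ballI allI funcsetI) (simp_all add: h A.jprod_closed A.unit_closed)
qed

lemma unital_jordan_hom_id:
  assumes "unital_jb_algebra A"
  shows "(\<lambda>x\<in>carrier A. x) \<in> unital_jordan_hom A A"
proof -
  interpret A: unital_jb_algebra A by (rule assms)
  show ?thesis
    unfolding unital_jordan_hom_def jordan_hom_def linear_maps_def mem_Collect_eq
    by (intro conjI ballI allI funcsetI) (simp_all add: A.jprod_closed A.unit_closed)
qed

text \<open>The identity also fixes the generators, and freeness tested against the algebra itself
  leaves room for only one such endomorphism.\<close>

lemma free_endomorphism_id:
  fixes A :: "'a normed_alg"
  assumes free: "free_unital_jb_algebra TYPE('a) n A u"
    and \<phi>: "\<phi> \<in> unital_jordan_hom A A" "\<phi> \<in> extensional (carrier A)" "\<And>i. i \<in> {1..n} \<Longrightarrow> \<phi> (u i) = u i"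
    and x: "x \<in> carrier A"
  shows "\<phi> x = x"
proof -
  have A: "unital_jb_algebra A" and u: "\<forall>i\<in>{1..n}. u i \<in> projections A"
    using free by (simp_all add: free_unital_jb_algebra_def)
  have ex1: "\<exists>!\<phi>. \<phi> \<in> extensional (carrier A) \<and> \<phi> \<in> unital_jordan_hom A A \<and> (\<forall>i\<in>{1..n}. \<phi> (u i) = u i)"
    using free A u unfolding free_unital_jb_algebra_def by blast
  have "\<phi> = (\<lambda>x\<in>carrier A. x)"
  proof (rule ex1E[OF ex1])
    fix \<eta> assume uniq: "\<forall>\<phi>. \<phi> \<in> extensional (carrier A) \<and> \<phi> \<in> unital_jordan_hom A A \<and> (\<forall>i\<in>{1..n}. \<phi> (u i) = u i) \<longrightarrow> \<phi> = \<eta>"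
    have "\<phi> = \<eta>"
      using \<phi> by (intro uniq[rule_format] conjI ballI)
    moreover have "(\<lambda>x\<in>carrier A. x) = \<eta>"
      using u by (intro uniq[rule_format] conjI ballI unital_jordan_hom_id[OF A]) (simp_all add: projections_def)
    ultimately show ?thesis by simp
  qed
  then show ?thesis using x by simp
qed

text \<open>Each algebra is taken free at two element types: the type of the other algebra gives the
  map across, its own type forces the composite to be the identity.\<close>

lemma free_unital_jb_algebra_unique:
  fixes A :: "'a normed_alg" and B :: "'b normed_alg"
  assumes A: "free_unital_jb_algebra TYPE('a) n A u" "free_unital_jb_algebra TYPE('b) n A u"
    and B: "free_unital_jb_algebra TYPE('b) n B w" "free_unital_jb_algebra TYPE('a) n B w"
  shows "\<exists>\<phi>\<in>jordan_iso A B. \<forall>i\<in>{1..n}. \<phi> (u i) = w i"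
proof -
  have uA: "unital_jb_algebra A" "\<forall>i\<in>{1..n}. u i \<in> projections A"
    and uB: "unital_jb_algebra B" "\<forall>i\<in>{1..n}. w i \<in> projections B"
    using A(1) B(1) by (simp_all add: free_unital_jb_algebra_def)
  obtain \<phi> where \<phi>: "\<phi> \<in> unital_jordan_hom A B" "\<forall>i\<in>{1..n}. \<phi> (u i) = w i"
    using A(2) uB unfolding free_unital_jb_algebra_def by blast
  obtain \<eta> where \<eta>: "\<eta> \<in> unital_jordan_hom B A" "\<forall>i\<in>{1..n}. \<eta> (w i) = u i"
    using B(2) uA unfolding free_unital_jb_algebra_def by blast
  have 1: "\<eta> (\<phi> x) = x" if "x \<in> carrier A" for x
  proof -
    have "(\<lambda>x\<in>carrier A. \<eta> (\<phi> x)) x = x"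
    proof (rule free_endomorphism_id[OF A(1) unital_jordan_hom_comp[OF \<phi>(1) \<eta>(1) uA(1)] _ _ that])
      show "(\<lambda>x\<in>carrier A. \<eta> (\<phi> x)) (u i) = u i" if i: "i \<in> {1..n}" for i
      proof -
        have "u i \<in> carrier A" using uA(2) i by (auto simp: projections_def)
        then show ?thesis using bspec[OF \<phi>(2) i] bspec[OF \<eta>(2) i] by simp
      qed
    qed simp
    then show ?thesis using that by simp
  qed
  have 2: "\<phi> (\<eta> x) = x" if "x \<in> carrier B" for x
  proof -
    have "(\<lambda>x\<in>carrier B. \<phi> (\<eta> x)) x = x"
    proof (rule free_endomorphism_id[OF B(1) unital_jordan_hom_comp[OF \<eta>(1) \<phi>(1) uB(1)] _ _ that])
      show "(\<lambda>x\<in>carrier B. \<phi> (\<eta> x)) (w i) = w i" if i: "i \<in> {1..n}" for i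
      proof -
        have "w i \<in> carrier B" using uB(2) i by (auto simp: projections_def)
        then show ?thesis using bspec[OF \<phi>(2) i] bspec[OF \<eta>(2) i] by simp
      qed
    qed simp
    then show ?thesis using that by simp
  qed
  have "bij_betw \<phi> (carrier A) (carrier B)"
  proof (rule bij_betw_byWitness)
    show "\<forall>x\<in>carrier A. \<eta> (\<phi> x) = x" using 1 by blast
    show "\<forall>x\<in>carrier B. \<phi> (\<eta> x) = x" using 2 by blast
    show "\<phi> ` carrier A \<subseteq> carrier B" using jordan_homD(1)[OF \<phi>(1)] by blast
    show "\<eta> ` carrier B \<subseteq> carrier A" using jordan_homD(1)[OF \<eta>(1)] by blast
  qed
  then have "\<phi> \<in> jordan_iso A B"
    using \<phi>(1) by (simp add: jordan_iso_def unital_jordan_hom_def)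
  then show ?thesis using \<phi>(2) by blast
qed

section \<open>A Hilbert space representation\<close>

definition l2_in :: "('i \<Rightarrow> 'v::real_normed_vector) \<Rightarrow> bool" where
  "l2_in v \<longleftrightarrow> (\<lambda>t. (norm (v t))\<^sup>2) summable_on UNIV"

definition l2_norm :: "('i \<Rightarrow> 'v::real_normed_vector) \<Rightarrow> real" where
  "l2_norm v = sqrt (\<Sum>\<^sub>\<infinity>t. (norm (v t))\<^sup>2)"

lemma l2_norm_nonneg: "0 \<le> l2_norm v"
  by (simp add: l2_norm_def infsum_nonneg)

lemma L2_set_le_l2_norm:
  assumes "l2_in v" "finite F"
  shows "L2_set (\<lambda>t. norm (v t)) F \<le> l2_norm v"
  unfolding L2_set_def l2_norm_def
  using assms by (intro real_sqrt_le_mono finite_sum_le_infsum) (auto simp: l2_in_def)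

lemma norm_le_l2_norm: "l2_in v \<Longrightarrow> norm (v t) \<le> l2_norm v"
  using L2_set_le_l2_norm[of v "{t}"] by (simp add: L2_set_def)

text \<open>Estimates are made on finite index sets, where \<open>L2_set\<close> offers Minkowski's
  inequality, and are carried over to the full family here.\<close>

lemma l2I:
  assumes "\<And>F. finite F \<Longrightarrow> L2_set (\<lambda>t. norm (v t)) F \<le> B"
  shows "l2_in v" "l2_norm v \<le> B"
proof -
  have B: "0 \<le> B" using assms[of "{}"] by simp
  have le: "(\<Sum>t\<in>F. (norm (v t))\<^sup>2) \<le> B\<^sup>2" if "finite F" for F
    using assms[OF that] by (simp add: L2_set_def sqrt_le_D)
  show l2: "l2_in v"
    unfolding l2_in_def by (rule nonneg_bdd_above_summable_on) (auto intro!: bdd_aboveI2 le)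
  have "(\<Sum>\<^sub>\<infinity>t. (norm (v t))\<^sup>2) \<le> B\<^sup>2"
    using l2 unfolding l2_in_def by (rule infsum_le_finite_sums) (rule le)
  then show "l2_norm v \<le> B"
    unfolding l2_norm_def using B real_le_lsqrt by (simp add: infsum_nonneg)
qed

lemma l2_mono:
  assumes "l2_in v" "0 \<le> B" "\<And>t. norm (w t) \<le> B * norm (v t)"
  shows "l2_in w" "l2_norm w \<le> B * l2_norm v"
proof -
  have "L2_set (\<lambda>t. norm (w t)) F \<le> B * l2_norm v" if "finite F" for F
  proof -
    have "L2_set (\<lambda>t. norm (w t)) F \<le> L2_set (\<lambda>t. B * norm (v t)) F"
      using assms by (intro L2_set_mono) auto
    also have "\<dots> = B * L2_set (\<lambda>t. norm (v t)) F"
      using assms(2) by (simp add: L2_set_right_distrib)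
    also have "\<dots> \<le> B * l2_norm v"
      using assms that by (intro mult_left_mono L2_set_le_l2_norm)
    finally show ?thesis .
  qed
  note le = this
  show "l2_in w" by (rule l2I(1)) (rule le)
  show "l2_norm w \<le> B * l2_norm v" by (rule l2I(2)) (rule le)
qed

lemma l2_add:
  assumes "l2_in v" "l2_in w"
  shows "l2_in (\<lambda>t. v t + w t)" "l2_norm (\<lambda>t. v t + w t) \<le> l2_norm v + l2_norm w"
proof -
  have "L2_set (\<lambda>t. norm (v t + w t)) F \<le> l2_norm v + l2_norm w" if "finite F" for F
  proof -
    have "L2_set (\<lambda>t. norm (v t + w t)) F \<le> L2_set (\<lambda>t. norm (v t) + norm (w t)) F"
      by (intro L2_set_mono norm_triangle_ineq norm_ge_zero)
    also have "\<dots> \<le> L2_set (\<lambda>t. norm (v t)) F + L2_set (\<lambda>t. norm (w t)) F"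
      by (rule L2_set_triangle_ineq)
    also have "\<dots> \<le> l2_norm v + l2_norm w"
      by (intro add_mono L2_set_le_l2_norm assms that)
    finally show ?thesis .
  qed
  note le = this
  show "l2_in (\<lambda>t. v t + w t)" by (rule l2I(1)) (rule le)
  show "l2_norm (\<lambda>t. v t + w t) \<le> l2_norm v + l2_norm w" by (rule l2I(2)) (rule le)
qed

lemma l2_complete:
  fixes X :: "nat \<Rightarrow> 'i \<Rightarrow> 'v::banach"
  assumes X: "\<And>n. l2_in (X n)"
    and C: "\<And>r. 0 < r \<Longrightarrow> \<exists>K. \<forall>m\<ge>K. \<forall>n\<ge>K. l2_norm (\<lambda>t. X m t - X n t) < r"
  obtains l where "l2_in l" "(\<lambda>n. l2_norm (\<lambda>t. X n t - l t)) \<longlonglongrightarrow> 0" "\<And>t. (\<lambda>n. X n t) \<longlonglongrightarrow> l t"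
proof -
  have diff: "l2_in (\<lambda>t. v t - w t)" if "l2_in v" "l2_in w" for v w :: "'i \<Rightarrow> 'v"
    using l2_add(1)[OF that(1) l2_mono(1)[OF that(2), of 1 "\<lambda>t. - w t"]] by simp
  have "Cauchy (\<lambda>n. X n t)" for t
  proof (rule CauchyI)
    fix r :: real assume "0 < r"
    then obtain K where K: "\<forall>m\<ge>K. \<forall>n\<ge>K. l2_norm (\<lambda>t. X m t - X n t) < r" using C by blast
    have "norm (X m t - X n t) < r" if "K \<le> m" "K \<le> n" for m n
    proof -
      have "norm (X m t - X n t) \<le> l2_norm (\<lambda>t. X m t - X n t)"
        by (rule norm_le_l2_norm[OF diff[OF X X]])
      also have "\<dots> < r" using K that by blast
      finally show ?thesis .
    qed
    then show "\<exists>K. \<forall>m\<ge>K. \<forall>n\<ge>K. norm (X m t - X n t) < r" by blast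
  qed
  then have lim: "(\<lambda>n. X n t) \<longlonglongrightarrow> lim (\<lambda>n. X n t)" for t
    by (simp add: Cauchy_convergent_iff convergent_LIMSEQ_iff)
  define l where "l t = lim (\<lambda>n. X n t)" for t
  \<comment> \<open>For fixed \<open>n\<close> the limit over \<open>m\<close> is taken inside a
    finite sum, and only afterwards does the finite set vary, as in Fatou's lemma.\<close>
  have close: "l2_in (\<lambda>t. X n t - l t) \<and> l2_norm (\<lambda>t. X n t - l t) \<le> r"
    if K: "\<forall>m\<ge>K. \<forall>n\<ge>K. l2_norm (\<lambda>t. X m t - X n t) < r" and n: "K \<le> n" for n K r
  proof -
    have "L2_set (\<lambda>t. norm (X n t - l t)) F \<le> r" if F: "finite F" for F
    proof (rule LIMSEQ_le_const2)
      show "(\<lambda>m. L2_set (\<lambda>t. norm (X n t - X m t)) F) \<longlonglongrightarrow> L2_set (\<lambda>t. norm (X n t - l t)) F"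
        unfolding L2_set_def l_def by (intro tendsto_intros lim)
      have "L2_set (\<lambda>t. norm (X n t - X m t)) F \<le> r" if "K \<le> m" for m
        using L2_set_le_l2_norm[OF diff[OF X X] F, of n m] K n that by (meson less_imp_le order_trans)
      then show "\<exists>M. \<forall>m\<ge>M. L2_set (\<lambda>t. norm (X n t - X m t)) F \<le> r" by blast
    qed
    then show ?thesis using l2I[of "\<lambda>t. X n t - l t" r] by blast
  qed
  have "l2_in l"
  proof -
    obtain K where "\<forall>m\<ge>K. \<forall>n\<ge>K. l2_norm (\<lambda>t. X m t - X n t) < 1" using C[of 1] by auto
    from close[OF this order_refl] have "l2_in (\<lambda>t. X K t - l t)" by simp
    from diff[OF X[of K] this] show ?thesis by simp
  qed
  moreover have "(\<lambda>n. l2_norm (\<lambda>t. X n t - l t)) \<longlonglongrightarrow> 0"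
  proof (rule LIMSEQ_I)
    fix r :: real assume r: "0 < r"
    then obtain K where K: "\<forall>m\<ge>K. \<forall>n\<ge>K. l2_norm (\<lambda>t. X m t - X n t) < r / 2" using C[of "r / 2"] by auto
    have "norm (l2_norm (\<lambda>t. X n t - l t) - 0) < r" if "K \<le> n" for n
      using close[OF K that] l2_norm_nonneg[of "\<lambda>t. X n t - l t"] r by simp
    then show "\<exists>K. \<forall>n\<ge>K. norm (l2_norm (\<lambda>t. X n t - l t) - 0) < r" by blast
  qed
  ultimately show ?thesis
    using lim by (intro that[of l]) (simp_all add: l_def)
qed

definition cip :: "complex^2 \<Rightarrow> complex^2 \<Rightarrow> complex" where
  "cip x y = (\<Sum>i\<in>UNIV. x $ i * cnj (y $ i))"

lemma norm_vec2: "(norm (x :: 'a::real_normed_vector^2))\<^sup>2 = (norm (x $ 1))\<^sup>2 + (norm (x $ 2))\<^sup>2"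
  by (simp add: norm_vec_def L2_set_def sum_2)

lemma cip_self: "cip x x = complex_of_real ((norm x)\<^sup>2)"
  unfolding norm_vec2 of_real_add complex_norm_square by (simp add: cip_def sum_2)

text \<open>A crude bound with a summable right-hand side; it makes the series defining the inner
  product converge.\<close>

lemma norm_cip_le: "norm (cip x y) \<le> (norm x)\<^sup>2 + (norm y)\<^sup>2"
proof -
  have *: "norm (a * cnj b) \<le> (norm a)\<^sup>2 + (norm b)\<^sup>2" for a b :: complex
  proof -
    have "0 \<le> (norm a - norm b)\<^sup>2 + ((norm a)\<^sup>2 + (norm b)\<^sup>2)" by simp
    then show ?thesis by (simp add: norm_mult power2_eq_square algebra_simps)
  qed
  have "norm (cip x y) \<le> norm (x $ 1 * cnj (y $ 1)) + norm (x $ 2 * cnj (y $ 2))"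
    unfolding cip_def sum_2 by (rule norm_triangle_ineq)
  then show ?thesis
    using *[of "x $ 1" "y $ 1"] *[of "x $ 2" "y $ 2"] unfolding norm_vec2 by linarith
qed

text \<open>The Hilbert sum of one copy of \<open>\<complex>\<^sup>2\<close> for each point of the interval (not square-integrable
  functions). The fields \<open>mult\<close> and \<open>one\<close> are dummies.\<close>

definition l2_space :: "(real \<Rightarrow> complex^2) inner_space" where
  "l2_space = \<lparr>carrier = {v. (\<forall>t. t \<notin> {0..1} \<longrightarrow> v t = 0) \<and> l2_in v},
     mult = (\<lambda>v w. v), one = (\<lambda>_. 0), zero = (\<lambda>_. 0), add = (\<lambda>v w t. v t + w t),
     smult = (\<lambda>a v t. a *s v t), cinner = (\<lambda>v w. \<Sum>\<^sub>\<infinity>t. cip (v t) (w t))\<rparr>"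

lemma l2_space_simps:
  "v \<in> carrier l2_space \<longleftrightarrow> (\<forall>t. t \<notin> {0..1} \<longrightarrow> v t = 0) \<and> l2_in v"
  "\<zero>\<^bsub>l2_space\<^esub> = (\<lambda>_. 0)" "v \<oplus>\<^bsub>l2_space\<^esub> w = (\<lambda>t. v t + w t)" "a \<odot>\<^bsub>l2_space\<^esub> v = (\<lambda>t. a *s v t)"
  "cinner l2_space v w = (\<Sum>\<^sub>\<infinity>t. cip (v t) (w t))"
  by (simp_all add: l2_space_def)

abbreviation L2_plus (infixl \<open>\<oplus>\<^sub>2\<close> 65) where "v \<oplus>\<^sub>2 w \<equiv> v \<oplus>\<^bsub>l2_space\<^esub> w"
abbreviation L2_minus (infixl \<open>\<ominus>\<^sub>2\<close> 65) where "v \<ominus>\<^sub>2 w \<equiv> v \<ominus>\<^bsub>l2_space\<^esub> w"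
abbreviation L2_scale (infixl \<open>\<odot>\<^sub>2\<close> 70) where "a \<odot>\<^sub>2 v \<equiv> a \<odot>\<^bsub>l2_space\<^esub> v"
abbreviation "L2 \<equiv> carrier l2_space"

lemma cip_summable:
  assumes "l2_in v" "l2_in w"
  shows "(\<lambda>t. cip (v t) (w t)) summable_on UNIV"
proof (rule abs_summable_summable, rule summable_on_comparison_test)
  show "(\<lambda>t. (norm (v t))\<^sup>2 + (norm (w t))\<^sup>2) summable_on UNIV"
    using assms by (intro summable_on_add) (simp_all add: l2_in_def)
qed (simp_all add: norm_cip_le)

lemma norm_vector_scalar_mult: "norm (a *s x) = norm a * norm x" for x :: "complex^2"
proof -
  have "(norm (a *s x))\<^sup>2 = (norm a * norm x)\<^sup>2"
    by (simp add: norm_vec2 power_mult_distrib norm_mult distrib_left)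
  then show ?thesis by (simp add: power2_eq_iff_nonneg)
qed

lemma hnorm_l2_space: "hnorm l2_space v = l2_norm v" if "l2_in v"
proof -
  have "(\<Sum>\<^sub>\<infinity>t. cip (v t) (v t)) = complex_of_real (\<Sum>\<^sub>\<infinity>t. (norm (v t))\<^sup>2)"
    unfolding cip_self using that unfolding l2_in_def
    by (intro infsumI has_sum_of_real has_sum_infsum)
  then show ?thesis by (simp add: hnorm_def l2_space_simps l2_norm_def)
qed

lemma l2_zero: "l2_in (\<lambda>_. 0)" "l2_norm (\<lambda>_. 0) = 0"
  using l2I[of "\<lambda>_. 0" 0] l2_norm_nonneg[of "\<lambda>_. 0"] by (auto simp: L2_set_def intro: order_antisym)

lemma l2_smult: "l2_in v \<Longrightarrow> l2_in (\<lambda>t. a *s v t)" for v :: "'i \<Rightarrow> complex^2"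
  by (rule l2_mono(1)[of v "norm a"]) (simp_all add: norm_vector_scalar_mult)

lemma l2_space_module: "Module.module scalar_ring l2_space"
proof (rule module_scalar_ringI)
  show "abelian_group l2_space"
  proof (rule abelian_groupI)
    show "\<exists>w\<in>L2. w \<oplus>\<^sub>2 v = \<zero>\<^bsub>l2_space\<^esub>" if "v \<in> L2" for v
      using that l2_smult[of v "-1"] by (intro bexI[of _ "\<lambda>t. (-1) *s v t"]) (auto simp: l2_space_simps)
  qed (auto simp: l2_space_simps l2_add l2_zero algebra_simps)
qed (auto simp: l2_space_simps l2_smult vector_add_ldistrib vector_sadd_rdistrib vector_smult_assoc)

lemma l2_space_minus: "w \<in> L2 \<Longrightarrow> v \<ominus>\<^sub>2 w = (\<lambda>t. v t - w t)"
  by (simp add: a_minus_def uminus_eq_smult[OF l2_space_module]) (simp add: l2_space_simps vec_eq_iff fun_eq_iff)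

lemma l2_space_normed_group: "normed_group l2_space (hnorm l2_space)"
proof -
  interpret M: Module.module scalar_ring l2_space by (rule l2_space_module)
  show ?thesis
  proof (intro normed_group.intro[OF M.abelian_group_axioms] normed_group_axioms.intro)
    fix v assume v: "v \<in> L2"
    then have l2: "l2_in v" by (simp add: l2_space_simps)
    show "0 \<le> hnorm l2_space v"
      by (simp add: hnorm_l2_space l2 l2_norm_nonneg)
    show "hnorm l2_space v = 0 \<longleftrightarrow> v = \<zero>\<^bsub>l2_space\<^esub>"
    proof
      assume "hnorm l2_space v = 0"
      then have "norm (v t) \<le> 0" for t
        using norm_le_l2_norm[OF l2, of t] by (simp add: hnorm_l2_space l2)
      then show "v = \<zero>\<^bsub>l2_space\<^esub>" by (simp add: l2_space_simps fun_eq_iff)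
    next
      assume "v = \<zero>\<^bsub>l2_space\<^esub>"
      then show "hnorm l2_space v = 0" by (simp add: hnorm_l2_space l2_zero l2_space_simps)
    qed
    have "(\<lambda>t. norm ((-1) *s v t)) = (\<lambda>t. norm (v t))"
      by (simp add: norm_vector_scalar_mult del: vector_sneg_minus1)
    then have "l2_norm (\<lambda>t. (-1) *s v t) = l2_norm v"
      unfolding l2_norm_def by metis
    then show "hnorm l2_space (\<ominus>\<^bsub>l2_space\<^esub> v) = hnorm l2_space v"
      unfolding uminus_eq_smult[OF l2_space_module v] l2_space_simps(4)
      by (simp only: hnorm_l2_space l2 l2_smult)
    fix w assume "w \<in> L2"
    then show "hnorm l2_space (v \<oplus>\<^sub>2 w) \<le> hnorm l2_space v + hnorm l2_space w"
      using l2 by (simp add: l2_space_simps hnorm_l2_space l2_add)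
  qed
qed

lemma l2_space_hilbert: "complex_hilbert_space l2_space"
proof (intro complex_hilbert_space.intro l2_space_module complex_hilbert_space_axioms.intro)
  fix x y z :: "real \<Rightarrow> complex^2"
  assume x: "x \<in> L2"
  then have x2: "l2_in x" by (simp add: l2_space_simps)
  have cxx: "cinner l2_space x x = complex_of_real (\<Sum>\<^sub>\<infinity>t. (norm (x t))\<^sup>2)"
    unfolding l2_space_simps cip_self using x2 unfolding l2_in_def
    by (intro infsumI has_sum_of_real has_sum_infsum)
  then show "0 \<le> Re (cinner l2_space x x)" by (simp add: infsum_nonneg)
  show "x = \<zero>\<^bsub>l2_space\<^esub>" if "cinner l2_space x x = 0"
  proof -
    have "hnorm l2_space x = 0" using that by (simp add: hnorm_def)
    then show ?thesis using normed_group.N_eq_0[OF l2_space_normed_group x] by simp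
  qed
  assume y: "y \<in> L2"
  then have y2: "l2_in y" by (simp add: l2_space_simps)
  show "cinner l2_space (a \<odot>\<^sub>2 x) y = a * cinner l2_space x y" for a
  proof -
    have "cip (a *s x t) (y t) = a * cip (x t) (y t)" for t
      by (simp add: cip_def sum_2 algebra_simps)
    then show ?thesis by (simp add: l2_space_simps infsum_cmult_right cip_summable x2 y2)
  qed
  show "cinner l2_space y x = cnj (cinner l2_space x y)"
  proof -
    have "cip (y t) (x t) = cnj (cip (x t) (y t))" for t
      by (simp add: cip_def sum_2)
    then show ?thesis by (simp add: l2_space_simps)
  qed
  assume z: "z \<in> L2"
  then have z2: "l2_in z" by (simp add: l2_space_simps)
  show "cinner l2_space (x \<oplus>\<^sub>2 y) z = cinner l2_space x z + cinner l2_space y z"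
  proof -
    have "cip (x t + y t) (z t) = cip (x t) (z t) + cip (y t) (z t)" for t
      by (simp add: cip_def sum_2 algebra_simps)
    then show ?thesis by (simp add: l2_space_simps infsum_add cip_summable x2 y2 z2)
  qed
next
  interpret normed_group l2_space "hnorm l2_space" by (rule l2_space_normed_group)
  have "\<exists>l\<in>L2. (\<lambda>n. hnorm l2_space (X n \<ominus>\<^sub>2 l)) \<longlonglongrightarrow> 0"
    if X: "range X \<subseteq> L2" and C: "\<forall>r>0. \<exists>K. \<forall>m\<ge>K. \<forall>n\<ge>K. hnorm l2_space (X m \<ominus>\<^sub>2 X n) < r" for X
  proof -
    have Xn: "X n \<in> L2" for n using X by auto
    have minus_closed: "v \<ominus>\<^sub>2 w \<in> L2" if "v \<in> L2" "w \<in> L2" for v w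
      using that by (simp add: a_minus_def)
    have eq: "hnorm l2_space (v \<ominus>\<^sub>2 w) = l2_norm (\<lambda>t. v t - w t)"
      if "v \<in> L2" "w \<in> L2" for v w
      using minus_closed[OF that] unfolding l2_space_minus[OF that(2)]
      by (simp add: hnorm_l2_space l2_space_simps)
    have C': "\<And>r. 0 < r \<Longrightarrow> \<exists>K. \<forall>m\<ge>K. \<forall>n\<ge>K. l2_norm (\<lambda>t. X m t - X n t) < r"
      using C by (simp add: eq Xn)
    have "l2_in (X n)" for n using Xn by (simp add: l2_space_simps)
    from l2_complete[OF this C'] obtain l where l: "l2_in l" "(\<lambda>n. l2_norm (\<lambda>t. X n t - l t)) \<longlonglongrightarrow> 0"
      "\<And>t. (\<lambda>n. X n t) \<longlonglongrightarrow> l t" by blast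
    have "l t = 0" if "t \<notin> {0..1}" for t
    proof -
      have "X n t = 0" for n using Xn[of n] that by (simp add: l2_space_simps)
      then show ?thesis using l(3)[of t] by (simp add: LIMSEQ_const_iff)
    qed
    then have lc: "l \<in> L2" using l(1) by (simp add: l2_space_simps)
    then show ?thesis using l(2) by (intro bexI[of _ l]) (simp_all add: eq Xn)
  qed
  then show "Metric_space.mcomplete L2 (norm_dist l2_space (hnorm l2_space))"
    unfolding mcomplete_iff by simp
qed

section \<open>Bounded self-adjoint operators on a Hilbert space\<close>

locale normed_hilbert_space = complex_hilbert_space H + norm: normed_group H "hnorm H"
  for H :: "'h inner_space" (structure)
begin

lemma cinner_add_right:
  "\<lbrakk>x \<in> carrier H; y \<in> carrier H; z \<in> carrier H\<rbrakk> \<Longrightarrow> cinner H x (y \<oplus> z) = cinner H x y + cinner H x z"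
  using cinner_cnj[of "y \<oplus> z" x] cinner_cnj[of y x] cinner_cnj[of z x] by (simp add: cinner_add)

lemma cinner_smult_right:
  "\<lbrakk>x \<in> carrier H; y \<in> carrier H\<rbrakk> \<Longrightarrow> cinner H x (a \<odot> y) = cnj a * cinner H x y"
  using cinner_cnj[of "a \<odot> y" x] cinner_cnj[of y x] by (simp add: cinner_smult)

lemma hnorm_smult: "x \<in> carrier H \<Longrightarrow> hnorm H (a \<odot> x) = cmod a * hnorm H x"
proof -
  assume x: "x \<in> carrier H"
  have "cinner H (a \<odot> x) (a \<odot> x) = (a * cnj a) * cinner H x x"
    using x by (simp add: cinner_smult cinner_smult_right)
  also have "a * cnj a = complex_of_real ((cmod a)\<^sup>2)"
    by (rule complex_norm_square[symmetric])
  finally have "Re (cinner H (a \<odot> x) (a \<odot> x)) = (cmod a)\<^sup>2 * Re (cinner H x x)"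
    by simp
  then show ?thesis by (simp add: hnorm_def real_sqrt_mult)
qed

abbreviation "BH \<equiv> BH_sa H"
abbreviation B_plus (infixl \<open>\<oplus>\<^sub>B\<close> 65) where "S \<oplus>\<^sub>B T \<equiv> S \<oplus>\<^bsub>BH\<^esub> T"
abbreviation B_minus (infixl \<open>\<ominus>\<^sub>B\<close> 65) where "S \<ominus>\<^sub>B T \<equiv> S \<ominus>\<^bsub>BH\<^esub> T"
abbreviation B_times (infixl \<open>\<otimes>\<^sub>B\<close> 70) where "S \<otimes>\<^sub>B T \<equiv> S \<otimes>\<^bsub>BH\<^esub> T"
abbreviation B_scale (infixl \<open>\<odot>\<^sub>B\<close> 70) where "a \<odot>\<^sub>B S \<equiv> a \<odot>\<^bsub>BH\<^esub> S"
abbreviation "SA \<equiv> bounded_sa_operators H"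

lemma BH_sa_simps:
  "carrier BH = SA"
  "\<zero>\<^bsub>BH\<^esub> = (\<lambda>x\<in>carrier H. \<zero>)"
  "S \<oplus>\<^sub>B T = (\<lambda>x\<in>carrier H. S x \<oplus> T x)"
  "a \<odot>\<^sub>B S = (\<lambda>x\<in>carrier H. complex_of_real a \<odot> S x)"
  "S \<otimes>\<^sub>B T = (\<lambda>x\<in>carrier H. complex_of_real (1/2) \<odot> (S (T x) \<oplus> T (S x)))"
  by (simp_all add: BH_sa_def)

lemma sa_operatorI:
  assumes "\<And>x. x \<in> carrier H \<Longrightarrow> S x \<in> carrier H"
    and "\<And>x y. \<lbrakk>x \<in> carrier H; y \<in> carrier H\<rbrakk> \<Longrightarrow> S (x \<oplus> y) = S x \<oplus> S y"
    and "\<And>a x. x \<in> carrier H \<Longrightarrow> S (a \<odot> x) = a \<odot> S x"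
    and "S \<in> extensional (carrier H)"
    and "\<And>x. x \<in> carrier H \<Longrightarrow> hnorm H (S x) \<le> K * hnorm H x"
    and "\<And>x y. \<lbrakk>x \<in> carrier H; y \<in> carrier H\<rbrakk> \<Longrightarrow> cinner H (S x) y = cinner H x (S y)"
  shows "S \<in> SA"
  unfolding bounded_sa_operators_def linear_maps_def mem_Collect_eq
  using assms(4) by (intro conjI ballI allI funcsetI exI[of _ K]; (simp only: assms(1-3,5,6))?)

lemma sa_operatorD:
  assumes "S \<in> SA"
  shows "x \<in> carrier H \<Longrightarrow> S x \<in> carrier H"
    "x \<in> carrier H \<Longrightarrow> y \<in> carrier H \<Longrightarrow> S (x \<oplus> y) = S x \<oplus> S y"
    "x \<in> carrier H \<Longrightarrow> S (a \<odot> x) = a \<odot> S x"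
    "S \<in> extensional (carrier H)"
    "x \<in> carrier H \<Longrightarrow> y \<in> carrier H \<Longrightarrow> cinner H (S x) y = cinner H x (S y)"
  using assms by (auto simp: bounded_sa_operators_def linear_maps_def)

lemma sa_operator_bounded:
  assumes "S \<in> SA"
  obtains K where "0 \<le> K" "\<And>x. x \<in> carrier H \<Longrightarrow> hnorm H (S x) \<le> K * hnorm H x"
proof -
  obtain K where K: "\<forall>x\<in>carrier H. hnorm H (S x) \<le> K * hnorm H x"
    using assms by (auto simp: bounded_sa_operators_def)
  have "hnorm H (S x) \<le> \<bar>K\<bar> * hnorm H x" if "x \<in> carrier H" for x
  proof -
    have "K * hnorm H x \<le> \<bar>K\<bar> * hnorm H x"
      using norm.N_ge_0[OF that] by (intro mult_right_mono) auto
    then show ?thesis using K that by force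
  qed
  then show ?thesis by (intro that[of "\<bar>K\<bar>"]) auto
qed

lemma sa_operator_eqI:
  assumes "S \<in> SA" "T \<in> SA" "\<And>x. x \<in> carrier H \<Longrightarrow> S x = T x"
  shows "S = T"
  using sa_operatorD(4)[OF assms(1)] sa_operatorD(4)[OF assms(2)] assms(3) by (rule extensionalityI)

lemma hnorm_zero: "hnorm H \<zero> = 0"
  using norm.N_eq_0 by blast

lemma BH_add_closed:
  assumes "S \<in> SA" "T \<in> SA"
  shows "(\<lambda>x\<in>carrier H. S x \<oplus> T x) \<in> SA"
proof -
  obtain K where K: "\<And>x. x \<in> carrier H \<Longrightarrow> hnorm H (S x) \<le> K * hnorm H x"
    using sa_operator_bounded[OF assms(1)] by blast
  obtain L where L: "\<And>x. x \<in> carrier H \<Longrightarrow> hnorm H (T x) \<le> L * hnorm H x"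
    using sa_operator_bounded[OF assms(2)] by blast
  note D = sa_operatorD[OF assms(1)] sa_operatorD[OF assms(2)]
  let ?S = "\<lambda>x\<in>carrier H. S x \<oplus> T x"
  show ?thesis
  proof (rule sa_operatorI[where K = "K + L"])
    fix x assume x: "x \<in> carrier H"
    show "hnorm H (?S x) \<le> (K + L) * hnorm H x"
      using norm.N_triangle[of "S x" "T x"] K[OF x] L[OF x] x by (simp add: D distrib_right)
    show "?S (a \<odot> x) = a \<odot> ?S x" for a
      using x by (simp add: D smult_r_distr)
    fix y assume y: "y \<in> carrier H"
    show "?S (x \<oplus> y) = ?S x \<oplus> ?S y"
      using x y by (simp add: D M.a_ac)
    show "cinner H (?S x) y = cinner H x (?S y)"
      using x y by (simp add: D cinner_add cinner_add_right)
  qed (simp_all add: D)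
qed

lemma BH_smult_closed:
  assumes "S \<in> SA"
  shows "(\<lambda>x\<in>carrier H. complex_of_real a \<odot> S x) \<in> SA"
proof -
  obtain K where K: "\<And>x. x \<in> carrier H \<Longrightarrow> hnorm H (S x) \<le> K * hnorm H x"
    using sa_operator_bounded[OF assms(1)] by blast
  note D = sa_operatorD[OF assms(1)]
  let ?S = "\<lambda>x\<in>carrier H. complex_of_real a \<odot> S x"
  show ?thesis
  proof (rule sa_operatorI[where K = "\<bar>a\<bar> * K"])
    fix x assume x: "x \<in> carrier H"
    show "hnorm H (?S x) \<le> (\<bar>a\<bar> * K) * hnorm H x"
      using mult_left_mono[OF K[OF x], of "\<bar>a\<bar>"] x by (simp add: D hnorm_smult mult.assoc)
    show "?S (b \<odot> x) = b \<odot> ?S x" for b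
      using x smult_assoc1[of "complex_of_real a" b "S x"] smult_assoc1[of b "complex_of_real a" "S x"]
      by (simp add: D mult.commute)
    fix y assume y: "y \<in> carrier H"
    show "?S (x \<oplus> y) =
      ?S x \<oplus> ?S y"
      using x y by (simp add: D smult_r_distr)
    show "cinner H (?S x) y = cinner H x (?S y)"
      using x y by (simp add: D cinner_smult cinner_smult_right)
  qed (simp_all add: D)
qed

lemma BH_zero_closed: "(\<lambda>x\<in>carrier H. \<zero>) \<in> SA"
proof (rule sa_operatorI[where K = 0])
  fix x assume x: "x \<in> carrier H"
  show "hnorm H ((\<lambda>x\<in>carrier H. \<zero>) x) \<le> 0 * hnorm H x"
    using x by (simp add: hnorm_zero)
  show "(\<lambda>x\<in>carrier H. \<zero>) (a \<odot> x) = a \<odot> (\<lambda>x\<in>carrier H. \<zero>) x" for a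
    using x by simp
  fix y assume y: "y \<in> carrier H"
  show "cinner H ((\<lambda>x\<in>carrier H. \<zero>) x) y = cinner H x ((\<lambda>x\<in>carrier H. \<zero>) y)"
    using x y cinner_smult[of "\<zero>" y 0] cinner_smult_right[of x "\<zero>" 0] by simp
qed simp_all

lemma BH_module: "Module.module scalar_ring BH"
proof (rule module_scalar_ringI)
  note cl = BH_add_closed BH_smult_closed BH_zero_closed
  note sm = smult_l_distr[simplified] smult_r_distr[simplified] smult_assoc1[simplified] smult_one[simplified]
  show "abelian_group BH"
  proof (rule abelian_groupI, unfold BH_sa_simps)
    fix S T U
    assume S: "S \<in> SA"
    show "\<exists>T\<in>SA. (\<lambda>x\<in>carrier H. T x \<oplus> S x) = (\<lambda>x\<in>carrier H. \<zero>)"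
    proof (rule bexI[OF _ BH_smult_closed[OF S, of "-1"]], rule restrict_ext)
      fix x assume "x \<in> carrier H"
      then show "(\<lambda>x\<in>carrier H. complex_of_real (- 1) \<odot> S x) x \<oplus> S x = \<zero>"
        using sm(1)[of "S x" "-1" 1] sm(4)[of "S x"] smult_l_null[simplified, of "S x"] by (simp add: sa_operatorD[OF S])
    qed
    show "(\<lambda>x\<in>carrier H. (\<lambda>x\<in>carrier H. \<zero>) x \<oplus> S x) = S"
      by (rule sa_operator_eqI[OF BH_add_closed[OF BH_zero_closed S] S]) (simp add: sa_operatorD[OF S])
    assume T: "T \<in> SA"
    show "(\<lambda>x\<in>carrier H. S x \<oplus> T x) = (\<lambda>x\<in>carrier H. T x \<oplus> S x)"
      by (rule restrict_ext) (simp add: sa_operatorD[OF S] sa_operatorD[OF T] M.a_comm)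
    assume U: "U \<in> SA"
    show "(\<lambda>x\<in>carrier H. (\<lambda>x\<in>carrier H. S x \<oplus> T x) x \<oplus> U x) = (\<lambda>x\<in>carrier H. S x \<oplus> (\<lambda>x\<in>carrier H. T x \<oplus> U x) x)"
      by (rule restrict_ext) (simp add: sa_operatorD[OF S] sa_operatorD[OF T] sa_operatorD[OF U] M.a_assoc)
  qed (rule cl; assumption)+
  show "a \<odot>\<^sub>B S \<in> carrier BH" if "S \<in> carrier BH" for a S
    using that by (simp add: BH_sa_simps cl)
  show "(a + b) \<odot>\<^sub>B S = a \<odot>\<^sub>B S \<oplus>\<^sub>B b \<odot>\<^sub>B S"
    and "(a * b) \<odot>\<^sub>B S = a \<odot>\<^sub>B (b \<odot>\<^sub>B S)"
    and "1 \<odot>\<^sub>B S = S"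
    and "a \<odot>\<^sub>B (S \<oplus>\<^sub>B T) = a \<odot>\<^sub>B S \<oplus>\<^sub>B a \<odot>\<^sub>B T"
    if ST: "S \<in> carrier BH" "T \<in> carrier BH" for a b S T
  proof -
    have S: "S \<in> SA" and T: "T \<in> SA" using ST by (simp_all add: BH_sa_simps)
    note D = sa_operatorD(1)[OF S] sa_operatorD(1)[OF T]
    show "(a + b) \<odot>\<^sub>B S = a \<odot>\<^sub>B S \<oplus>\<^sub>B b \<odot>\<^sub>B S"
      unfolding BH_sa_simps by (rule restrict_ext) (simp add: D sm)
    show "(a * b) \<odot>\<^sub>B S = a \<odot>\<^sub>B (b \<odot>\<^sub>B S)"
      unfolding BH_sa_simps by (rule restrict_ext) (simp add: D sm)
    show "a \<odot>\<^sub>B (S \<oplus>\<^sub>B T) = a \<odot>\<^sub>B S \<oplus>\<^sub>B a \<odot>\<^sub>B T"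
      unfolding BH_sa_simps by (rule restrict_ext) (simp add: D sm)
    show "1 \<odot>\<^sub>B S = S"
      unfolding BH_sa_simps by (rule sa_operator_eqI[OF BH_smult_closed[OF S] S]) (simp add: D sm)
  qed
qed

lemma BH_nrm: "nrm BH S = Sup {hnorm H (S x) | x. x \<in> carrier H \<and> hnorm H x \<le> 1}"
  by (simp add: BH_sa_def)

lemma BH_nrm_upper:
  assumes "S \<in> SA" "x \<in> carrier H" "hnorm H x \<le> 1"
  shows "hnorm H (S x) \<le> nrm BH S"
  unfolding BH_nrm
proof (rule cSup_upper)
  obtain K where K: "0 \<le> K" "\<And>x. x \<in> carrier H \<Longrightarrow> hnorm H (S x) \<le> K * hnorm H x"
    using sa_operator_bounded[OF assms(1)] by blast
  have "hnorm H (S x) \<le> K" if "x \<in> carrier H" "hnorm H x \<le> 1" for x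
    using K(2)[OF that(1)] mult_left_mono[OF that(2) K(1)] by simp
  then show "bdd_above {hnorm H (S x) |x. x \<in> carrier H \<and> hnorm H x \<le> 1}"
    by (intro bdd_aboveI[of _ K]) auto
qed (use assms in auto)

lemma BH_nrm_least:
  assumes "\<And>x. x \<in> carrier H \<Longrightarrow> hnorm H x \<le> 1 \<Longrightarrow> hnorm H (S x) \<le> B"
  shows "nrm BH S \<le> B"
  unfolding BH_nrm
proof (rule cSup_least)
  \<comment> \<open>The zero vector keeps the set under the supremum nonempty, even on the zero
    space.\<close>
  have "\<zero> \<in> carrier H" "hnorm H \<zero> \<le> 1" by (simp_all add: hnorm_zero)
  then show "{hnorm H (S x) |x. x \<in> carrier H \<and> hnorm H x \<le> 1} \<noteq> {}" by blast
qed (use assms in auto)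

lemma BH_nrm_bound:
  assumes S: "S \<in> SA" and x: "x \<in> carrier H"
  shows "hnorm H (S x) \<le> nrm BH S * hnorm H x"
proof (cases "hnorm H x = 0")
  case True
  then have "x = \<zero>" using norm.N_eq_0[OF x] by simp
  then have "S x = 0 \<odot> S x" using sa_operatorD(3)[OF S x, of 0] x by simp
  also have "\<dots> = \<zero>" using sa_operatorD(1)[OF S x] smult_l_null by simp
  finally show ?thesis using True by (simp add: hnorm_zero)
next
  case False
  define r where "r = hnorm H x"
  have r: "0 < r" using False norm.N_ge_0[OF x] by (simp add: r_def)
  have "hnorm H (S (complex_of_real (1 / r) \<odot> x)) \<le> nrm BH S"
    using x r by (intro BH_nrm_upper S) (simp_all add: hnorm_smult norm_divide flip: r_def)
  then have "hnorm H (S x) / r \<le> nrm BH S"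
    using r by (simp add: sa_operatorD[OF S] hnorm_smult x norm_divide)
  then show ?thesis using r by (simp add: pos_divide_le_eq flip: r_def)
qed

lemma BH_normed_group: "normed_group BH (nrm BH)"
proof -
  interpret B: Module.module scalar_ring BH by (rule BH_module)
  show ?thesis
  proof (intro normed_group.intro[OF B.abelian_group_axioms] normed_group_axioms.intro)
    fix S assume "S \<in> carrier BH"
    then have S: "S \<in> SA" by (simp add: BH_sa_simps)
    have z: "\<zero> \<in> carrier H" "hnorm H \<zero> \<le> 1" by (simp_all add: hnorm_zero)
    show "0 \<le> nrm BH S"
      using BH_nrm_upper[OF S z] norm.N_ge_0[OF sa_operatorD(1)[OF S z(1)]] by linarith
    show "nrm BH S = 0 \<longleftrightarrow> S = \<zero>\<^bsub>BH\<^esub>"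
    proof
      assume 0: "nrm BH S = 0"
      show "S = \<zero>\<^bsub>BH\<^esub>"
        unfolding BH_sa_simps
      proof (rule sa_operator_eqI[OF S BH_zero_closed])
        fix x assume x: "x \<in> carrier H"
        have "hnorm H (S x) = 0"
          using BH_nrm_bound[OF S x] norm.N_ge_0[OF sa_operatorD(1)[OF S x]] 0 by simp
        then show "S x = (\<lambda>x\<in>carrier H. \<zero>) x"
          using norm.N_eq_0[OF sa_operatorD(1)[OF S x]] x by simp
      qed
    next
      assume "S = \<zero>\<^bsub>BH\<^esub>"
      then have "nrm BH S \<le> 0"
        by (intro BH_nrm_least) (simp add: BH_sa_simps hnorm_zero)
      then show "nrm BH S = 0" using \<open>0 \<le> nrm BH S\<close> by simp
    qed
    have "hnorm H ((\<ominus>\<^bsub>BH\<^esub> S) x) = hnorm H (S x)" if "x \<in> carrier H" for x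
      using that S by (simp add: uminus_eq_smult[OF BH_module] BH_sa_simps hnorm_smult sa_operatorD)
    then have "{hnorm H ((\<ominus>\<^bsub>BH\<^esub> S) x) |x. x \<in> carrier H \<and> hnorm H x \<le> 1} =
      {hnorm H (S x) |x. x \<in> carrier H \<and> hnorm H x \<le> 1}"
      by (intro Collect_cong ex_cong1) auto
    then show "nrm BH (\<ominus>\<^bsub>BH\<^esub> S) = nrm BH S"
      by (simp add: BH_nrm)
    fix T assume "T \<in> carrier BH"
    then have T: "T \<in> SA" by (simp add: BH_sa_simps)
    show "nrm BH (S \<oplus>\<^sub>B T) \<le> nrm BH S + nrm BH T"
    proof (rule BH_nrm_least)
      fix x assume x: "x \<in> carrier H" "hnorm H x \<le> 1"
      show "hnorm H ((S \<oplus>\<^sub>B T) x) \<le> nrm BH S + nrm BH T"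
        using norm.N_triangle[OF sa_operatorD(1)[OF S x(1)] sa_operatorD(1)[OF T x(1)]]
          BH_nrm_upper[OF S x] BH_nrm_upper[OF T x] by (simp add: BH_sa_simps x)
    qed
  qed
qed

text \<open>Closedness comes from the completeness of \<open>A\<close>: when images converge, their
  preimages are Cauchy by the isometry, and the limit of the preimages is mapped to the limit of the
  images.\<close>

lemma isometric_image_norm_closed:
  fixes A :: "'a normed_alg"
  assumes A: "jb_algebra A"
    and hom: "\<psi> \<in> jordan_hom A BH"
    and iso: "\<And>x. x \<in> carrier A \<Longrightarrow> nrm BH (\<psi> x) = nrm A x"
  shows "norm_closed_jordan_subalgebra (\<psi> ` carrier A) BH"
    "\<psi> \<in> jordan_iso A (BH\<lparr>carrier := \<psi> ` carrier A\<rparr>)"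
proof -
  interpret A: jb_algebra A by (rule A)
  interpret NA: normed_group A "nrm A" by (rule A.normed_group)
  interpret B: Module.module scalar_ring BH by (rule BH_module)
  interpret NB: normed_group BH "nrm BH" by (rule BH_normed_group)
  have closed: "\<psi> x \<in> carrier BH" if "x \<in> carrier A" for x
    using hom that by (auto simp: jordan_hom_def linear_maps_def)
  have add: "\<psi> (x \<oplus>\<^bsub>A\<^esub> y) = \<psi> x \<oplus>\<^sub>B \<psi> y" and mult: "\<psi> (x \<otimes>\<^bsub>A\<^esub> y) = \<psi> x \<otimes>\<^sub>B \<psi> y"
    if "x \<in> carrier A" "y \<in> carrier A" for x y
    using hom that by (auto simp: jordan_hom_def linear_maps_def)
  have smult: "\<psi> (a \<odot>\<^bsub>A\<^esub> x) = a \<odot>\<^sub>B \<psi> x" if "x \<in> carrier A" for a x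
    using hom that by (auto simp: jordan_hom_def linear_maps_def)
  have minus: "\<psi> (\<ominus>\<^bsub>A\<^esub> x) = \<ominus>\<^bsub>BH\<^esub> \<psi> x" if "x \<in> carrier A" for x
    by (simp add: uminus_eq_smult[OF A.module_axioms that] uminus_eq_smult[OF BH_module closed[OF that]] smult that)
  have diff: "\<psi> (x \<ominus>\<^bsub>A\<^esub> y) = \<psi> x \<ominus>\<^sub>B \<psi> y" if "x \<in> carrier A" "y \<in> carrier A" for x y
    using that by (simp add: a_minus_def add minus)
  have A_diff_closed: "x \<ominus>\<^bsub>A\<^esub> y \<in> carrier A" if "x \<in> carrier A" "y \<in> carrier A" for x y
    using that by (simp add: a_minus_def)
  have nrm_diff: "nrm BH (\<psi> x \<ominus>\<^sub>B \<psi> y) = nrm A (x \<ominus>\<^bsub>A\<^esub> y)"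
    if "x \<in> carrier A" "y \<in> carrier A" for x y
    using iso[OF A_diff_closed[OF that]] diff[OF that] by simp
  have inj: "inj_on \<psi> (carrier A)"
  proof (rule inj_onI)
    fix x y assume xy: "x \<in> carrier A" "y \<in> carrier A" "\<psi> x = \<psi> y"
    have "nrm BH (\<psi> x \<ominus>\<^sub>B \<psi> y) = 0"
      using NB.minus_eq_0_iff[OF closed closed, OF xy(1,2)] xy(3) NB.N_eq_0[OF B.zero_closed] by simp
    then have "nrm A (x \<ominus>\<^bsub>A\<^esub> y) = 0" using nrm_diff[OF xy(1,2)] by simp
    then show "x = y"
      using NA.N_eq_0[OF A_diff_closed[OF xy(1,2)]] NA.minus_eq_0_iff[OF xy(1,2)] by simp
  qed
  have sub: "submodule (\<psi> ` carrier A) scalar_ring BH"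
  proof (rule B.submoduleI)
    have "\<psi> \<zero>\<^bsub>A\<^esub> = \<zero>\<^bsub>BH\<^esub>"
      using iso[OF A.zero_closed] NA.N_eq_0[OF A.zero_closed] NB.N_eq_0[OF closed[OF A.zero_closed]] by simp
    then show "\<zero>\<^bsub>BH\<^esub> \<in> \<psi> ` carrier A" by (metis A.zero_closed imageI)
    show "\<psi> ` carrier A \<subseteq> carrier BH" using closed by blast
    show "\<ominus>\<^bsub>BH\<^esub> S \<in> \<psi> ` carrier A" if S: "S \<in> \<psi> ` carrier A" for S
    proof -
      obtain x where "x \<in> carrier A" "S = \<psi> x" using S by blast
      then show ?thesis by (intro image_eqI[of _ _ "\<ominus>\<^bsub>A\<^esub> x"]) (simp_all add: minus)
    qed
    show "S \<oplus>\<^sub>B T \<in> \<psi> ` carrier A" if S: "S \<in> \<psi> ` carrier A" and T: "T \<in> \<psi> ` carrier A" for S T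
    proof -
      obtain x where "x \<in> carrier A" "S = \<psi> x" using S by blast
      moreover obtain y where "y \<in> carrier A" "T = \<psi> y" using T by blast
      ultimately show ?thesis by (intro image_eqI[of _ _ "x \<oplus>\<^bsub>A\<^esub> y"]) (simp_all add: add)
    qed
    show "a \<odot>\<^sub>B S \<in> \<psi> ` carrier A" if S: "S \<in> \<psi> ` carrier A" for a S
    proof -
      obtain x where "x \<in> carrier A" "S = \<psi> x" using S by blast
      then show ?thesis by (intro image_eqI[of _ _ "a \<odot>\<^bsub>A\<^esub> x"]) (simp_all add: smult)
    qed
  qed
  let ?T = "Metric_space.mtopology (carrier BH) (norm_dist BH (nrm BH))"
  have "closedin ?T (\<psi> ` carrier A)"
    unfolding Metric_space.metric_closedin_iff_sequentially_closed[OF NB.metric]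
  proof (intro conjI allI impI)
    show "\<psi> ` carrier A \<subseteq> carrier BH" using closed by blast
    fix \<sigma> S
    assume a: "range \<sigma> \<subseteq> \<psi> ` carrier A \<and> limitin ?T \<sigma> S sequentially"
    have "\<forall>n. \<exists>x. x \<in> carrier A \<and> \<sigma> n = \<psi> x" using a by blast
    from choice[OF this] obtain X where X: "\<forall>n. X n \<in> carrier A \<and> \<sigma> n = \<psi> (X n)" ..
    then have X1: "X n \<in> carrier A" and X2: "\<sigma> n = \<psi> (X n)" for n by blast+
    have range: "range \<sigma> \<subseteq> carrier BH" using closed X1 X2 by auto
    from a have lim0: "limitin ?T \<sigma> S sequentially" ..
    then have S: "S \<in> carrier BH" and lim: "(\<lambda>n. nrm BH (\<sigma> n \<ominus>\<^sub>B S)) \<longlonglongrightarrow> 0"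
      using NB.limitin_iff[OF range] by simp_all
    have BS: "\<sigma> n \<ominus>\<^sub>B S \<in> carrier BH" for n
      using S closed[OF X1] by (simp add: a_minus_def X2)
    have "\<exists>K. \<forall>m\<ge>K. \<forall>n\<ge>K. nrm A (X m \<ominus>\<^bsub>A\<^esub> X n) < r" if r: "0 < r" for r
    proof -
      obtain K where K: "\<And>n. n \<ge> K \<Longrightarrow> nrm BH (\<sigma> n \<ominus>\<^sub>B S) < r / 2"
        using order_tendstoD(2)[OF lim, of "r / 2"] r by (auto simp: eventually_sequentially)
      have "nrm A (X m \<ominus>\<^bsub>A\<^esub> X n) < r" if mn: "K \<le> m" "K \<le> n" for m n
      proof -
        have "nrm A (X m \<ominus>\<^bsub>A\<^esub> X n) = nrm BH (\<sigma> m \<ominus>\<^sub>B \<sigma> n)"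
          using nrm_diff[OF X1 X1] by (simp add: X2)
        also have "\<sigma> m \<ominus>\<^sub>B \<sigma> n = (\<sigma> m \<ominus>\<^sub>B S) \<oplus>\<^sub>B (S \<ominus>\<^sub>B \<sigma> n)"
          using closed[OF X1] S by (intro NB.minus_telescope) (simp_all add: X2)
        also have "S \<ominus>\<^sub>B \<sigma> n = \<ominus>\<^bsub>BH\<^esub> (\<sigma> n \<ominus>\<^sub>B S)"
          using closed[OF X1] S by (intro NB.minus_swap[symmetric]) (simp_all add: X2)
        also have "nrm BH ((\<sigma> m \<ominus>\<^sub>B S) \<oplus>\<^sub>B \<ominus>\<^bsub>BH\<^esub> (\<sigma> n \<ominus>\<^sub>B S))
            \<le> nrm BH (\<sigma> m \<ominus>\<^sub>B S) + nrm BH (\<ominus>\<^bsub>BH\<^esub> (\<sigma> n \<ominus>\<^sub>B S))"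
          by (rule NB.N_triangle[OF BS B.a_inv_closed[OF BS]])
        also have "\<dots> < r"
          using K[OF mn(1)] K[OF mn(2)] unfolding NB.N_uminus[OF BS] by linarith
        finally show ?thesis .
      qed
      then show ?thesis by blast
    qed
    moreover have "range X \<subseteq> carrier A" using X1 by blast
    ultimately obtain x where x: "x \<in> carrier A" "(\<lambda>n. nrm A (X n \<ominus>\<^bsub>A\<^esub> x)) \<longlonglongrightarrow> 0"
      using A.complete[unfolded NA.mcomplete_iff, rule_format, of X] by auto
    have "(\<lambda>n. nrm BH (\<sigma> n \<ominus>\<^sub>B \<psi> x)) \<longlonglongrightarrow> 0"
      using x(2) by (simp add: X2 nrm_diff X1 x(1))
    then have "limitin ?T \<sigma> (\<psi> x) sequentially"
      using NB.limitin_iff[OF range] closed[OF x(1)] by simp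
    then have "S = \<psi> x"
      by (rule Metric_space.limitin_metric_unique[OF NB.metric lim0]) simp
    then show "S \<in> \<psi> ` carrier A" using x(1) by simp
  qed
  moreover have "\<forall>S\<in>\<psi> ` carrier A. \<forall>T\<in>\<psi> ` carrier A. S \<otimes>\<^sub>B T \<in> \<psi> ` carrier A"
  proof (intro ballI)
    fix S T assume S: "S \<in> \<psi> ` carrier A" and T: "T \<in> \<psi> ` carrier A"
    obtain x where "x \<in> carrier A" "S = \<psi> x" using S by blast
    moreover obtain y where "y \<in> carrier A" "T = \<psi> y" using T by blast
    ultimately show "S \<otimes>\<^sub>B T \<in> \<psi> ` carrier A"
      by (intro image_eqI[of _ _ "x \<otimes>\<^bsub>A\<^esub> y"]) (simp_all add: mult A.jprod_closed)
  qed
  ultimately show "norm_closed_jordan_subalgebra (\<psi> ` carrier A) BH"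
    using sub by (simp add: norm_closed_jordan_subalgebra_def)
  show "\<psi> \<in> jordan_iso A (BH\<lparr>carrier := \<psi> ` carrier A\<rparr>)"
    using inj by (auto simp: jordan_iso_def jordan_hom_def linear_maps_def bij_betw_def add mult smult)
qed

end

section \<open>Matrix functions as multiplication operators\<close>

definition cmul :: "real^2^2 \<Rightarrow> complex^2 \<Rightarrow> complex^2" where
  "cmul M x = (\<chi> i. \<Sum>j\<in>UNIV. complex_of_real (M $ i $ j) * x $ j)"

lemma cmul_nth: "cmul M x $ i = of_real (M $ i $ 1) * x $ 1 + of_real (M $ i $ 2) * x $ 2"
  by (simp add: cmul_def sum_2)

lemma cmul_simps:
  "cmul (A + B) x = cmul A x + cmul B x" "cmul (r *\<^sub>R A) x = complex_of_real r *s cmul A x"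
  "cmul (A ** B) x = cmul A (cmul B x)" "cmul A (x + y) = cmul A x + cmul A y" "cmul A (a *s x) = a *s cmul A x"
  "cmul A 0 = 0"
  by (simp_all add: vec_eq_iff forall_2 cmul_nth matrix_matrix_mult_def sum_2 algebra_simps)

lemma cip_cmul: "transpose M = M \<Longrightarrow> cip (cmul M x) y = cip x (cmul M y)"
  by (drule symmetric_eq_sym2, erule ssubst) (simp add: cip_def sum_2 cmul_nth algebra_simps)

text \<open>A real matrix acts separately on real and imaginary parts, so passing to complex vectors
  does not increase its norm.\<close>

lemma norm_cmul_le: "norm (cmul M x) \<le> opn M * norm x"
proof -
  define u where "u = (\<chi> i. Re (x $ i))"
  define v where "v = (\<chi> i. Im (x $ i))"
  have split: "(norm z)\<^sup>2 = (norm (\<chi> i. Re (z $ i)))\<^sup>2 + (norm (\<chi> i. Im (z $ i)))\<^sup>2" for z :: "complex^2"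
    by (simp add: norm_vec2 cmod_power2)
  have Re: "(\<chi> i. Re (cmul M x $ i)) = M *v u" and Im: "(\<chi> i. Im (cmul M x $ i)) = M *v v"
    by (simp_all add: vec_eq_iff cmul_nth matrix_vector_mult_def sum_2 u_def v_def)
  have "(norm (cmul M x))\<^sup>2 = (norm (M *v u))\<^sup>2 + (norm (M *v v))\<^sup>2"
    unfolding split[of "cmul M x"] Re Im ..
  also have "\<dots> \<le> (opn M * norm u)\<^sup>2 + (opn M * norm v)\<^sup>2"
    by (intro add_mono power_mono opn_bound norm_ge_zero)
  also have "\<dots> = (opn M * norm x)\<^sup>2"
    unfolding power_mult_distrib split[of x] u_def v_def by (simp add: distrib_left)
  finally show ?thesis
    by (rule power2_le_imp_le) (simp add: opn_nonneg)
qed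

definition cvec :: "real^2 \<Rightarrow> complex^2" where
  "cvec x = (\<chi> i. complex_of_real (x $ i))"

lemma norm_cvec: "norm (cvec x) = norm x"
proof -
  have "(norm (cvec x))\<^sup>2 = (norm x)\<^sup>2" by (simp add: norm_vec2 cvec_def)
  then show ?thesis by (simp add: power2_eq_iff_nonneg)
qed

lemma cmul_cvec: "cmul M (cvec x) = cvec (M *v x)"
  by (simp add: vec_eq_iff cmul_nth cvec_def matrix_vector_mult_def sum_2)

definition J_op :: "(real \<Rightarrow> real^2^2) \<Rightarrow> (real \<Rightarrow> complex^2) \<Rightarrow> real \<Rightarrow> complex^2" where
  "J_op f = (\<lambda>v\<in>L2. \<lambda>t. cmul (f t) (v t))"

lemma J_op_apply: "v \<in> L2 \<Longrightarrow> J_op f v = (\<lambda>t. cmul (f t) (v t))"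
  by (simp add: J_op_def)

lemma norm_cmul_J_le:
  assumes "f \<in> J" "v \<in> L2"
  shows "norm (cmul (f t) (v t)) \<le> nrm J_alg f * norm (v t)"
proof (cases "t \<in> {0..1}")
  case True
  have "norm (cmul (f t) (v t)) \<le> opn (f t) * norm (v t)" by (rule norm_cmul_le)
  also have "\<dots> \<le> nrm J_alg f * norm (v t)"
    using True by (intro mult_right_mono J_nrm_upper assms) auto
  finally show ?thesis .
next
  case False
  then have "v t = 0" using assms(2) by (simp add: l2_space_simps)
  then show ?thesis by (simp add: cmul_simps)
qed

lemma J_nrm_nonneg: "f \<in> J \<Longrightarrow> 0 \<le> nrm J_alg f"
  by (rule jb_algebra.nrm_nonneg[OF unital_jb_algebra.axioms(1)[OF J_unital_jb_algebra]])

lemma J_op_closed: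
  assumes f: "f \<in> J" and v: "v \<in> L2"
  shows "J_op f v \<in> L2" "hnorm l2_space (J_op f v) \<le> nrm J_alg f * hnorm l2_space v"
proof -
  have v2: "l2_in v" using v by (simp add: l2_space_simps)
  note l2 = l2_mono[OF v2 J_nrm_nonneg[OF f] norm_cmul_J_le[OF f v]]
  show "J_op f v \<in> L2"
    using v l2(1) by (simp add: J_op_apply l2_space_simps cmul_simps)
  show "hnorm l2_space (J_op f v) \<le> nrm J_alg f * hnorm l2_space v"
    using l2 v2 by (simp add: J_op_apply v hnorm_l2_space)
qed

interpretation l2: normed_hilbert_space l2_space
  by (intro normed_hilbert_space.intro l2_space_hilbert l2_space_normed_group)

lemma J_op_sa:
  assumes f: "f \<in> J"
  shows "J_op f \<in> bounded_sa_operators l2_space"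
proof (rule l2.sa_operatorI[where K = "nrm J_alg f"])
  fix x assume x: "x \<in> L2"
  show "J_op f x \<in> L2" "hnorm l2_space (J_op f x) \<le> nrm J_alg f * hnorm l2_space x"
    using J_op_closed[OF f x] by simp_all
  have "a \<odot>\<^sub>2 x \<in> L2" for a
    using x by simp
  then show "J_op f (a \<odot>\<^sub>2 x) = a \<odot>\<^sub>2 J_op f x" for a
    unfolding J_op_apply[OF x] by (simp only: J_op_apply) (simp only: l2_space_simps cmul_simps)
  fix y assume y: "y \<in> L2"
  have "x \<oplus>\<^sub>2 y \<in> L2" using x y by simp
  then show "J_op f (x \<oplus>\<^sub>2 y) = J_op f x \<oplus>\<^sub>2 J_op f y"
    unfolding J_op_apply[OF x] J_op_apply[OF y] by (simp only: J_op_apply) (simp only: l2_space_simps cmul_simps)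
  have "cip (cmul (f t) (x t)) (y t) = cip (x t) (cmul (f t) (y t))" for t
  proof (cases "t \<in> {0..1}")
    case True
    then show ?thesis using J_symmetric[OF f] by (intro cip_cmul) auto
  next
    case False
    then have "x t = 0" "y t = 0" using x y by (simp_all add: l2_space_simps)
    then show ?thesis by (simp add: cmul_simps cip_def)
  qed
  then show "cinner l2_space (J_op f x) y = cinner l2_space x (J_op f y)"
    by (simp only: J_op_apply[OF x] J_op_apply[OF y] l2_space_simps)
qed (simp add: J_op_def)

text \<open>For the lower bound a real vector is placed at a single point t; on it
  \<open>J_op f\<close> acts as the matrix \<open>f t\<close>.\<close>

lemma J_op_nrm:
  assumes f: "f \<in> J"
  shows "nrm (BH_sa l2_space) (J_op f) = nrm J_alg f"
proof (rule order_antisym)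
  show "nrm (BH_sa l2_space) (J_op f) \<le> nrm J_alg f"
  proof (rule l2.BH_nrm_least)
    fix v assume v: "v \<in> L2" "hnorm l2_space v \<le> 1"
    show "hnorm l2_space (J_op f v) \<le> nrm J_alg f"
      using J_op_closed(2)[OF f v(1)] mult_left_mono[OF v(2) J_nrm_nonneg[OF f]] by simp
  qed
  show "nrm J_alg f \<le> nrm (BH_sa l2_space) (J_op f)"
  proof (rule J_nrm_least, rule onorm_le)
    fix t :: real and x :: "real^2" assume t: "0 \<le> t" "t \<le> 1"
    have single: "l2_in (\<lambda>s. if s = t then z else 0) \<and> l2_norm (\<lambda>s. if s = t then z else 0) = norm z" for z :: "complex^2"
    proof -
      have "((\<lambda>s. (norm (if s = t then z else 0))\<^sup>2) has_sum (norm z)\<^sup>2) UNIV"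
        by (rule has_sum_finite_neutralI[of "{t}"]) auto
      then show ?thesis
        unfolding l2_in_def l2_norm_def summable_on_def by (auto simp: infsumI)
    qed
    define v where "v = (\<lambda>s. if s = t then cvec x else 0)"
    have v: "v \<in> L2"
      using single[of "cvec x"] t by (auto simp: l2_space_simps v_def)
    have Jv: "J_op f v = (\<lambda>s. if s = t then cvec (f t *v x) else 0)"
      unfolding J_op_apply[OF v] by (auto simp: v_def cmul_cvec cmul_simps)
    have "hnorm l2_space (J_op f v) \<le> nrm (BH_sa l2_space) (J_op f) * hnorm l2_space v"
      by (rule l2.BH_nrm_bound[OF J_op_sa[OF f] v])
    moreover have "hnorm l2_space (J_op f v) = norm (f t *v x)"
      unfolding Jv using single by (simp add: hnorm_l2_space norm_cvec)
    moreover have "hnorm l2_space v = norm x"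
      unfolding v_def using single by (simp add: hnorm_l2_space norm_cvec)
    ultimately show "norm (f t *v x) \<le> nrm (BH_sa l2_space) (J_op f) * norm x" by simp
  qed
qed

text \<open>Outside [0,1] the operations of \<open>J_alg\<close> return the unspecified value of
  \<open>restrict\<close>; the identities hold there because \<open>v t = 0\<close>.\<close>

lemma cmul_J_ops:
  assumes v: "v \<in> L2"
  shows "cmul ((f \<oplus>\<^sub>J g) t) (v t) = cmul (f t) (v t) + cmul (g t) (v t)"
    "cmul ((r \<odot>\<^sub>J f) t) (v t) = complex_of_real r *s cmul (f t) (v t)"
    "cmul ((f \<otimes>\<^sub>J g) t) (v t) =
      complex_of_real (1/2) *s (cmul (f t) (cmul (g t) (v t)) + cmul (g t) (cmul (f t) (v t)))"
proof -
  have *: "v t = 0 \<or> 0 \<le> t \<and> t \<le> 1" using v by (auto simp: l2_space_simps)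
  show "cmul ((f \<oplus>\<^sub>J g) t) (v t) = cmul (f t) (v t) + cmul (g t) (v t)"
    using * by (elim disjE conjE) (simp_all only: J_apply cmul_simps, simp_all)
  show "cmul ((r \<odot>\<^sub>J f) t) (v t) = complex_of_real r *s cmul (f t) (v t)"
    using * by (elim disjE conjE) (simp_all only: J_apply cmul_simps, simp_all)
  show "cmul ((f \<otimes>\<^sub>J g) t) (v t) =
      complex_of_real (1/2) *s (cmul (f t) (cmul (g t) (v t)) + cmul (g t) (cmul (f t) (v t)))"
    using * by (elim disjE conjE) (simp_all only: J_apply cmul_simps, simp_all)
qed

lemma J_op_hom: "J_op \<in> jordan_hom J_alg (BH_sa l2_space)"
  unfolding jordan_hom_def linear_maps_def mem_Collect_eq
proof (intro conjI ballI allI funcsetI)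
  fix f assume f: "f \<in> J"
  show "J_op f \<in> carrier (BH_sa l2_space)"
    using J_op_sa[OF f] by (simp add: l2.BH_sa_simps)
  show "J_op (r \<odot>\<^sub>J f) = r \<odot>\<^bsub>BH_sa l2_space\<^esub> J_op f" for r
    unfolding l2.BH_sa_simps J_op_def[of "r \<odot>\<^sub>J f"]
    by (rule restrict_ext) (simp only: J_op_apply l2_space_simps(4) cmul_J_ops)
  fix g assume g: "g \<in> J"
  show "J_op (f \<oplus>\<^sub>J g) = J_op f \<oplus>\<^bsub>BH_sa l2_space\<^esub> J_op g"
    unfolding l2.BH_sa_simps J_op_def[of "f \<oplus>\<^sub>J g"]
    by (rule restrict_ext) (simp only: J_op_apply l2_space_simps(3) cmul_J_ops)
  show "J_op (f \<otimes>\<^sub>J g) = J_op f \<otimes>\<^bsub>BH_sa l2_space\<^esub> J_op g"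
    unfolding l2.BH_sa_simps J_op_def[of "f \<otimes>\<^sub>J g"]
  proof (rule restrict_ext)
    fix v assume v: "v \<in> L2"
    show "(\<lambda>t. cmul ((f \<otimes>\<^sub>J g) t) (v t)) =
      complex_of_real (1/2) \<odot>\<^sub>2 (J_op f (J_op g v) \<oplus>\<^sub>2 J_op g (J_op f v))"
      unfolding J_op_apply[OF J_op_closed(1)[OF f v]] J_op_apply[OF J_op_closed(1)[OF g v]]
      by (simp only: J_op_apply[OF v] l2_space_simps(3,4) cmul_J_ops(3)[OF v])
  qed
qed

lemma J_jc_algebra: "jc_algebra TYPE(real \<Rightarrow> complex^2) J_alg"
proof -
  have jb: "jb_algebra J_alg"
    using J_unital_jb_algebra by (rule unital_jb_algebra.axioms(1))
  show ?thesis
    unfolding jc_algebra_def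
    by (intro conjI jb exI[of _ l2_space] exI[of _ "J_op ` J"] exI[of _ J_op] ballI
        l2_space_hilbert l2.isometric_image_norm_closed[OF jb J_op_hom J_op_nrm] J_op_nrm)
qed

theorem theorem5p2:
  shows "jc_algebra TYPE(real \<Rightarrow> complex^2) J_alg \<and>
    free_unital_jb_algebra TYPE('b) 2 J_alg J_gens \<and>
    (\<forall>(F :: 'b normed_alg) u.
       free_unital_jb_algebra TYPE('b) 2 F u \<and>
       free_unital_jb_algebra TYPE(real \<Rightarrow> real^2^2) 2 F u \<longrightarrow>
       (\<exists>\<phi>\<in>jordan_iso F J_alg. \<forall>i\<in>{1..2}. \<phi> (u i) = J_gens i))"
  \<comment> \<open>\<open>J_free\<close> is polymorphic in the test type and enters twice: once at
    the element type of the matrix algebra and once at that of \<open>F\<close>.\<close>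
  using J_jc_algebra J_free free_unital_jb_algebra_unique[OF _ _ J_free J_free]
  by (intro conjI allI impI) (assumption | elim conjE)+

end
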